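(* Let $G$ be a simple graph with vertex set $\Pi$, let $\mathfrak{g}$ be the Kac-Moody algebra with Dynkin diagram $G$ and $W(\mathfrak{g})$ its Weyl group, and let $\beta:=\beta(\Pi)=\sum_{\alpha\in\Pi}\alpha$. (1) The number of acyclic orientations of $G$ equals $K(\beta)$, where $K(\cdot)$ is the Kostant partition function of $\mathfrak{g}$. In other words, the number of distinct Coxeter elements in $W(\mathfrak{g})$ equals $\dim\,(U\mathfrak{n}^{+})_\beta$. (2) If $G$ is connected, then the number of conjugacy classes of Coxeter elements in $W(\mathfrak{g})$ equals $\dim\,\mathfrak{n}^{+}_\beta$ $(=\operatorname{mult}\beta)$.
   Context: $G$ is a simple graph on $l$ vertices, not assumed connected unless stated. Let $A$ be its adjacency matrix and $B:=2I-A$, a symmetric generalized Cartan matrix. $\mathfrak{g}$ is the complex Kac-Moody Lie algebra constructed from $B$ (generated by a Cartan subalgebra $\mathfrak{h}$ from a minimal realization of $B$ and Chevalley generators $e_i,f_i$ subject to the Chevalley-Serre relations). Its root space decomposition is $\mathfrak{g}=\mathfrak{h}\oplus\bigoplus_{\alpha\in\Delta_+}(\mathfrak{g}_\alpha\oplus\mathfrak{g}_{-\alpha})$ with $\Delta_+$ the set of positive roots; $\operatorname{mult}\alpha:=\dim\mathfrak{g}_\alpha$; $\mathfrak{n}^{+}:=\bigoplus_{\alpha\in\Delta_+}\mathfrak{g}_\alpha$. The set $\Pi$ of simple roots is identified with the vertex set of $G$. $U\mathfrak{n}^{+}$ is the universal enveloping algebra of $\mathfrak{n}^{+}$; $(U\mathfrak{n}^{+})_\beta$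 and $\mathfrak{n}^{+}_\beta$ are the $\beta$-weight spaces for the action of $\mathfrak{h}$. The Kostant partition function value $K(\beta)$ is the coefficient of $e^\beta$ in $\prod_{\alpha\in\Delta_+}(1-e^{\alpha})^{-\operatorname{mult}\alpha}$. The Weyl group $W(\mathfrak{g})$ is the subgroup of $\mathrm{GL}(\mathfrak{h}^* )$ generated by the simple reflections $s_\alpha$, $\alpha\in\Pi$. A Coxeter element is a product of all the simple reflections, each occurring exactly once, in some order. Conjugacy is in $W(\mathfrak{g})$. *)

theory Defs
  imports
    "HOL-Analysis.Analysis"
    "HOL-Algebra.Generated_Groups"
    "Jordan_Normal_Form.Missing_VectorSpace"
begin

section \<open>Graphs, generalized Cartan matrices, minimal realizations\<close>

text \<open>A finite simple graph is a symmetric irreflexive relation \<open>E\<close> on a finite vertex type \<open>'v\<close>.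
  An orientation picks exactly one of the two arcs over every edge.\<close>

definition is_orientation :: "('v \<Rightarrow> 'v \<Rightarrow> bool) \<Rightarrow> ('v \<times> 'v) set \<Rightarrow> bool" where
  "is_orientation E D \<longleftrightarrow>
     (\<forall>u v. (u, v) \<in> D \<longrightarrow> E u v) \<and>
     (\<forall>u v. E u v \<longrightarrow> ((u, v) \<in> D \<longleftrightarrow> (v, u) \<notin> D))"

definition acyclic_orientations :: "('v \<Rightarrow> 'v \<Rightarrow> bool) \<Rightarrow> ('v \<times> 'v) set set" where
  "acyclic_orientations E = {D. is_orientation E D \<and> acyclic D}"

definition connected_graph :: "('v \<Rightarrow> 'v \<Rightarrow> bool) \<Rightarrow> bool" where
  "connected_graph E \<longleftrightarrow> (\<forall>u v. E\<^sup>*\<^sup>* u v)"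

definition adjacency_matrix :: "('v::finite \<Rightarrow> 'v \<Rightarrow> bool) \<Rightarrow> int^'v^'v" where
  "adjacency_matrix E = (\<chi> i j. if E i j then 1 else 0)"

definition cartan_matrix :: "('v::finite \<Rightarrow> 'v \<Rightarrow> bool) \<Rightarrow> int^'v^'v" where
  "cartan_matrix E = mat 2 - adjacency_matrix E"

text \<open>The Cartan subalgebra \<open>\<hh>\<close> is \<open>\<complex>\<^sup>d\<close>; its dual \<open>\<hh>\<^sup>*\<close> is identified with \<open>\<complex>\<^sup>d\<close> through the following
  (bilinear, not sesquilinear) pairing, the first argument being the functional.\<close>

definition pairing :: "complex^'d \<Rightarrow> complex^'d \<Rightarrow> complex" where
  "pairing \<mu> h = (\<Sum>k\<in>UNIV. \<mu> $ k * h $ k)"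

text \<open>\<open>\<alpha> i \<in> \<hh>\<^sup>*\<close> are the simple roots and \<open>\<alpha>v i \<in> \<hh>\<close> the simple coroots; minimality is the
  condition \<open>dim \<hh> = 2n - rank B\<close>.\<close>

definition minimal_realization ::
    "int^'v^'v \<Rightarrow> ('v::finite \<Rightarrow> complex^'d) \<Rightarrow> ('v \<Rightarrow> complex^'d) \<Rightarrow> bool" where
  "minimal_realization B \<alpha> \<alpha>v \<longleftrightarrow>
     inj \<alpha> \<and> vec.independent (range \<alpha>) \<and>
     inj \<alpha>v \<and> vec.independent (range \<alpha>v) \<and>
     (\<forall>i j. pairing (\<alpha> j) (\<alpha>v i) = of_int (B $ i $ j)) \<and>
     CARD('d) + rank (\<chi> i j. of_int (B $ i $ j) :: complex^'v^'v) = 2 * CARD('v)"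


section \<open>Complex algebras by generators and relations\<close>

definition complex_field :: "complex ring" where
  "complex_field = \<lparr>carrier = UNIV, mult = (*), one = 1, zero = 0, add = (+)\<rparr>"

datatype 'x alg_term =
    Gen 'x
  | Zero
  | Add "'x alg_term" "'x alg_term"
  | Scale complex "'x alg_term"
  | Mult "'x alg_term" "'x alg_term"

text \<open>The least congruence containing \<open>R\<close> that makes the terms a complex vector space with a
  bilinear product.  No associativity, unit or Lie law is built in; those are put into \<open>R\<close>.\<close>

inductive_set alg_cong :: "('x alg_term \<times> 'x alg_term) set \<Rightarrow> ('x alg_term \<times> 'x alg_term) set"
  for R where
  rel: "(s, t) \<in> R \<Longrightarrow> (s, t) \<in> alg_cong R"
| refl: "(t, t) \<in> alg_cong R"
| sym: "(s, t) \<in> alg_cong R \<Longrightarrow> (t, s) \<in> alg_cong R"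
| trans: "(s, t) \<in> alg_cong R \<Longrightarrow> (t, u) \<in> alg_cong R \<Longrightarrow> (s, u) \<in> alg_cong R"
| Add: "(s, s') \<in> alg_cong R \<Longrightarrow> (t, t') \<in> alg_cong R \<Longrightarrow> (Add s t, Add s' t') \<in> alg_cong R"
| Scale: "(t, t') \<in> alg_cong R \<Longrightarrow> (Scale c t, Scale c t') \<in> alg_cong R"
| Mult: "(s, s') \<in> alg_cong R \<Longrightarrow> (t, t') \<in> alg_cong R \<Longrightarrow> (Mult s t, Mult s' t') \<in> alg_cong R"
| Add_assoc: "(Add (Add s t) u, Add s (Add t u)) \<in> alg_cong R"
| Add_comm: "(Add s t, Add t s) \<in> alg_cong R"
| Add_Zero: "(Add Zero t, t) \<in> alg_cong R"
| Scale_Add: "(Scale c (Add s t), Add (Scale c s) (Scale c t)) \<in> alg_cong R"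
| Add_Scale: "(Scale (c + d) t, Add (Scale c t) (Scale d t)) \<in> alg_cong R"
| Scale_Scale: "(Scale c (Scale d t), Scale (c * d) t) \<in> alg_cong R"
| Scale_one: "(Scale 1 t, t) \<in> alg_cong R"
| Scale_zero: "(Scale 0 t, Zero) \<in> alg_cong R"
| Mult_Add_left: "(Mult (Add s t) u, Add (Mult s u) (Mult t u)) \<in> alg_cong R"
| Mult_Add_right: "(Mult u (Add s t), Add (Mult u s) (Mult u t)) \<in> alg_cong R"
| Mult_Scale_left: "(Mult (Scale c s) t, Scale c (Mult s t)) \<in> alg_cong R"
| Mult_Scale_right: "(Mult s (Scale c t), Scale c (Mult s t)) \<in> alg_cong R"

definition alg_class :: "('x alg_term \<times> 'x alg_term) set \<Rightarrow> 'x alg_term \<Rightarrow> 'x alg_term set" where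
  "alg_class R t = alg_cong R `` {t}"

text \<open>The algebra generated by \<open>X\<close> subject to the relations \<open>R\<close>, as a quotient of the terms over \<open>X\<close>.
  It is an \<open>HOL-Algebra\<close> module record whose field \<open>mult\<close> is the product (a Lie bracket in the
  Lie algebras below); \<open>one\<close> is not specified.  The classes themselves also contain terms with
  generators outside \<open>X\<close>.  When \<open>R\<close> consists of algebra laws and relations between terms over \<open>X\<close>
  this identifies no further terms over \<open>X\<close>: replace the other generators by \<open>Zero\<close>.\<close>

definition presented_algebra ::
    "'x set \<Rightarrow> ('x alg_term \<times> 'x alg_term) set \<Rightarrow> (complex, 'x alg_term set) module" where
  "presented_algebra X R =
     \<lparr>carrier = {t. set_alg_term t \<subseteq> X} // alg_cong R,
      mult = (\<lambda>x y. \<Union>s\<in>x. \<Union>t\<in>y. alg_class R (Mult s t)),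
      one = undefined,
      zero = alg_class R Zero,
      add = (\<lambda>x y. \<Union>s\<in>x. \<Union>t\<in>y. alg_class R (Add s t)),
      smult = (\<lambda>c x. \<Union>t\<in>x. alg_class R (Scale c t))\<rparr>"

lemma equiv_alg_cong: "equiv UNIV (alg_cong R)"
  by (rule equivI) (auto simp: refl_on_def sym_def trans_def intro: alg_cong.refl alg_cong.sym alg_cong.trans)

lemma alg_class_eq_iff: "alg_class R s = alg_class R t \<longleftrightarrow> (s, t) \<in> alg_cong R"
  unfolding alg_class_def by (rule eq_equiv_class_iff[OF equiv_alg_cong]) auto

lemma carrier_presented_algebra:
  "carrier (presented_algebra X R) = alg_class R ` {t. set_alg_term t \<subseteq> X}"
  by (auto simp: presented_algebra_def alg_class_def quotient_def)

lemma alg_class_in_carrier: "set_alg_term t \<subseteq> X \<Longrightarrow> alg_class R t \<in> carrier (presented_algebra X R)"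
  by (auto simp: carrier_presented_algebra)

lemma presented_algebra_cases:
  assumes "x \<in> carrier (presented_algebra X R)"
  obtains t where "x = alg_class R t" "set_alg_term t \<subseteq> X"
  using assms by (auto simp: carrier_presented_algebra)

lemma UN_alg_class:
  assumes "\<And>s'. (s, s') \<in> alg_cong R \<Longrightarrow> F s' = F s"
  shows "(\<Union>s'\<in>alg_class R s. F s') = F s"
proof -
  have "(\<Union>s'\<in>alg_class R s. F s') = (\<Union>s'\<in>alg_class R s. F s)"
    by (rule SUP_cong) (simp_all add: alg_class_def assms)
  moreover have "s \<in> alg_class R s"
    by (simp add: alg_class_def alg_cong.refl)
  ultimately show ?thesis
    by auto
qed

lemma UN_alg_class2:
  assumes "\<And>s' t'. (s, s') \<in> alg_cong R \<Longrightarrow> (t, t') \<in> alg_cong R \<Longrightarrow> F s' t' = F s t"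
  shows "(\<Union>s'\<in>alg_class R s. \<Union>t'\<in>alg_class R t. F s' t') = F s t"
proof -
  have "(\<Union>t'\<in>alg_class R t. F s' t') = F s t" if "(s, s') \<in> alg_cong R" for s'
    using UN_alg_class[of t R "F s'"] assms[OF that] assms[OF that alg_cong.refl] by simp
  then show ?thesis
    using UN_alg_class[of s R "\<lambda>s'. \<Union>t'\<in>alg_class R t. F s' t'"] alg_cong.refl[of s R] by simp
qed

lemma presented_algebra_ops:
  "alg_class R s \<oplus>\<^bsub>presented_algebra X R\<^esub> alg_class R t = alg_class R (Add s t)"
  "alg_class R s \<otimes>\<^bsub>presented_algebra X R\<^esub> alg_class R t = alg_class R (Mult s t)"
  "c \<odot>\<^bsub>presented_algebra X R\<^esub> alg_class R t = alg_class R (Scale c t)"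
  "\<zero>\<^bsub>presented_algebra X R\<^esub> = alg_class R Zero"
proof -
  have "(\<Union>s'\<in>alg_class R s. \<Union>t'\<in>alg_class R t. alg_class R (Add s' t')) = alg_class R (Add s t)"
    by (rule UN_alg_class2) (simp add: alg_class_eq_iff alg_cong.Add alg_cong.sym)
  then show "alg_class R s \<oplus>\<^bsub>presented_algebra X R\<^esub> alg_class R t = alg_class R (Add s t)"
    by (simp add: presented_algebra_def)
  have "(\<Union>s'\<in>alg_class R s. \<Union>t'\<in>alg_class R t. alg_class R (Mult s' t')) = alg_class R (Mult s t)"
    by (rule UN_alg_class2) (simp add: alg_class_eq_iff alg_cong.Mult alg_cong.sym)
  then show "alg_class R s \<otimes>\<^bsub>presented_algebra X R\<^esub> alg_class R t = alg_class R (Mult s t)"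
    by (simp add: presented_algebra_def)
  have "(\<Union>t'\<in>alg_class R t. alg_class R (Scale c t')) = alg_class R (Scale c t)"
    by (rule UN_alg_class) (simp add: alg_class_eq_iff alg_cong.Scale alg_cong.sym)
  then show "c \<odot>\<^bsub>presented_algebra X R\<^esub> alg_class R t = alg_class R (Scale c t)"
    by (simp add: presented_algebra_def)
qed (simp add: presented_algebra_def)

lemma field_complex_field: "Ring.field complex_field"
proof -
  have "abelian_group complex_field"
  proof (rule abelian_groupI)
    show "\<exists>y\<in>carrier complex_field. y \<oplus>\<^bsub>complex_field\<^esub> x = \<zero>\<^bsub>complex_field\<^esub>" for x
      by (rule bexI[of _ "- x"]) (simp_all add: complex_field_def)
  qed (simp_all add: complex_field_def)
  moreover have "Group.comm_monoid complex_field"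
    by (rule comm_monoidI) (simp_all add: complex_field_def)
  ultimately have "cring complex_field"
    by (rule cringI) (simp add: complex_field_def distrib_right)
  then show ?thesis
  proof (rule cring.cring_fieldI2)
    show "\<exists>b\<in>carrier complex_field. a \<otimes>\<^bsub>complex_field\<^esub> b = \<one>\<^bsub>complex_field\<^esub>"
      if "a \<noteq> \<zero>\<^bsub>complex_field\<^esub>" for a
      using that by (intro bexI[of _ "inverse a"]) (simp_all add: complex_field_def)
  qed (simp add: complex_field_def)
qed

lemma abelian_group_presented_algebra: "abelian_group (presented_algebra X R)"
  (is "abelian_group ?V")
proof (rule abelian_groupI)
  fix x assume "x \<in> carrier ?V"
  then obtain t where t: "x = alg_class R t" "set_alg_term t \<subseteq> X"
    by (rule presented_algebra_cases)
  have "(Add (Scale (-1) t) t, Add (Scale (-1) t) (Scale 1 t)) \<in> alg_cong R"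
    by (intro alg_cong.Add alg_cong.refl alg_cong.sym[OF alg_cong.Scale_one])
  moreover have "(Add (Scale (-1) t) (Scale 1 t), Scale (-1 + 1) t) \<in> alg_cong R"
    by (rule alg_cong.sym[OF alg_cong.Add_Scale])
  moreover have "(Scale (-1 + 1) t, Zero) \<in> alg_cong R"
    by (simp add: alg_cong.Scale_zero)
  ultimately have "(Add (Scale (-1) t) t, Zero) \<in> alg_cong R"
    by (meson alg_cong.trans)
  then show "\<exists>y\<in>carrier ?V. y \<oplus>\<^bsub>?V\<^esub> x = \<zero>\<^bsub>?V\<^esub>"
    using t by (intro bexI[of _ "alg_class R (Scale (-1) t)"])
      (simp_all add: presented_algebra_ops alg_class_eq_iff alg_class_in_carrier)
qed (auto elim!: presented_algebra_cases del: equalityI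
       simp: presented_algebra_ops alg_class_eq_iff alg_class_in_carrier
         alg_cong.Add_assoc alg_cong.Add_comm alg_cong.Add_Zero)

lemma vectorspace_presented_algebra: "vectorspace complex_field (presented_algebra X R)"
proof -
  have "cring complex_field"
    using field_complex_field by (simp add: field_def domain_def)
  then have "Module.module complex_field (presented_algebra X R)"
    using abelian_group_presented_algebra
    by (rule moduleI)
       (auto elim!: presented_algebra_cases del: equalityI
          simp: presented_algebra_ops alg_class_eq_iff alg_class_in_carrier complex_field_def
            alg_cong.Scale_Add alg_cong.Add_Scale alg_cong.sym[OF alg_cong.Scale_Scale]
            alg_cong.Scale_one)
  then show ?thesis
    using field_complex_field by (rule vectorspace.intro)
qed

definition lie_laws :: "('x alg_term \<times> 'x alg_term) set" where
  "lie_laws =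
     {(Mult t t, Zero) | t. True} \<union>
     {(Add (Mult s (Mult t u)) (Add (Mult t (Mult u s)) (Mult u (Mult s t))), Zero) | s t u. True}"

definition presented_lie_algebra ::
    "('x alg_term \<times> 'x alg_term) set \<Rightarrow> (complex, 'x alg_term set) module" where
  "presented_lie_algebra R = presented_algebra UNIV (lie_laws \<union> R)"

lemma presented_lie_algebra_laws:
  fixes R
  defines "L \<equiv> presented_lie_algebra R"
  assumes "x \<in> carrier L" "y \<in> carrier L" "z \<in> carrier L"
  shows "x \<otimes>\<^bsub>L\<^esub> y \<in> carrier L"
    and "(x \<oplus>\<^bsub>L\<^esub> y) \<otimes>\<^bsub>L\<^esub> z = x \<otimes>\<^bsub>L\<^esub> z \<oplus>\<^bsub>L\<^esub> y \<otimes>\<^bsub>L\<^esub> z"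
    and "(c \<odot>\<^bsub>L\<^esub> x) \<otimes>\<^bsub>L\<^esub> y = c \<odot>\<^bsub>L\<^esub> (x \<otimes>\<^bsub>L\<^esub> y)"
    and "x \<otimes>\<^bsub>L\<^esub> x = \<zero>\<^bsub>L\<^esub>"
    and "x \<otimes>\<^bsub>L\<^esub> (y \<otimes>\<^bsub>L\<^esub> z) \<oplus>\<^bsub>L\<^esub> (y \<otimes>\<^bsub>L\<^esub> (z \<otimes>\<^bsub>L\<^esub> x) \<oplus>\<^bsub>L\<^esub> z \<otimes>\<^bsub>L\<^esub> (x \<otimes>\<^bsub>L\<^esub> y)) = \<zero>\<^bsub>L\<^esub>"
proof -
  obtain r s t where "x = alg_class (lie_laws \<union> R) r" "y = alg_class (lie_laws \<union> R) s"
      "z = alg_class (lie_laws \<union> R) t"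
    using assms(2-4) unfolding L_def presented_lie_algebra_def by (auto elim!: presented_algebra_cases)
  moreover have "(Mult r r, Zero) \<in> alg_cong (lie_laws \<union> R)"
      "(Add (Mult r (Mult s t)) (Add (Mult s (Mult t r)) (Mult t (Mult r s))), Zero) \<in> alg_cong (lie_laws \<union> R)"
    by (rule alg_cong.rel, force simp: lie_laws_def)+
  ultimately show "x \<otimes>\<^bsub>L\<^esub> y \<in> carrier L"
    and "(x \<oplus>\<^bsub>L\<^esub> y) \<otimes>\<^bsub>L\<^esub> z = x \<otimes>\<^bsub>L\<^esub> z \<oplus>\<^bsub>L\<^esub> y \<otimes>\<^bsub>L\<^esub> z"
    and "(c \<odot>\<^bsub>L\<^esub> x) \<otimes>\<^bsub>L\<^esub> y = c \<odot>\<^bsub>L\<^esub> (x \<otimes>\<^bsub>L\<^esub> y)"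
    and "x \<otimes>\<^bsub>L\<^esub> x = \<zero>\<^bsub>L\<^esub>"
    and "x \<otimes>\<^bsub>L\<^esub> (y \<otimes>\<^bsub>L\<^esub> z) \<oplus>\<^bsub>L\<^esub> (y \<otimes>\<^bsub>L\<^esub> (z \<otimes>\<^bsub>L\<^esub> x) \<oplus>\<^bsub>L\<^esub> z \<otimes>\<^bsub>L\<^esub> (x \<otimes>\<^bsub>L\<^esub> y)) = \<zero>\<^bsub>L\<^esub>"
    by (simp_all add: L_def presented_lie_algebra_def presented_algebra_ops alg_class_eq_iff
          alg_class_in_carrier alg_cong.Mult_Add_left alg_cong.Mult_Scale_left)
qed


section \<open>Universal enveloping algebras\<close>

datatype 'l uea_gen = Unit | Inc 'l

definition unital_associative_laws :: "('l uea_gen alg_term \<times> 'l uea_gen alg_term) set" where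
  "unital_associative_laws =
     {(Mult (Mult s t) u, Mult s (Mult t u)) | s t u. True} \<union>
     {(Mult (Gen Unit) t, t) | t. True} \<union> {(Mult t (Gen Unit), t) | t. True}"

definition uea_relations ::
    "(complex, 'l) module \<Rightarrow> ('l uea_gen alg_term \<times> 'l uea_gen alg_term) set" where
  "uea_relations L =
     {(Gen (Inc (x \<oplus>\<^bsub>L\<^esub> y)), Add (Gen (Inc x)) (Gen (Inc y))) | x y. x \<in> carrier L \<and> y \<in> carrier L} \<union>
     {(Gen (Inc (c \<odot>\<^bsub>L\<^esub> x)), Scale c (Gen (Inc x))) | c x. x \<in> carrier L} \<union>
     {(Gen (Inc (x \<otimes>\<^bsub>L\<^esub> y)),
       Add (Mult (Gen (Inc x)) (Gen (Inc y))) (Scale (-1) (Mult (Gen (Inc y)) (Gen (Inc x)))))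
      | x y. x \<in> carrier L \<and> y \<in> carrier L}"

definition uea_cong_rel ::
    "(complex, 'l) module \<Rightarrow> ('l uea_gen alg_term \<times> 'l uea_gen alg_term) set" where
  "uea_cong_rel L = unital_associative_laws \<union> uea_relations L"

definition uea :: "(complex, 'l) module \<Rightarrow> (complex, 'l uea_gen alg_term set) module" where
  "uea L = (presented_algebra (insert Unit (Inc ` carrier L)) (uea_cong_rel L))
     \<lparr>one := alg_class (uea_cong_rel L) (Gen Unit)\<rparr>"

primrec leibniz :: "('x \<Rightarrow> 'x alg_term) \<Rightarrow> 'x alg_term \<Rightarrow> 'x alg_term" where
  "leibniz \<delta> (Gen x) = \<delta> x"
| "leibniz \<delta> Zero = Zero"
| "leibniz \<delta> (Add s t) = Add (leibniz \<delta> s) (leibniz \<delta> t)"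
| "leibniz \<delta> (Scale c t) = Scale c (leibniz \<delta> t)"
| "leibniz \<delta> (Mult s t) = Add (Mult (leibniz \<delta> s) t) (Mult s (leibniz \<delta> t))"

lemma leibniz_cong:
  assumes R: "\<And>s t. (s, t) \<in> R \<Longrightarrow> (leibniz \<delta> s, leibniz \<delta> t) \<in> alg_cong R"
    and "(s, t) \<in> alg_cong R"
  shows "(leibniz \<delta> s, leibniz \<delta> t) \<in> alg_cong R"
proof -
  let ?A = "presented_algebra UNIV R"
  interpret A: vectorspace complex_field ?A
    by (rule vectorspace_presented_algebra)
  have [simp]: "alg_class R t \<in> carrier ?A" for t
    by (simp add: alg_class_in_carrier)
  have Add: "alg_class R (Add s t) = alg_class R s \<oplus>\<^bsub>?A\<^esub> alg_class R t" for s t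
    by (simp add: presented_algebra_ops)
  have Scale: "alg_class R (Scale c t) = c \<odot>\<^bsub>?A\<^esub> alg_class R t" for c t
    by (simp add: presented_algebra_ops)
  have Mult: "alg_class R (Mult (Add s t) u) = alg_class R (Mult s u) \<oplus>\<^bsub>?A\<^esub> alg_class R (Mult t u)"
      "alg_class R (Mult u (Add s t)) = alg_class R (Mult u s) \<oplus>\<^bsub>?A\<^esub> alg_class R (Mult u t)"
      "alg_class R (Mult (Scale c s) t) = c \<odot>\<^bsub>?A\<^esub> alg_class R (Mult s t)"
      "alg_class R (Mult s (Scale c t)) = c \<odot>\<^bsub>?A\<^esub> alg_class R (Mult s t)" for s t u c
    by (simp_all add: presented_algebra_ops alg_class_eq_iff alg_cong.Mult_Add_left
          alg_cong.Mult_Add_right alg_cong.Mult_Scale_left alg_cong.Mult_Scale_right)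
  have [simp]: "c \<in> carrier complex_field" for c
    by (simp add: complex_field_def)
  show ?thesis
    using assms(2)
  proof (induction)
    case (Mult_Add_left s t u)
    then show ?case by (simp flip: alg_class_eq_iff add: Add Scale Mult A.a_ac)
  next
    case (Mult_Add_right u s t)
    then show ?case by (simp flip: alg_class_eq_iff add: Add Scale Mult A.a_ac)
  next
    case (Mult_Scale_left c s t)
    then show ?case by (simp flip: alg_class_eq_iff add: Add Scale Mult A.smult_r_distr)
  next
    case (Mult_Scale_right s c t)
    then show ?case by (simp flip: alg_class_eq_iff add: Add Scale Mult A.smult_r_distr)
  next
    case (trans s t u)
    show ?case by (rule alg_cong.trans[OF trans.IH])
  next
    case (sym s t)
    show ?case by (rule alg_cong.sym[OF sym.IH])
  qed (simp_all add: R alg_cong.refl alg_cong.Add alg_cong.Scale alg_cong.Mult alg_cong.Add_assoc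
         alg_cong.Add_comm alg_cong.Add_Zero alg_cong.Scale_Add alg_cong.Add_Scale
         alg_cong.Scale_Scale alg_cong.Scale_one alg_cong.Scale_zero)
qed

text \<open>The derivation of the enveloping algebra of \<open>L\<close> that extends a derivation \<open>d\<close> of \<open>L\<close>;
  by \<open>leibniz_cong\<close> it does not depend on the term representing \<open>u\<close>.\<close>

definition uea_derivation ::
    "(complex, 'l) module \<Rightarrow> ('l \<Rightarrow> 'l) \<Rightarrow> 'l uea_gen alg_term set \<Rightarrow> 'l uea_gen alg_term set" where
  "uea_derivation L d u =
     (\<Union>t\<in>u. alg_class (uea_cong_rel L)
        (leibniz (\<lambda>x. case x of Unit \<Rightarrow> Zero | Inc y \<Rightarrow> Gen (Inc (d y))) t))"


section \<open>Kac-Moody algebras\<close>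

datatype ('d, 'v) km_gen = Hgen "complex^'d" | Egen 'v | Fgen 'v

type_synonym ('d, 'v) km_elem = "('d, 'v) km_gen alg_term set"

text \<open>\<open>Hgen\<close>, \<open>Egen\<close>, \<open>Fgen\<close> are the generators usually written \<open>h\<close>, \<open>e\<^sub>i\<close>, \<open>f\<^sub>i\<close>.  Besides the Chevalley-Serre relations, the first two families make \<open>h \<mapsto> Gen (Hgen h)\<close> linear.\<close>

inductive_set km_relations ::
    "int^'v^'v \<Rightarrow> ('v::finite \<Rightarrow> complex^'d) \<Rightarrow> ('v \<Rightarrow> complex^'d) \<Rightarrow>
     (('d, 'v) km_gen alg_term \<times> ('d, 'v) km_gen alg_term) set"
  for B \<alpha> \<alpha>v where
  H_add: "(Gen (Hgen (h + h')), Add (Gen (Hgen h)) (Gen (Hgen h'))) \<in> km_relations B \<alpha> \<alpha>v"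
| H_scale: "(Gen (Hgen (c *s h)), Scale c (Gen (Hgen h))) \<in> km_relations B \<alpha> \<alpha>v"
| H_H: "(Mult (Gen (Hgen h)) (Gen (Hgen h')), Zero) \<in> km_relations B \<alpha> \<alpha>v"
| H_e: "(Mult (Gen (Hgen h)) (Gen (Egen i)), Scale (pairing (\<alpha> i) h) (Gen (Egen i))) \<in> km_relations B \<alpha> \<alpha>v"
| H_f: "(Mult (Gen (Hgen h)) (Gen (Fgen i)), Scale (- pairing (\<alpha> i) h) (Gen (Fgen i))) \<in> km_relations B \<alpha> \<alpha>v"
| e_f: "(Mult (Gen (Egen i)) (Gen (Fgen i)), Gen (Hgen (\<alpha>v i))) \<in> km_relations B \<alpha> \<alpha>v"
| e_f_neq: "i \<noteq> j \<Longrightarrow> (Mult (Gen (Egen i)) (Gen (Fgen j)), Zero) \<in> km_relations B \<alpha> \<alpha>v"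
| serre_e: "i \<noteq> j \<Longrightarrow>
    ((Mult (Gen (Egen i)) ^^ nat (1 - B $ i $ j)) (Gen (Egen j)), Zero) \<in> km_relations B \<alpha> \<alpha>v"
| serre_f: "i \<noteq> j \<Longrightarrow>
    ((Mult (Gen (Fgen i)) ^^ nat (1 - B $ i $ j)) (Gen (Fgen j)), Zero) \<in> km_relations B \<alpha> \<alpha>v"

definition kac_moody ::
    "int^'v^'v \<Rightarrow> ('v::finite \<Rightarrow> complex^'d) \<Rightarrow> ('v \<Rightarrow> complex^'d) \<Rightarrow>
     (complex, ('d, 'v) km_elem) module" where
  "kac_moody B \<alpha> \<alpha>v = presented_lie_algebra (km_relations B \<alpha> \<alpha>v)"

definition ad_h ::
    "int^'v^'v \<Rightarrow> ('v::finite \<Rightarrow> complex^'d) \<Rightarrow> ('v \<Rightarrow> complex^'d) \<Rightarrow>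
     complex^'d \<Rightarrow> ('d, 'v) km_elem \<Rightarrow> ('d, 'v) km_elem" where
  "ad_h B \<alpha> \<alpha>v h x =
     alg_class (lie_laws \<union> km_relations B \<alpha> \<alpha>v) (Gen (Hgen h)) \<otimes>\<^bsub>kac_moody B \<alpha> \<alpha>v\<^esub> x"

text \<open>The \<open>\<mu>\<close>-weight space of \<open>M\<close> under an action \<open>act\<close> of \<open>\<hh>\<close>, as a vector space of its own.\<close>

definition weight_space ::
    "(complex, 'm) module \<Rightarrow> (complex^'d \<Rightarrow> 'm \<Rightarrow> 'm) \<Rightarrow> complex^'d \<Rightarrow> (complex, 'm) module" where
  "weight_space M act \<mu> = M\<lparr>carrier := {x \<in> carrier M. \<forall>h. act h x = pairing \<mu> h \<odot>\<^bsub>M\<^esub> x}\<rparr>"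

definition root_space ::
    "int^'v^'v \<Rightarrow> ('v::finite \<Rightarrow> complex^'d) \<Rightarrow> ('v \<Rightarrow> complex^'d) \<Rightarrow>
     complex^'d \<Rightarrow> (complex, ('d, 'v) km_elem) module" where
  "root_space B \<alpha> \<alpha>v \<mu> = weight_space (kac_moody B \<alpha> \<alpha>v) (ad_h B \<alpha> \<alpha>v) \<mu>"

definition root_mult ::
    "int^'v^'v \<Rightarrow> ('v::finite \<Rightarrow> complex^'d) \<Rightarrow> ('v \<Rightarrow> complex^'d) \<Rightarrow> complex^'d \<Rightarrow> nat" where
  "root_mult B \<alpha> \<alpha>v \<mu> = vectorspace.dim complex_field (root_space B \<alpha> \<alpha>v \<mu>)"

text \<open>Elements of the positive cone of the root lattice are given by their coordinates in the
  (linearly independent) simple roots.\<close>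

definition root_lattice_vec :: "('v::finite \<Rightarrow> complex^'d) \<Rightarrow> ('v \<Rightarrow> nat) \<Rightarrow> complex^'d" where
  "root_lattice_vec \<alpha> c = (\<Sum>i\<in>UNIV. of_nat (c i) *s \<alpha> i)"

lemma root_lattice_vec_all_ones: "root_lattice_vec \<alpha> (\<lambda>_. 1) = (\<Sum>i\<in>UNIV. \<alpha> i)"
  by (simp add: root_lattice_vec_def)

definition positive_roots ::
    "int^'v^'v \<Rightarrow> ('v::finite \<Rightarrow> complex^'d) \<Rightarrow> ('v \<Rightarrow> complex^'d) \<Rightarrow> ('v \<Rightarrow> nat) set" where
  "positive_roots B \<alpha> \<alpha>v =
     {c. c \<noteq> (\<lambda>_. 0) \<and>
         carrier (root_space B \<alpha> \<alpha>v (root_lattice_vec \<alpha> c)) \<noteq> {\<zero>\<^bsub>kac_moody B \<alpha> \<alpha>v\<^esub>}}"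

definition n_plus ::
    "int^'v^'v \<Rightarrow> ('v::finite \<Rightarrow> complex^'d) \<Rightarrow> ('v \<Rightarrow> complex^'d) \<Rightarrow>
     (complex, ('d, 'v) km_elem) module" where
  "n_plus B \<alpha> \<alpha>v = (kac_moody B \<alpha> \<alpha>v)
     \<lparr>carrier := LinearCombinations.module.span complex_field (kac_moody B \<alpha> \<alpha>v)
        (\<Union>c\<in>positive_roots B \<alpha> \<alpha>v. carrier (root_space B \<alpha> \<alpha>v (root_lattice_vec \<alpha> c)))\<rparr>"

definition n_plus_weight_space ::
    "int^'v^'v \<Rightarrow> ('v::finite \<Rightarrow> complex^'d) \<Rightarrow> ('v \<Rightarrow> complex^'d) \<Rightarrow>
     complex^'d \<Rightarrow> (complex, ('d, 'v) km_elem) module" where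
  "n_plus_weight_space B \<alpha> \<alpha>v \<mu> = weight_space (n_plus B \<alpha> \<alpha>v) (ad_h B \<alpha> \<alpha>v) \<mu>"

definition uea_n_plus_weight_space ::
    "int^'v^'v \<Rightarrow> ('v::finite \<Rightarrow> complex^'d) \<Rightarrow> ('v \<Rightarrow> complex^'d) \<Rightarrow>
     complex^'d \<Rightarrow> (complex, ('d, 'v) km_elem uea_gen alg_term set) module" where
  "uea_n_plus_weight_space B \<alpha> \<alpha>v \<mu> =
     weight_space (uea (n_plus B \<alpha> \<alpha>v))
       (\<lambda>h. uea_derivation (n_plus B \<alpha> \<alpha>v) (ad_h B \<alpha> \<alpha>v h)) \<mu>"


section \<open>The Kostant partition function\<close>

text \<open>Formal power series with integer coefficients in the variables \<open>e\<^sup>\<alpha>\<close>, \<open>\<alpha>\<close> a simple root.\<close>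

typedef 'v mfps = "UNIV :: (('v \<Rightarrow> nat) \<Rightarrow> int) set"
  morphisms mfps_coeff Abs_mfps ..

setup_lifting type_definition_mfps

lemma mfps_eqI: "(\<And>c. mfps_coeff p c = mfps_coeff q c) \<Longrightarrow> p = q"
  by transfer auto

definition splits :: "('v \<Rightarrow> nat) \<Rightarrow> (('v \<Rightarrow> nat) \<times> ('v \<Rightarrow> nat)) set" where
  "splits c = {(a, b). (\<lambda>i. a i + b i) = c}"

lemma finite_splits [simp]: "finite (splits (c :: 'v::finite \<Rightarrow> nat))"
proof -
  have "finite (PiE UNIV (\<lambda>i::'v. {..c i}))"
    by (intro finite_PiE) auto
  moreover have "splits c \<subseteq> PiE UNIV (\<lambda>i. {..c i}) \<times> PiE UNIV (\<lambda>i. {..c i})"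
    by (auto simp: splits_def PiE_def extensional_def)
  ultimately show ?thesis
    by (meson finite_SigmaI finite_subset)
qed

instantiation mfps :: (finite) comm_ring_1
begin

lift_definition zero_mfps :: "'a mfps" is "\<lambda>_. 0" .
lift_definition one_mfps :: "'a mfps" is "\<lambda>c. if c = (\<lambda>_. 0) then 1 else 0" .
lift_definition plus_mfps :: "'a mfps \<Rightarrow> 'a mfps \<Rightarrow> 'a mfps" is "\<lambda>p q c. p c + q c" .
lift_definition minus_mfps :: "'a mfps \<Rightarrow> 'a mfps \<Rightarrow> 'a mfps" is "\<lambda>p q c. p c - q c" .
lift_definition uminus_mfps :: "'a mfps \<Rightarrow> 'a mfps" is "\<lambda>p c. - p c" .
lift_definition times_mfps :: "'a mfps \<Rightarrow> 'a mfps \<Rightarrow> 'a mfps"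
  is "\<lambda>p q c. \<Sum>(a, b)\<in>splits c. p a * q b" .

instance
proof
  fix p q r :: "'a mfps"
  show "p * q * r = p * (q * r)"
  proof (transfer, rule ext)
    fix p q r :: "('a \<Rightarrow> nat) \<Rightarrow> int" and c
    have "(\<Sum>(x, y)\<in>splits c. (\<Sum>(a, b)\<in>splits x. p a * q b) * r y)
        = (\<Sum>((x, y), (a, b))\<in>(SIGMA z:splits c. splits (fst z)). p a * q b * r y)"
      by (simp add: sum.Sigma sum_distrib_right case_prod_unfold)
    also have "\<dots> = (\<Sum>((x, y), (a, b))\<in>(SIGMA z:splits c. splits (snd z)). p x * (q a * r b))"
      by (rule sum.reindex_bij_witness
            [where i = "\<lambda>((x, y), (a, b)). ((\<lambda>i. x i + a i, b), (x, a))"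
               and j = "\<lambda>((x, y), (a, b)). ((a, \<lambda>i. b i + y i), (b, y))"])
         (auto simp: splits_def add.assoc)
    also have "\<dots> = (\<Sum>(x, y)\<in>splits c. p x * (\<Sum>(a, b)\<in>splits y. q a * r b))"
      by (simp add: sum.Sigma sum_distrib_left case_prod_unfold)
    finally show "(\<Sum>(x, y)\<in>splits c. (\<Sum>(a, b)\<in>splits x. p a * q b) * r y)
        = (\<Sum>(x, y)\<in>splits c. p x * (\<Sum>(a, b)\<in>splits y. q a * r b))" .
  qed
  show "p * q = q * p"
  proof (transfer, rule ext)
    fix p q :: "('a \<Rightarrow> nat) \<Rightarrow> int" and c
    show "(\<Sum>(a, b)\<in>splits c. p a * q b) = (\<Sum>(a, b)\<in>splits c. q a * p b)"
      by (rule sum.reindex_bij_witness[where i = prod.swap and j = prod.swap])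
         (auto simp: splits_def add.commute)
  qed
  show "1 * p = p"
  proof (transfer, rule ext)
    fix p :: "('a \<Rightarrow> nat) \<Rightarrow> int" and c
    have "(\<Sum>(a, b)\<in>splits c. (if a = (\<lambda>_. 0) then 1 else 0) * p b)
        = (\<Sum>(a, b)\<in>{(\<lambda>_::'a. 0::nat, c)}. (if a = (\<lambda>_. 0) then 1 else 0) * p b)"
      by (rule sum.mono_neutral_right[OF finite_splits]) (auto simp: splits_def split: if_splits)
    then show "(\<Sum>(a, b)\<in>splits c. (if a = (\<lambda>_. 0) then 1 else 0) * p b) = p c"
      by simp
  qed
  show "(p + q) * r = p * r + q * r"
    by transfer (auto simp: sum.distrib[symmetric] case_prod_unfold distrib_right intro!: ext sum.cong)
  show "(0 :: 'a mfps) \<noteq> 1"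
    by transfer (auto simp: fun_eq_iff)
qed (transfer; auto)+

end

lift_definition mfps_exp :: "('v \<Rightarrow> nat) \<Rightarrow> 'v mfps" is "\<lambda>a c. if c = a then 1 else 0" .

definition mfps_inverse :: "'v::finite mfps \<Rightarrow> 'v mfps" where
  "mfps_inverse p = (THE q. p * q = 1)"

lemma mfps_inverse_eqI:
  assumes "p * q = 1"
  shows "mfps_inverse p = q"
  unfolding mfps_inverse_def
proof (rule the_equality)
  fix r assume r: "p * r = 1"
  have "r = (p * q) * r" using assms by simp
  also have "\<dots> = q * (p * r)" by (simp only: ac_simps)
  finally show "r = q" using r by simp
qed (fact assms)

lemma mfps_coeff_exp_times:
  "mfps_coeff (mfps_exp a * p) c = (if \<forall>i. a i \<le> c i then mfps_coeff p (\<lambda>i. c i - a i) else 0)"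
proof (transfer fixing: a c)
  fix p :: "('a \<Rightarrow> nat) \<Rightarrow> int"
  have "(\<Sum>(x, y)\<in>splits c. (if x = a then 1 else 0) * p y)
      = (\<Sum>(x, y)\<in>splits c \<inter> {(a, \<lambda>i. c i - a i)}. (if x = a then 1 else 0) * p y)"
    by (rule sum.mono_neutral_right[OF finite_splits]) (auto simp: splits_def split: if_splits)
  also have "\<dots> = (if \<forall>i. a i \<le> c i then p (\<lambda>i. c i - a i) else 0)"
  proof (cases "\<forall>i. a i \<le> c i")
    case True
    then have "splits c \<inter> {(a, \<lambda>i. c i - a i)} = {(a, \<lambda>i. c i - a i)}"
      by (auto simp: splits_def)
    with True show ?thesis by simp
  next
    case False
    then have empty: "splits c \<inter> {(a, \<lambda>i. c i - a i)} = {}"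
      by (auto simp: splits_def) (metis le_add1)
    show ?thesis unfolding empty using False by auto
  qed
  finally show "(\<Sum>(x, y)\<in>splits c. (if x = a then 1 else 0) * p y)
      = (if \<forall>i. a i \<le> c i then p (\<lambda>i. c i - a i) else 0)" .
qed

lift_definition mfps_geometric :: "('v \<Rightarrow> nat) \<Rightarrow> 'v mfps"
  is "\<lambda>a c. if \<exists>k. c = (\<lambda>i. k * a i) then 1 else 0" .

lemma mfps_inverse_one_minus_exp:
  assumes "a \<noteq> (\<lambda>_. 0)"
  shows "mfps_inverse (1 - mfps_exp a) = mfps_geometric a"
proof (rule mfps_inverse_eqI, rule mfps_eqI)
  fix c
  have ge: "(\<forall>i. a i \<le> c i) \<and> (\<exists>k. (\<lambda>i. c i - a i) = (\<lambda>i. k * a i)) \<longleftrightarrow> (\<exists>k. c = (\<lambda>i. Suc k * a i))"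
    (is "?l \<longleftrightarrow> ?r")
  proof
    assume ?l
    then obtain k where k: "\<And>i. a i \<le> c i" "\<And>i. c i - a i = k * a i" by metis
    have "c i = Suc k * a i" for i using k(1)[of i] k(2)[of i] by simp
    then show ?r by blast
  next
    assume ?r
    then show ?l by auto
  qed
  have no: "\<not> (\<exists>k. c = (\<lambda>i. Suc k * a i))" if "c = (\<lambda>_. 0)"
    using assms that by (auto simp: fun_eq_iff)
  have ex: "(\<exists>k. c = (\<lambda>i. k * a i)) \<longleftrightarrow> c = (\<lambda>_. 0) \<or> (\<exists>k. c = (\<lambda>i. Suc k * a i))"
    by (metis mult_0 not0_implies_Suc)
  show "mfps_coeff ((1 - mfps_exp a) * mfps_geometric a) c = mfps_coeff 1 c"
  proof -
    have "mfps_coeff ((1 - mfps_exp a) * mfps_geometric a) c =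
        mfps_coeff (mfps_geometric a) c - mfps_coeff (mfps_exp a * mfps_geometric a) c"
      by (simp add: left_diff_distrib minus_mfps.rep_eq)
    then show ?thesis
      using ge no ex by (auto simp: mfps_coeff_exp_times mfps_geometric.rep_eq one_mfps.rep_eq)
  qed
qed

text \<open>The coefficient of \<open>e\<^sup>c\<close> in \<open>\<Prod>\<^sub>\<alpha> (1 - e\<^sup>\<alpha>)\<^bsup>-mult \<alpha>\<^esup>\<close>: the product ranges over a possibly
  infinite set of roots, and its coefficients are the eventually constant values of the
  coefficients of the finite subproducts.\<close>

definition kostant_partition ::
    "int^'v^'v \<Rightarrow> ('v::finite \<Rightarrow> complex^'d) \<Rightarrow> ('v \<Rightarrow> complex^'d) \<Rightarrow> ('v \<Rightarrow> nat) \<Rightarrow> int" where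
  "kostant_partition B \<alpha> \<alpha>v c =
     (THE k. \<forall>\<^sub>F S in finite_subsets_at_top (positive_roots B \<alpha> \<alpha>v).
        mfps_coeff (\<Prod>a\<in>S. mfps_inverse
          ((1 - mfps_exp a) ^ root_mult B \<alpha> \<alpha>v (root_lattice_vec \<alpha> a))) c = k)"


section \<open>The Weyl group and its Coxeter elements\<close>

definition GL :: "(complex^'d \<Rightarrow> complex^'d) monoid" where
  "GL = \<lparr>carrier = {w. Vector_Spaces.linear (*s) (*s) w \<and> bij w}, mult = (\<circ>), one = id\<rparr>"

lemma group_GL: "group GL"
proof (rule groupI)
  fix w :: "complex^'d \<Rightarrow> complex^'d" assume "w \<in> carrier GL"
  then have w: "Vector_Spaces.linear (*s) (*s) w" "bij w" by (auto simp: GL_def)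
  have w_inv: "w (inv_into UNIV w x) = x" for x
    using w(2) by (simp add: bij_is_surj surj_f_inv_f)
  have inv_eqI: "inv_into UNIV w x = y" if "w y = x" for x y
    using that w(2) by (auto simp: bij_is_inj)
  have "Vector_Spaces.linear (*s) (*s) (inv_into UNIV w)"
    unfolding Vector_Spaces.linear_iff
    by (auto intro!: inv_eqI vec.vector_space_axioms
          simp: vec.linear_add[OF w(1)] vec.linear_scale[OF w(1)] w_inv)
  then show "\<exists>v\<in>carrier GL. v \<otimes>\<^bsub>GL\<^esub> w = \<one>\<^bsub>GL\<^esub>"
    using w(2) by (intro bexI[of _ "inv_into UNIV w"]) (auto simp: GL_def bij_imp_bij_inv bij_is_inj)
qed (auto simp: GL_def bij_comp vec.linear_id comp_assoc intro: Vector_Spaces.linear_compose)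

definition simple_reflection ::
    "('v \<Rightarrow> complex^'d) \<Rightarrow> ('v \<Rightarrow> complex^'d) \<Rightarrow> 'v \<Rightarrow> complex^'d \<Rightarrow> complex^'d" where
  "simple_reflection \<alpha> \<alpha>v i \<mu> = \<mu> - pairing \<mu> (\<alpha>v i) *s \<alpha> i"

lemma simple_reflection_in_GL:
  fixes \<alpha> \<alpha>v :: "'v \<Rightarrow> complex^'d"
  assumes "pairing (\<alpha> i) (\<alpha>v i) = 2"
  shows "simple_reflection \<alpha> \<alpha>v i \<in> carrier GL"
proof -
  have add: "pairing (x + y) h = pairing x h + pairing y h"
    and scale: "pairing (c *s x) h = c * pairing x h" for x y h :: "complex^'d" and c
    by (simp_all add: pairing_def distrib_right sum.distrib sum_distrib_left mult.assoc)
  have diff: "pairing (x - y) h = pairing x h - pairing y h" for x y h :: "complex^'d"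
    by (simp add: pairing_def left_diff_distrib sum_subtractf)
  have "simple_reflection \<alpha> \<alpha>v i (simple_reflection \<alpha> \<alpha>v i x) = x" for x
    by (simp add: simple_reflection_def diff scale assms vec_eq_iff algebra_simps)
  then have "bij (simple_reflection \<alpha> \<alpha>v i)"
    by (rule involuntory_imp_bij)
  moreover have "Vector_Spaces.linear (*s) (*s) (simple_reflection \<alpha> \<alpha>v i)"
    unfolding Vector_Spaces.linear_iff
    by (auto intro!: vec.vector_space_axioms
          simp: simple_reflection_def add scale vec_eq_iff algebra_simps)
  ultimately show ?thesis
    by (simp add: GL_def)
qed

definition weyl_group ::
    "('v \<Rightarrow> complex^'d) \<Rightarrow> ('v \<Rightarrow> complex^'d) \<Rightarrow> (complex^'d \<Rightarrow> complex^'d) monoid" where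
  "weyl_group \<alpha> \<alpha>v = subgroup_generated GL (range (simple_reflection \<alpha> \<alpha>v))"

definition coxeter_elements ::
    "('v \<Rightarrow> complex^'d) \<Rightarrow> ('v \<Rightarrow> complex^'d) \<Rightarrow> (complex^'d \<Rightarrow> complex^'d) set" where
  "coxeter_elements \<alpha> \<alpha>v =
     {foldr (\<circ>) (map (simple_reflection \<alpha> \<alpha>v) vs) id | vs. distinct vs \<and> set vs = UNIV}"

definition conjugacy_class :: "'g monoid \<Rightarrow> 'g \<Rightarrow> 'g set" where
  "conjugacy_class G w = {u \<otimes>\<^bsub>G\<^esub> w \<otimes>\<^bsub>G\<^esub> inv\<^bsub>G\<^esub> u | u. u \<in> carrier G}"

end

theory Submission
  imports Defs "Jordan_Normal_Form.Spectral_Radius"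
begin

text \<open>
  Everything is reduced to acyclic orientations.  A word listing a set of vertices once orients the
  edges inside that set, and two words give the same orientation iff they differ by swapping
  neighbouring letters that are not adjacent in the graph.

  Coxeter elements.  A product of all simple reflections depends only on the orientation, and the
  orientation can be read off from its action on vectors dual to the simple coroots.  Rotating a word
  conjugates the product, so for connected \<open>E\<close> every conjugacy class contains an orientation whose
  only source is a prescribed vertex.  That it contains only one is seen by deforming the reflection
  representation (\<open>a\<^sub>i\<^sub>j a\<^sub>j\<^sub>i = 1\<close> along the edges, otherwise arbitrary): by Tits' positivity argument
  every relation between simple reflections survives the deformation, and the characteristic
  polynomials of the deformed Coxeter elements determine, for every closed walk, how many of its
  edges are traversed along the orientation.

  Lie algebra.  The algebra acts on the dual of a lowest weight Verma module, realised as the functions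
  of words that are annihilated by the Serre elements.  Left-normed brackets beginning with a
  fixed vertex \<open>r\<close> span the root space of \<open>\<Sum>i\<in>S. \<alpha> i\<close>; modulo the Serre relations they are indexed by the
  orientations of \<open>S\<close> with unique source \<open>r\<close>, and the indicator functions of these orientations
  form a dual family.  The same functions show that the words indexed by all acyclic orientations
  form a basis in the enveloping algebra.  Splitting an orientation at the vertices reachable from \<open>r\<close>
  gives the recursion that the Kostant partition function satisfies on multilinear weights.
\<close>

hide_const (open) Matrix.mat Matrix.vec Matrix.vec_index Determinant.det
no_notation Matrix.vec_index (infixl \<open>$\<close> 100)

section \<open>Acyclic orientations\<close>

text \<open>For conjugacy the characteristic polynomial of the Coxeter element itself is too coarse:
  on a triangle the two classes are inverse to each other and share it. Up to rescaling the roots,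
  the deformation is free exactly along the cycles of the graph, and the length-three braid relation
  sees only the product of the two entries of an edge. This is why the group relations can be kept
  while the two directions around a cycle become distinguishable. On the Lie side a presentation
  yields spanning sets easily; the difficulty is to show that nothing further collapses. Operators
  for the \<open>e\<close> alone would not do, since the relations with the \<open>f\<close> might
  force more identities among the \<open>e\<close>; hence a module for all generators at once. Only
  squarefree weights matter, and there the cubic Serre relation never applies, because it needs a
  repeated letter.\<close>

definition induced :: "('v \<Rightarrow> 'v \<Rightarrow> bool) \<Rightarrow> 'v set \<Rightarrow> 'v \<Rightarrow> 'v \<Rightarrow> bool" where
  "induced E S u v \<longleftrightarrow> u \<in> S \<and> v \<in> S \<and> E u v"

abbreviation orientations_on :: "('v \<Rightarrow> 'v \<Rightarrow> bool) \<Rightarrow> 'v set \<Rightarrow> ('v \<times> 'v) set set" where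
  "orientations_on E S \<equiv> acyclic_orientations (induced E S)"

text \<open>Isolated vertices of \<open>D\<close> count as sources. A finite acyclic orientation of
  a nonempty \<open>S\<close> always has a source, so for \<open>r\<close> in \<open>S\<close> the
  condition makes \<open>r\<close> the unique one, and it cannot hold if \<open>S\<close> induces a
  disconnected subgraph.\<close>

definition rooted_orientations :: "('v \<Rightarrow> 'v \<Rightarrow> bool) \<Rightarrow> 'v set \<Rightarrow> 'v \<Rightarrow> ('v \<times> 'v) set set" where
  "rooted_orientations E S r = {D \<in> orientations_on E S. \<forall>v\<in>S. (\<forall>u. (u, v) \<notin> D) \<longrightarrow> v = r}"

primrec orient :: "('v \<Rightarrow> 'v \<Rightarrow> bool) \<Rightarrow> 'v list \<Rightarrow> ('v \<times> 'v) set" where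
  "orient E [] = {}"
| "orient E (x # w) = {(x, v) | v. v \<in> set w \<and> E x v} \<union> orient E w"

text \<open>Partial commutation of letters, written as a chain of swaps so that induction peels off
  the first swap. For a symmetric \<open>E\<close> it is an equivalence.\<close>

inductive comm_eq :: "('v \<Rightarrow> 'v \<Rightarrow> bool) \<Rightarrow> 'v list \<Rightarrow> 'v list \<Rightarrow> bool" for E where
  comm_refl: "comm_eq E w w"
| comm_swap: "u \<noteq> v \<Longrightarrow> \<not> E u v \<Longrightarrow> comm_eq E (a @ v # u # b) w \<Longrightarrow> comm_eq E (a @ u # v # b) w"

lemma induced_UNIV [simp]: "induced E UNIV = E"
  by (simp add: induced_def fun_eq_iff)

lemma orientations_onD:
  assumes "D \<in> orientations_on E S"
  shows "(u, v) \<in> D \<Longrightarrow> u \<in> S \<and> v \<in> S \<and> E u v"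
    and "u \<in> S \<Longrightarrow> v \<in> S \<Longrightarrow> E u v \<Longrightarrow> (u, v) \<in> D \<longleftrightarrow> (v, u) \<notin> D"
    and "acyclic D"
proof -
  have *: "is_orientation (induced E S) D" "acyclic D"
    using assms by (simp_all add: acyclic_orientations_def)
  show "(u, v) \<in> D \<Longrightarrow> u \<in> S \<and> v \<in> S \<and> E u v"
    using *(1) unfolding is_orientation_def induced_def by blast
  show "u \<in> S \<Longrightarrow> v \<in> S \<Longrightarrow> E u v \<Longrightarrow> (u, v) \<in> D \<longleftrightarrow> (v, u) \<notin> D"
    using *(1) unfolding is_orientation_def induced_def by blast
qed (use assms in \<open>simp add: acyclic_orientations_def\<close>)

lemma orientations_on_iff:
  "D \<in> orientations_on E S \<longleftrightarrow>
    acyclic D \<and> (\<forall>u v. (u, v) \<in> D \<longleftrightarrow> u \<in> S \<and> v \<in> S \<and> E u v \<and> (v, u) \<notin> D)"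
    (is "_ \<longleftrightarrow> ?r")
proof
  assume D: "D \<in> orientations_on E S"
  show ?r
    using orientations_onD[OF D] by (intro conjI allI) blast+
next
  assume r: ?r
  show "D \<in> orientations_on E S"
    unfolding acyclic_orientations_def is_orientation_def induced_def mem_Collect_eq
  proof (intro conjI allI impI)
    fix u v
    have "(u, v) \<in> D \<longleftrightarrow> u \<in> S \<and> v \<in> S \<and> E u v \<and> (v, u) \<notin> D"
      using r by blast
    then show "(u, v) \<in> D \<Longrightarrow> u \<in> S" "(u, v) \<in> D \<Longrightarrow> v \<in> S" "(u, v) \<in> D \<Longrightarrow> E u v"
      "u \<in> S \<and> v \<in> S \<and> E u v \<Longrightarrow> ((u, v) \<in> D) = ((v, u) \<notin> D)"
      by argo+
  qed (use r in blast)
qed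

lemma rootedD:
  assumes "D \<in> rooted_orientations E S r"
  shows "D \<in> orientations_on E S" and "v \<in> S \<Longrightarrow> (\<And>u. (u, v) \<notin> D) \<Longrightarrow> v = r"
  using assms unfolding rooted_orientations_def by blast+

lemma orient_edge: "(u, v) \<in> orient E w \<Longrightarrow> u \<in> set w \<and> v \<in> set w \<and> E u v"
  by (induction w) auto

lemma orient_append:
  "orient E (a @ b) = orient E a \<union> orient E b \<union> {(u, v). u \<in> set a \<and> v \<in> set b \<and> E u v}"
  by (induction a) auto

text \<open>No arc leads from \<open>T\<close> back to \<open>S\<close>, so a path that has crossed
  over never returns; in particular a cycle would lie inside one of the two parts.\<close>

lemma trancl_glue:
  assumes "D1 \<subseteq> S \<times> S" "D2 \<subseteq> T \<times> T" "S \<inter> T = {}" "C \<subseteq> S \<times> T"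
    and "(u, v) \<in> (D1 \<union> D2 \<union> C)\<^sup>+"
  shows "(u, v) \<in> D1\<^sup>+ \<or> (u, v) \<in> D2\<^sup>+ \<or> (u \<in> S \<and> v \<in> T)"
  using assms(5)
proof (induction rule: trancl_induct)
  case (base y)
  then show ?case using assms(4) by auto
next
  case (step y z)
  have 1: "D1\<^sup>+ \<subseteq> S \<times> S" "D2\<^sup>+ \<subseteq> T \<times> T"
    using assms(1,2) by (simp_all add: trancl_subset_Sigma)
  have "y \<in> T" if "(u, y) \<in> D2\<^sup>+" using 1 that by auto
  moreover have "y \<in> S \<and> u \<in> S" if "(u, y) \<in> D1\<^sup>+" using 1 that by auto
  moreover have "y \<in> S \<and> z \<in> S" if "(y, z) \<in> D1" using assms(1) that by auto
  moreover have "y \<in> T \<and> z \<in> T" if "(y, z) \<in> D2" using assms(2) that by auto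
  moreover have "y \<in> S \<and> z \<in> T" if "(y, z) \<in> C" using assms(4) that by auto
  moreover have "y \<notin> T" if "y \<in> S" using assms(3) that by auto
  ultimately show ?case
    using step.IH step.hyps(2) trancl_into_trancl[of u y D1 z] trancl_into_trancl[of u y D2 z]
    by (elim UnE disjE) simp_all
qed

lemma acyclic_glue:
  assumes "D1 \<subseteq> S \<times> S" "D2 \<subseteq> T \<times> T" "S \<inter> T = {}" "C \<subseteq> S \<times> T" "acyclic D1" "acyclic D2"
  shows "acyclic (D1 \<union> D2 \<union> C)"
  using trancl_glue[OF assms(1-4)] assms(3,5,6) unfolding acyclic_def by blast

section \<open>Gluing, splitting and topological sorting of acyclic orientations\<close>

locale simple_graph =
  fixes E :: "'v::finite \<Rightarrow> 'v \<Rightarrow> bool"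
  assumes sym_E: "E u v \<Longrightarrow> E v u" and irrefl_E: "\<not> E u u"
begin

lemma glue_orientations:
  assumes "D1 \<in> orientations_on E S" "D2 \<in> orientations_on E T" "S \<inter> T = {}"
  shows "D1 \<union> D2 \<union> {(u, v). u \<in> S \<and> v \<in> T \<and> E u v} \<in> orientations_on E (S \<union> T)"
proof -
  have "acyclic (D1 \<union> D2 \<union> {(u, v). u \<in> S \<and> v \<in> T \<and> E u v})"
  proof (rule acyclic_glue[of _ S _ T])
    show "D1 \<subseteq> S \<times> S" "D2 \<subseteq> T \<times> T"
      using orientations_onD(1)[OF assms(1)] orientations_onD(1)[OF assms(2)] by auto
    show "acyclic D1" "acyclic D2"
      using orientations_onD(3) assms(1,2) by blast+
  qed (use assms(3) in auto)
  moreover have "is_orientation (induced E (S \<union> T)) (D1 \<union> D2 \<union> {(u, v). u \<in> S \<and> v \<in> T \<and> E u v})"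
    unfolding is_orientation_def
  proof (intro conjI allI impI)
    fix u v
    show "induced E (S \<union> T) u v" if "(u, v) \<in> D1 \<union> D2 \<union> {(u, v). u \<in> S \<and> v \<in> T \<and> E u v}"
      using that orientations_onD(1)[OF assms(1)] orientations_onD(1)[OF assms(2)]
      by (auto simp: induced_def)
    have D1: "(u, v) \<in> D1 \<longleftrightarrow> u \<in> S \<and> v \<in> S \<and> E u v \<and> (v, u) \<notin> D1"
      and D2: "(u, v) \<in> D2 \<longleftrightarrow> u \<in> T \<and> v \<in> T \<and> E u v \<and> (v, u) \<notin> D2" for u v
      using orientations_onD(1,2)[OF assms(1)] orientations_onD(1,2)[OF assms(2)] by blast+
    assume "induced E (S \<union> T) u v"
    then have uv: "u \<in> S \<or> u \<in> T" "v \<in> S \<or> v \<in> T" "E u v" "E v u"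
      using sym_E by (auto simp: induced_def)
    have "u \<notin> S \<or> u \<notin> T" "v \<notin> S \<or> v \<notin> T" using assms(3) by auto
    then show "((u, v) \<in> D1 \<union> D2 \<union> {(u, v). u \<in> S \<and> v \<in> T \<and> E u v}) =
        ((v, u) \<notin> D1 \<union> D2 \<union> {(u, v). u \<in> S \<and> v \<in> T \<and> E u v})"
      using uv D1[of u v] D1[of v u] D2[of u v] D2[of v u] by auto
  qed
  ultimately show ?thesis
    by (simp add: acyclic_orientations_def)
qed

lemma orientation_empty: "orientations_on E {} = {{}}"
  by (auto simp: acyclic_orientations_def is_orientation_def induced_def acyclic_def)

lemma orientation_singleton: "{} \<in> orientations_on E {x}"
  using irrefl_E by (auto simp: acyclic_orientations_def is_orientation_def induced_def acyclic_def)

lemma orient_mem: "distinct w \<Longrightarrow> orient E w \<in> orientations_on E (set w)"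
proof (induction w)
  case Nil
  then show ?case using orientation_empty by simp
next
  case (Cons x w)
  have "{} \<union> orient E w \<union> {(u, v). u \<in> {x} \<and> v \<in> set w \<and> E u v} \<in> orientations_on E ({x} \<union> set w)"
    by (rule glue_orientations) (use Cons orientation_singleton in auto)
  moreover have "{} \<union> orient E w \<union> {(u, v). u \<in> {x} \<and> v \<in> set w \<and> E u v} = orient E (x # w)"
    by auto
  ultimately show ?case by simp
qed

lemma restrict_orientation:
  assumes "D \<in> orientations_on E S" "T \<subseteq> S"
  shows "D \<inter> T \<times> T \<in> orientations_on E T"
proof -
  have "acyclic (D \<inter> T \<times> T)"
    using assms(1) acyclic_subset[of D "D \<inter> T \<times> T"] by (simp add: acyclic_orientations_def)
  moreover have "(u, v) \<in> D \<inter> T \<times> T \<longleftrightarrow> u \<in> T \<and> v \<in> T \<and> E u v \<and> (v, u) \<notin> D \<inter> T \<times> T" for u v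
    using orientations_onD(1,2)[OF assms(1), of u v] assms(2) by blast
  ultimately show ?thesis by (intro orientations_on_iff[THEN iffD2] conjI allI)
qed

text \<open>Converse of gluing. The last hypothesis says that \<open>T\<close> is an initial
  segment, so every edge across leaves \<open>T\<close> and the cross arcs carry no
  information.\<close>

lemma orientation_split:
  assumes D: "D \<in> orientations_on E S" and "T \<subseteq> S" and no: "\<And>u v. (u, v) \<in> D \<Longrightarrow> u \<in> S - T \<Longrightarrow> v \<notin> T"
  shows "D = (D \<inter> T \<times> T) \<union> (D \<inter> (S - T) \<times> (S - T)) \<union> {(u, v). u \<in> T \<and> v \<in> S - T \<and> E u v}"
    (is "_ = ?D")
proof -
  have mem: "(u, v) \<in> D \<longleftrightarrow> u \<in> S \<and> v \<in> S \<and> E u v \<and> (v, u) \<notin> D" for u v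
    by (rule D[unfolded orientations_on_iff, THEN conjunct2, rule_format])
  have eq: "(u, v) \<in> D \<longleftrightarrow> (u, v) \<in> ?D" for u v
  proof -
    have "u \<in> T \<longrightarrow> u \<in> S" "v \<in> T \<longrightarrow> v \<in> S" "E u v \<longleftrightarrow> E v u"
      "(u, v) \<in> D \<longrightarrow> u \<in> S \<and> u \<notin> T \<longrightarrow> v \<notin> T" "(v, u) \<in> D \<longrightarrow> v \<in> S \<and> v \<notin> T \<longrightarrow> u \<notin> T"
      using assms(2) no[of u v] no[of v u] sym_E[of u v] sym_E[of v u] by blast+
    then show ?thesis
      using mem[of u v] mem[of v u]
      unfolding Un_iff Int_iff mem_Sigma_iff Diff_iff mem_Collect_eq prod.case by argo
  qed
  show ?thesis
  proof (rule Set.set_eqI)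
    fix p show "p \<in> D \<longleftrightarrow> p \<in> ?D"
      by (cases p) (erule ssubst, rule eq)
  qed
qed

lemma source_exists:
  assumes D: "D \<in> orientations_on E S" and "x \<in> S"
  obtains s where "s \<in> S" "\<And>u. (u, s) \<notin> D"
proof -
  have "wf D"
    using orientations_onD(3)[OF D] by (simp add: finite_acyclic_wf)
  then obtain s where "s \<in> S" "\<And>y. (y, s) \<in> D \<Longrightarrow> y \<notin> S"
    using wfE_min[of D x S] \<open>x \<in> S\<close> by metis
  then show ?thesis using orientations_onD(1)[OF D] that by blast
qed

text \<open>Topological sorting: a source may be listed first, since all its edges leave it.\<close>

lemma orientation_word:
  assumes "D \<in> orientations_on E S"
  shows "\<exists>w. distinct w \<and> set w = S \<and> orient E w = D"
  using finite[of S] assms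
proof (induction S arbitrary: D rule: finite_psubset_induct)
  case (psubset S)
  show ?case
  proof (cases "S = {}")
    case True
    then show ?thesis using psubset.prems orientation_empty by auto
  next
    case False
    then obtain s where s: "s \<in> S" "\<And>u. (u, s) \<notin> D"
      using source_exists[OF psubset.prems] by blast
    let ?D = "D \<inter> (S - {s}) \<times> (S - {s})"
    have "?D \<in> orientations_on E (S - {s})"
      by (rule restrict_orientation[OF psubset.prems]) auto
    then obtain w where w: "distinct w" "set w = S - {s}" "orient E w = ?D"
      using psubset.IH[of "S - {s}" ?D] s(1) by blast
    have "D = (D \<inter> {s} \<times> {s}) \<union> ?D \<union> {(u, v). u \<in> {s} \<and> v \<in> S - {s} \<and> E u v}"
      by (rule orientation_split[OF psubset.prems]) (use s in auto)
    also have "\<dots> = orient E (s # w)"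
      using w s by auto
    finally show ?thesis
      using w s by (intro exI[of _ "s # w"]) auto
  qed
qed

lemma orientation_word_split:
  assumes D: "D \<in> orientations_on E S" and "T \<subseteq> S" and no: "\<And>u v. (u, v) \<in> D \<Longrightarrow> u \<in> S - T \<Longrightarrow> v \<notin> T"
  obtains a b where "distinct (a @ b)" "set a = T" "set b = S - T" "orient E (a @ b) = D"
    "orient E a = D \<inter> T \<times> T" "orient E b = D \<inter> (S - T) \<times> (S - T)"
proof -
  obtain a where a: "distinct a" "set a = T" "orient E a = D \<inter> T \<times> T"
    using orientation_word[OF restrict_orientation[OF D \<open>T \<subseteq> S\<close>]] by blast
  obtain b where b: "distinct b" "set b = S - T" "orient E b = D \<inter> (S - T) \<times> (S - T)"
    using orientation_word[OF restrict_orientation[OF D, of "S - T"]] by blast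
  show ?thesis
    by (rule that[of a b]) (use a b orientation_split[OF D \<open>T \<subseteq> S\<close> no] in \<open>auto simp: orient_append\<close>)
qed

lemma orientation_word_source:
  assumes D: "D \<in> orientations_on E S" and s: "s \<in> S" "\<And>u. (u, s) \<notin> D"
  obtains w where "distinct (s # w)" "set (s # w) = S" "orient E (s # w) = D"
proof (rule orientation_word_split[OF D, of "{s}"])
  fix a b assume *: "distinct (a @ b)" "set a = {s}" "set b = S - {s}" "orient E (a @ b) = D"
  from * have "card (set a) = length a" by (metis distinct_append distinct_card)
  with * have "length a = 1" by simp
  then obtain x where "a = [x]" by (auto simp: length_Suc_conv)
  with *(2) have a: "a = [s]" by simp
  show ?thesis
  proof (rule that[of b])
    show "distinct (s # b)" "set (s # b) = S" "orient E (s # b) = D"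
      using *(1,3,4) s(1) unfolding a by auto
  qed
qed (use s in auto)

text \<open>The first letter of a word has no incoming arc.\<close>

lemma rooted_hd:
  assumes "orient E w \<in> rooted_orientations E (set w) r" "distinct w" "w \<noteq> []"
  shows "hd w = r"
proof -
  obtain x u where w: "w = x # u" using \<open>w \<noteq> []\<close> by (cases w) auto
  have "(v, x) \<notin> orient E w" for v
    using assms(2) orient_edge[of v x E u] by (auto simp: w)
  then show ?thesis
    using rootedD(2)[OF assms(1), of x] w by simp
qed

lemma rooted_word:
  assumes "D \<in> rooted_orientations E S r" "r \<in> S"
  obtains w where "distinct (r # w)" "set (r # w) = S" "orient E (r # w) = D"
proof -
  obtain w where w: "distinct w" "set w = S" "orient E w = D"
    using orientation_word[OF rootedD(1)[OF assms(1)]] by blast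
  moreover have "w \<noteq> []" using w assms by auto
  moreover have "hd w = r" using rooted_hd[of w r] w assms \<open>w \<noteq> []\<close> by auto
  ultimately show ?thesis using that[of "tl w"] by (cases w) auto
qed

subsection \<open>Words with the same orientation\<close>

lemma comm_eq_trans: "comm_eq E a b \<Longrightarrow> comm_eq E b c \<Longrightarrow> comm_eq E a c"
  by (induction rule: comm_eq.induct) (auto intro: comm_eq.intros)

lemma comm_eq_Cons: "comm_eq E a b \<Longrightarrow> comm_eq E (x # a) (x # b)"
proof (induction rule: comm_eq.induct)
  case (comm_swap u v a b w)
  then show ?case using comm_eq.comm_swap[of u v E "x # a" b] by simp
qed (rule comm_refl)

lemma comm_eq_move:
  "\<forall>u\<in>set a. u \<noteq> x \<and> \<not> E x u \<Longrightarrow> comm_eq E (x # a @ b) (a @ x # b)"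
proof (induction a)
  case (Cons u a)
  have "comm_eq E (u # x # a @ b) (u # a @ x # b)"
    using Cons by (intro comm_eq_Cons) auto
  then show ?case
    using comm_eq.comm_swap[of x u E "[]" "a @ b"] Cons.prems by auto
qed (simp add: comm_refl)

text \<open>The first letter \<open>x\<close> of \<open>w\<close> is a source of the common
  orientation, so in \<open>w'\<close> no earlier letter is adjacent to it, and \<open>x\<close>
  commutes to the front of \<open>w'\<close>.\<close>

lemma comm_eq_orient:
  "distinct w \<Longrightarrow> distinct w' \<Longrightarrow> set w = set w' \<Longrightarrow> orient E w = orient E w' \<Longrightarrow> comm_eq E w w'"
proof (induction w arbitrary: w')
  case Nil
  then show ?case by (simp add: comm_refl)
next
  case (Cons x w)
  then have "x \<in> set w'" by auto
  then obtain a b where w': "w' = a @ x # b" by (meson split_list)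
  have nonadj: "u \<noteq> x \<and> \<not> E x u" if "u \<in> set a" for u
  proof -
    have "u \<noteq> x" using that Cons.prems w' by auto
    moreover have "\<not> E u x"
    proof
      assume "E u x"
      then have "(u, x) \<in> orient E w'" using that by (auto simp: w' orient_append)
      then have "(u, x) \<in> orient E (x # w)" using Cons.prems by simp
      then show False using \<open>u \<noteq> x\<close> orient_edge[of u x E w] Cons.prems by auto
    qed
    ultimately show ?thesis using sym_E by blast
  qed
  have mem: "p \<in> orient E (a @ b) \<longleftrightarrow> p \<in> orient E w' \<and> fst p \<noteq> x \<and> snd p \<noteq> x" for p
    using Cons.prems orient_edge[of "fst p" "snd p" E a] orient_edge[of "fst p" "snd p" E b]
    by (auto simp: w' orient_append)
  have mem': "p \<in> orient E w \<longleftrightarrow> p \<in> orient E (x # w) \<and> fst p \<noteq> x \<and> snd p \<noteq> x" for p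
  proof -
    have "p \<in> orient E w \<Longrightarrow> fst p \<in> set w \<and> snd p \<in> set w"
      using orient_edge[of "fst p" "snd p" E w] by simp
    then show ?thesis using Cons.prems(1) by auto
  qed
  have "comm_eq E w (a @ b)"
  proof (rule Cons.IH)
    show "set w = set (a @ b)" using Cons.prems w' by auto
    show "orient E w = orient E (a @ b)" using mem mem' Cons.prems(4) by blast
  qed (use Cons.prems w' in auto)
  then have "comm_eq E (x # w) (x # a @ b)" by (rule comm_eq_Cons)
  moreover have "comm_eq E (x # a @ b) (a @ x # b)"
    using nonadj by (intro comm_eq_move) auto
  ultimately show ?case unfolding w' by (rule comm_eq_trans)
qed

lemma orient_swap:
  assumes "\<not> E u v" shows "orient E (a @ u # v # b) = orient E (a @ v # u # b)"
  using assms sym_E by (auto simp: orient_append)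

end

section \<open>Products of simple reflections\<close>

lemma pairing_simps:
  "pairing (x + y) h = pairing x h + pairing y h"
  "pairing (x - y) h = pairing x h - pairing y h"
  "pairing (c *s x) h = c * pairing x h"
  "pairing (- x) h = - pairing x h"
  "pairing 0 h = 0"
  "pairing x (h + h') = pairing x h + pairing x h'"
  "pairing x (c *s h) = c * pairing x h"
  by (simp_all add: pairing_def algebra_simps sum.distrib sum_subtractf sum_distrib_left sum_negf)

lemma pairing_sum: "pairing (sum f A) h = (\<Sum>a\<in>A. pairing (f a) h)"
  by (induction A rule: infinite_finite_induct) (simp_all add: pairing_simps)

definition word_prod :: "('v \<Rightarrow> complex^'n) \<Rightarrow> ('v \<Rightarrow> complex^'n) \<Rightarrow> 'v list \<Rightarrow> complex^'n \<Rightarrow> complex^'n" where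
  "word_prod \<alpha> \<alpha>v w = foldr (\<circ>) (map (simple_reflection \<alpha> \<alpha>v) w) id"

lemma word_prod_simps [simp]:
  "word_prod \<alpha> \<alpha>v [] x = x"
  "word_prod \<alpha> \<alpha>v (v # w) x = simple_reflection \<alpha> \<alpha>v v (word_prod \<alpha> \<alpha>v w x)"
  by (simp_all add: word_prod_def)

lemma word_prod_append: "word_prod \<alpha> \<alpha>v (a @ b) x = word_prod \<alpha> \<alpha>v a (word_prod \<alpha> \<alpha>v b x)"
  by (induction a) simp_all

lemma word_prod_linear:
  "word_prod \<alpha> \<alpha>v w (x + y) = word_prod \<alpha> \<alpha>v w x + word_prod \<alpha> \<alpha>v w y"
  "word_prod \<alpha> \<alpha>v w (c *s x) = c *s word_prod \<alpha> \<alpha>v w x"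
proof -
  have "simple_reflection \<alpha> \<alpha>v v (x + y) = simple_reflection \<alpha> \<alpha>v v x + simple_reflection \<alpha> \<alpha>v v y"
    "simple_reflection \<alpha> \<alpha>v v (c *s x) = c *s simple_reflection \<alpha> \<alpha>v v x" for v x y
    by (simp_all add: simple_reflection_def pairing_simps Finite_Cartesian_Product.vec_eq_iff algebra_simps)
  then show "word_prod \<alpha> \<alpha>v w (x + y) = word_prod \<alpha> \<alpha>v w x + word_prod \<alpha> \<alpha>v w y"
    "word_prod \<alpha> \<alpha>v w (c *s x) = c *s word_prod \<alpha> \<alpha>v w x"
    by (induction w) simp_all
qed

text \<open>Tracks how much of each root has been subtracted so far, so it makes sense even for
  dependent roots. In a word without repetition the coefficient of a letter changes only when that
  letter acts; letters act from right to left.\<close>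

primrec word_coeff :: "('v \<Rightarrow> complex^'n) \<Rightarrow> ('v \<Rightarrow> complex^'n) \<Rightarrow> 'v list \<Rightarrow> complex^'n \<Rightarrow> 'v \<Rightarrow> complex" where
  "word_coeff \<alpha> \<alpha>v [] x = (\<lambda>_. 0)"
| "word_coeff \<alpha> \<alpha>v (v # w) x = (word_coeff \<alpha> \<alpha>v w x)
     (v := word_coeff \<alpha> \<alpha>v w x v + pairing (word_prod \<alpha> \<alpha>v w x) (\<alpha>v v))"

lemma word_prod_coeff:
  fixes \<alpha> :: "'v::finite \<Rightarrow> complex^'n"
  shows "word_prod \<alpha> \<alpha>v w x = x - (\<Sum>j\<in>UNIV. word_coeff \<alpha> \<alpha>v w x j *s \<alpha> j)"
proof (induction w)
  case (Cons v w)
  have "(\<Sum>j\<in>UNIV. word_coeff \<alpha> \<alpha>v (v # w) x j *s \<alpha> j) =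
      (\<Sum>j\<in>UNIV. word_coeff \<alpha> \<alpha>v w x j *s \<alpha> j + (if j = v then pairing (word_prod \<alpha> \<alpha>v w x) (\<alpha>v v) *s \<alpha> v else 0))"
    by (rule sum.cong) (auto simp: Finite_Cartesian_Product.vec_eq_iff algebra_simps)
  also have "\<dots> = (\<Sum>j\<in>UNIV. word_coeff \<alpha> \<alpha>v w x j *s \<alpha> j) + pairing (word_prod \<alpha> \<alpha>v w x) (\<alpha>v v) *s \<alpha> v"
    by (simp add: sum.distrib)
  finally show ?case
    by (simp add: simple_reflection_def Cons.IH del: word_coeff.simps)
qed simp

lemma word_coeff_notin: "v \<notin> set w \<Longrightarrow> word_coeff \<alpha> \<alpha>v w x v = 0"
  by (induction w) auto

lemma word_coeff_suffix: "v \<notin> set a \<Longrightarrow> word_coeff \<alpha> \<alpha>v (a @ b) x v = word_coeff \<alpha> \<alpha>v b x v"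
  by (induction a) auto

lemma word_coeff_Cons:
  fixes \<alpha> :: "'v::finite \<Rightarrow> complex^'n"
  assumes "v \<notin> set w"
  shows "word_coeff \<alpha> \<alpha>v (v # w) x v =
    pairing x (\<alpha>v v) - (\<Sum>k\<in>set w. word_coeff \<alpha> \<alpha>v w x k * pairing (\<alpha> k) (\<alpha>v v))"
proof -
  have "(\<Sum>k\<in>UNIV. word_coeff \<alpha> \<alpha>v w x k * pairing (\<alpha> k) (\<alpha>v v)) =
      (\<Sum>k\<in>set w. word_coeff \<alpha> \<alpha>v w x k * pairing (\<alpha> k) (\<alpha>v v))"
    by (rule sum.mono_neutral_right) (auto simp: word_coeff_notin)
  then show ?thesis
    using assms by (simp add: word_coeff_notin) (simp add: word_prod_coeff pairing_simps pairing_sum)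
qed

text \<open>The braid relation of an adjacent pair depends only on the product of its two
  off-diagonal entries. Fixing the product at 1, but not the entries, leaves room for the
  deformation.\<close>

definition reflection_system :: "('v \<Rightarrow> 'v \<Rightarrow> bool) \<Rightarrow> ('v \<Rightarrow> complex^'n) \<Rightarrow> ('v \<Rightarrow> complex^'n) \<Rightarrow> bool" where
  "reflection_system E \<alpha> \<alpha>v \<longleftrightarrow>
     (\<forall>i. pairing (\<alpha> i) (\<alpha>v i) = 2) \<and>
     (\<forall>i j. i \<noteq> j \<longrightarrow> \<not> E i j \<longrightarrow> pairing (\<alpha> i) (\<alpha>v j) = 0) \<and>
     (\<forall>i j. E i j \<longrightarrow> pairing (\<alpha> i) (\<alpha>v j) * pairing (\<alpha> j) (\<alpha>v i) = 1)"

context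
  fixes E :: "'v::finite \<Rightarrow> 'v \<Rightarrow> bool" and \<alpha> \<alpha>v :: "'v \<Rightarrow> complex^'n"
  assumes rs: "reflection_system E \<alpha> \<alpha>v"
begin

lemma reflection_square: "word_prod \<alpha> \<alpha>v [i, i] x = x"
  using rs by (simp add: reflection_system_def simple_reflection_def pairing_simps Finite_Cartesian_Product.vec_eq_iff algebra_simps)

lemma reflection_comm:
  assumes "i \<noteq> j" "\<not> E i j" "\<not> E j i"
  shows "word_prod \<alpha> \<alpha>v [i, j] x = word_prod \<alpha> \<alpha>v [j, i] x"
  using rs assms by (simp add: reflection_system_def simple_reflection_def pairing_simps Finite_Cartesian_Product.vec_eq_iff algebra_simps)

lemma reflection_braid:
  assumes "E i j"
  shows "word_prod \<alpha> \<alpha>v [i, j, i] x = word_prod \<alpha> \<alpha>v [j, i, j] x"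
proof -
  define a b where "a = pairing (\<alpha> i) (\<alpha>v j)" and "b = pairing (\<alpha> j) (\<alpha>v i)"
  have ab: "a * b = 1" and 2: "pairing (\<alpha> i) (\<alpha>v i) = 2" "pairing (\<alpha> j) (\<alpha>v j) = 2"
    using rs assms by (simp_all add: reflection_system_def a_def b_def)
  have ab': "b * (a * c) = c" "a * (b * c) = c" for c using ab by (simp_all add: mult.assoc[symmetric] mult.commute)
  show ?thesis
    by (simp add: simple_reflection_def pairing_simps Finite_Cartesian_Product.vec_eq_iff a_def[symmetric] b_def[symmetric] 2
        algebra_simps ab ab')
qed

lemma word_prod_rev: "word_prod \<alpha> \<alpha>v (w @ rev w) x = x"
proof (induction w arbitrary: x)
  case (Cons v w)
  have "word_prod \<alpha> \<alpha>v ((v # w) @ rev (v # w)) x =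
      simple_reflection \<alpha> \<alpha>v v (word_prod \<alpha> \<alpha>v (w @ rev w) (simple_reflection \<alpha> \<alpha>v v x))"
    by (simp add: word_prod_append)
  then show ?case using Cons reflection_square[of v x] by simp
qed simp

end

lemma comm_eq_word_prod:
  fixes \<alpha> \<alpha>v :: "'v::finite \<Rightarrow> complex^'n"
  assumes "reflection_system E \<alpha> \<alpha>v" "\<And>u v. E u v \<Longrightarrow> E v u" "comm_eq E w w'"
  shows "word_prod \<alpha> \<alpha>v w x = word_prod \<alpha> \<alpha>v w' x"
  using assms(3)
proof induction
  case (comm_swap u v a b w)
  then show ?case
    using reflection_comm[OF assms(1), of u v] assms(2)[of v u]
    by (simp add: word_prod_append) metis
qed simp

subsection \<open>Relations between reflections\<close>

locale two_reflection_systems = simple_graph E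
  for E :: "'v::finite \<Rightarrow> 'v \<Rightarrow> bool" +
  fixes \<alpha> \<alpha>v :: "'v \<Rightarrow> complex^'n" and \<beta> \<beta>v :: "'v \<Rightarrow> complex^'m"
  assumes rs1: "reflection_system E \<alpha> \<alpha>v" and rs2: "reflection_system E \<beta> \<beta>v"
    and adj: "E i j \<Longrightarrow> pairing (\<alpha> i) (\<alpha>v j) = -1"
    and indep: "(\<Sum>i\<in>UNIV. c i *s \<alpha> i) = 0 \<Longrightarrow> c i = 0"
begin

text \<open>Equality in the group of pairs of actions. Length is measured there rather than in the
  first action alone: a word that were trivial only in the first action would then still have
  positive length, and positivity of roots can refute it.\<close>

definition weq :: "'v list \<Rightarrow> 'v list \<Rightarrow> bool" where
  "weq x y \<longleftrightarrow> word_prod \<alpha> \<alpha>v x = word_prod \<alpha> \<alpha>v y \<and> word_prod \<beta> \<beta>v x = word_prod \<beta> \<beta>v y"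

definition wlen :: "'v list \<Rightarrow> nat" where
  "wlen x = (LEAST n. \<exists>y. weq x y \<and> length y = n)"

lemma weq_refl: "weq x x" and weq_sym: "weq x y \<Longrightarrow> weq y x" and weq_trans: "weq x y \<Longrightarrow> weq y z \<Longrightarrow> weq x z"
  by (auto simp: weq_def)

lemma weq_append: "weq x y \<Longrightarrow> weq x' y' \<Longrightarrow> weq (x @ x') (y @ y')"
  by (auto simp: weq_def word_prod_append)

lemma weq_square: "weq (x @ [s, s]) x"
  using reflection_square[OF rs1] reflection_square[OF rs2] by (auto simp: weq_def fun_eq_iff word_prod_append)

lemma weq_comm: "s \<noteq> t \<Longrightarrow> \<not> E s t \<Longrightarrow> weq [s, t] [t, s]"
  using reflection_comm[OF rs1, of s t] reflection_comm[OF rs2, of s t] sym_E[of t s]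
  by (auto simp: weq_def fun_eq_iff)

lemma weq_braid: "E s t \<Longrightarrow> weq [s, t, s] [t, s, t]"
  using reflection_braid[OF rs1, of s t] reflection_braid[OF rs2, of s t]
  by (auto simp: weq_def fun_eq_iff)

lemma wlen_word: "\<exists>y. weq x y \<and> length y = wlen x"
  unfolding wlen_def by (rule LeastI_ex) (use weq_refl in blast)

lemma wlen_le: "weq x y \<Longrightarrow> wlen x \<le> length y"
  unfolding wlen_def by (rule Least_le) blast

lemma wlen_cong: "weq x y \<Longrightarrow> wlen x = wlen y"
  unfolding wlen_def by (metis weq_sym weq_trans)

lemma wlen_append: "wlen (x @ z) \<le> wlen x + length z"
proof -
  obtain y where "weq x y" "length y = wlen x" using wlen_word by blast
  then have "wlen (x @ z) \<le> length (y @ z)" using weq_refl by (intro wlen_le weq_append)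
  then show ?thesis using \<open>length y = wlen x\<close> by simp
qed

definition cone :: "(complex^'n) set" where
  "cone = {x. \<exists>c. (\<forall>i. 0 \<le> c i) \<and> x = (\<Sum>i\<in>UNIV. complex_of_real (c i) *s \<alpha> i)}"

lemma cone_simple: "\<alpha> s \<in> cone"
proof -
  have "(\<Sum>i\<in>UNIV. complex_of_real (if i = s then 1 else 0) *s \<alpha> i) = (\<Sum>i\<in>UNIV. if i = s then \<alpha> s else 0)"
    by (rule sum.cong) auto
  also have "\<dots> = \<alpha> s" by simp
  finally show ?thesis unfolding cone_def by (auto intro!: exI[of _ "\<lambda>i. if i = s then 1 else 0"])
qed

lemma cone_add: "x \<in> cone \<Longrightarrow> y \<in> cone \<Longrightarrow> x + y \<in> cone"
proof -
  assume "x \<in> cone" "y \<in> cone"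
  then obtain c d where c: "\<And>i. 0 \<le> c i" "x = (\<Sum>i\<in>UNIV. complex_of_real (c i) *s \<alpha> i)"
    and d: "\<And>i. 0 \<le> d i" "y = (\<Sum>i\<in>UNIV. complex_of_real (d i) *s \<alpha> i)"
    by (auto simp: cone_def)
  have "x + y = (\<Sum>i\<in>UNIV. complex_of_real (c i + d i) *s \<alpha> i)"
    unfolding c(2) d(2) sum.distrib[symmetric]
    by (rule sum.cong) (auto simp: Finite_Cartesian_Product.vec_eq_iff algebra_simps)
  moreover have "0 \<le> c i + d i" for i using c(1)[of i] d(1)[of i] by simp
  ultimately show ?thesis
    unfolding cone_def mem_Collect_eq by (intro exI[of _ "\<lambda>i. c i + d i"]) simp
qed

lemma cone_not_neg: "- \<alpha> s \<notin> cone"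
proof
  assume "- \<alpha> s \<in> cone"
  then obtain c where c: "\<And>i. 0 \<le> c i" "- \<alpha> s = (\<Sum>i\<in>UNIV. complex_of_real (c i) *s \<alpha> i)"
    by (auto simp: cone_def)
  have "(\<Sum>i\<in>UNIV. (complex_of_real (c i) + (if i = s then 1 else 0)) *s \<alpha> i) =
      (\<Sum>i\<in>UNIV. complex_of_real (c i) *s \<alpha> i + (if i = s then \<alpha> s else 0))"
    by (rule sum.cong) (auto simp: Finite_Cartesian_Product.vec_eq_iff algebra_simps)
  also have "\<dots> = 0" by (simp add: sum.distrib c(2)[symmetric])
  finally have "complex_of_real (c s) + 1 = 0"
    using indep[of "\<lambda>i. complex_of_real (c i) + (if i = s then 1 else 0)" s] by simp
  then have "c s + 1 = 0" by (metis of_real_1 of_real_add of_real_eq_0_iff)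
  then show False using c(1)[of s] by simp
qed

lemma simple_reflection_simple:
  "simple_reflection \<alpha> \<alpha>v i (\<alpha> i) = - \<alpha> i"
  "i \<noteq> j \<Longrightarrow> \<not> E i j \<Longrightarrow> simple_reflection \<alpha> \<alpha>v i (\<alpha> j) = \<alpha> j"
  "E i j \<Longrightarrow> simple_reflection \<alpha> \<alpha>v i (\<alpha> j) = \<alpha> j + \<alpha> i"
proof -
  have "pairing (\<alpha> i) (\<alpha>v i) = 2"
    using rs1 by (simp add: reflection_system_def)
  moreover have "pairing (\<alpha> j) (\<alpha>v i) = 0" if "i \<noteq> j" "\<not> E i j"
    using rs1 that sym_E[of j i] unfolding reflection_system_def by metis
  moreover have "pairing (\<alpha> j) (\<alpha>v i) = -1" if "E i j"
    using adj[OF sym_E[OF that]] .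
  ultimately show "simple_reflection \<alpha> \<alpha>v i (\<alpha> i) = - \<alpha> i"
    "i \<noteq> j \<Longrightarrow> \<not> E i j \<Longrightarrow> simple_reflection \<alpha> \<alpha>v i (\<alpha> j) = \<alpha> j"
    "E i j \<Longrightarrow> simple_reflection \<alpha> \<alpha>v i (\<alpha> j) = \<alpha> j + \<alpha> i"
    by (simp_all add: simple_reflection_def Finite_Cartesian_Product.vec_eq_iff algebra_simps)
qed

text \<open>The induction from Tits' theorem on the geometric representation of a Coxeter group.\<close>

lemma word_prod_positive:
  "wlen x \<le> wlen (x @ [s]) \<Longrightarrow> word_prod \<alpha> \<alpha>v x (\<alpha> s) \<in> cone"
proof (induction "wlen x" arbitrary: x s rule: less_induct)
  case less
  obtain y where y: "weq x y" "length y = wlen x" using wlen_word by blast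
  show ?case
  proof (cases y rule: rev_cases)
    case Nil
    then show ?thesis using y cone_simple by (simp add: weq_def)
  next
    case (snoc x' t)
    have x: "weq x (x' @ [t])" using y snoc by simp
    have len': "wlen x' < wlen x" using wlen_le[OF weq_refl, of x'] y snoc by simp
    have len: "wlen x = wlen (x' @ [t])" using x by (rule wlen_cong)
    have le_t: "wlen x' \<le> wlen (x' @ [t])" using len len' by simp
    have xs: "wlen (x @ [s]) = wlen (x' @ [t, s])"
      using wlen_cong[OF weq_append[OF x weq_refl, of "[s]"]] by simp
    have "t \<noteq> s"
    proof
      assume "t = s"
      then have "wlen (x @ [s]) = wlen x'" using xs wlen_cong[OF weq_square] by simp
      then show False using less.prems len' by simp
    qed
    have app: "word_prod \<alpha> \<alpha>v x (\<alpha> s) = word_prod \<alpha> \<alpha>v x' (simple_reflection \<alpha> \<alpha>v t (\<alpha> s))"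
      using x by (simp add: weq_def word_prod_append)
    show ?thesis
    proof (cases "E t s")
      case False
      \<comment> \<open>If \<open>s\<close> shortened \<open>x'\<close>, then moving
        \<open>s\<close> past \<open>t\<close> would give \<open>x @ [s]\<close> at most the length
        of \<open>x'\<close>.\<close>
      have "wlen x' \<le> wlen (x' @ [s])"
      proof (rule ccontr)
        assume "\<not> ?thesis"
        moreover have "wlen (x' @ [t, s]) = wlen (x' @ [s] @ [t])"
          using weq_append[OF weq_refl[of x'] weq_comm[OF \<open>t \<noteq> s\<close> False]] by (simp add: wlen_cong)
        moreover have "wlen ((x' @ [s]) @ [t]) \<le> wlen (x' @ [s]) + length [t]" by (rule wlen_append)
        ultimately show False using xs less.prems len' by simp
      qed
      then have "word_prod \<alpha> \<alpha>v x' (\<alpha> s) \<in> cone" by (rule less.hyps[OF len'])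
      then show ?thesis
        using app simple_reflection_simple(2)[OF \<open>t \<noteq> s\<close> False] by simp
    next
      case True
      show ?thesis
      proof (cases "wlen x' \<le> wlen (x' @ [s])")
        case le: True
        have "word_prod \<alpha> \<alpha>v x' (\<alpha> s) + word_prod \<alpha> \<alpha>v x' (\<alpha> t) \<in> cone"
          by (intro cone_add less.hyps[OF len'] le le_t)
        then show ?thesis
          using app simple_reflection_simple(3)[OF True] by (simp add: word_prod_linear)
      next
        case False
        \<comment> \<open>Now \<open>x\<close> equals \<open>z @ [s, t]\<close>, and applying
          \<open>t\<close> and then \<open>s\<close> sends \<open>\<alpha> s\<close> to
          \<open>\<alpha> t\<close>, so it is positivity of \<open>z\<close> at
          \<open>\<alpha> t\<close> that counts. If \<open>t\<close> shortened \<open>z\<close>, the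
          braid relation would turn \<open>x @ [s]\<close> into \<open>z @ [t, s, t]\<close>, of
          length at most that of \<open>x'\<close>.\<close>
        define z where "z = x' @ [s]"
        have zlen: "wlen z < wlen x'" using False by (simp add: z_def)
        have x': "weq x' (z @ [s])" using weq_sym[OF weq_square[of x' s]] by (simp add: z_def)
        have "wlen z \<le> wlen (z @ [t])"
        proof (rule ccontr)
          assume "\<not> ?thesis"
          moreover have "weq (x' @ [t, s]) ((z @ [s]) @ [t, s])"
            using x' weq_refl by (rule weq_append)
          moreover have "weq (z @ [s, t, s]) (z @ [t, s, t])"
            using weq_refl weq_braid[OF sym_E[OF True]] by (rule weq_append)
          ultimately have "wlen (x' @ [t, s]) = wlen ((z @ [t]) @ [s, t])"
            by (metis append.assoc append_Cons append_Nil wlen_cong weq_trans)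
          moreover have "wlen ((z @ [t]) @ [s, t]) \<le> wlen (z @ [t]) + length [s, t]"
            by (rule wlen_append)
          ultimately show False using \<open>\<not> wlen z \<le> wlen (z @ [t])\<close> xs less.prems len' zlen by simp
        qed
        then have "word_prod \<alpha> \<alpha>v z (\<alpha> t) \<in> cone"
          using less.hyps[of z t] zlen len' by simp
        moreover have "word_prod \<alpha> \<alpha>v x (\<alpha> s) = word_prod \<alpha> \<alpha>v z (\<alpha> t)"
        proof -
          have "word_prod \<alpha> \<alpha>v x' u = word_prod \<alpha> \<alpha>v z (simple_reflection \<alpha> \<alpha>v s u)" for u
            using x' by (simp add: weq_def word_prod_append)
          moreover have "simple_reflection \<alpha> \<alpha>v s (\<alpha> s + \<alpha> t) = \<alpha> t"
            using word_prod_linear(1)[of \<alpha> \<alpha>v "[s]" "\<alpha> s" "\<alpha> t"]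
            by (simp add: simple_reflection_simple(1) simple_reflection_simple(3)[OF sym_E[OF True]])
          ultimately show ?thesis using app simple_reflection_simple(3)[OF True] by simp
        qed
        ultimately show ?thesis by simp
      qed
    qed
  qed
qed

text \<open>If a shortest word for \<open>x\<close> ended in \<open>t\<close>, positivity would put
  the image of \<open>\<alpha> t\<close> under the remaining letters into the cone, while triviality
  of the first action makes that image \<open>- \<alpha> t\<close>. So the shortest word is empty,
  and the second action is trivial too.\<close>

lemma word_prod_id:
  assumes "word_prod \<alpha> \<alpha>v x = id"
  shows "word_prod \<beta> \<beta>v x = id"
proof -
  obtain y where y: "weq x y" "length y = wlen x" using wlen_word by blast
  show ?thesis
  proof (cases y rule: rev_cases)
    case Nil
    then show ?thesis using y by (auto simp: weq_def word_prod_def)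
  next
    case (snoc z t)
    have "wlen z \<le> wlen (z @ [t])"
      using wlen_le[OF weq_refl, of z] y snoc wlen_cong[OF y(1)] by simp
    then have "word_prod \<alpha> \<alpha>v z (\<alpha> t) \<in> cone" by (rule word_prod_positive)
    moreover have "word_prod \<alpha> \<alpha>v (z @ [t]) (\<alpha> t) = \<alpha> t"
      using assms y(1) snoc by (simp add: weq_def)
    then have "word_prod \<alpha> \<alpha>v z (- \<alpha> t) = \<alpha> t"
      by (simp add: word_prod_append simple_reflection_simple)
    then have "word_prod \<alpha> \<alpha>v z (\<alpha> t) = - \<alpha> t"
      using word_prod_linear(2)[of \<alpha> \<alpha>v z "-1" "\<alpha> t"] by (simp add: vector_sneg_minus1[symmetric] equation_minus_iff)
    ultimately show ?thesis using cone_not_neg by simp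
  qed
qed

lemma word_prod_transfer:
  assumes "word_prod \<alpha> \<alpha>v x = word_prod \<alpha> \<alpha>v y"
  shows "word_prod \<beta> \<beta>v x = word_prod \<beta> \<beta>v y"
proof -
  have "word_prod \<alpha> \<alpha>v (x @ rev y) = id"
    using assms word_prod_rev[OF rs1, of y] by (simp add: fun_eq_iff word_prod_append)
  then have "word_prod \<beta> \<beta>v (x @ rev y) = id" by (rule word_prod_id)
  then have "word_prod \<beta> \<beta>v (x @ rev y @ y) u = word_prod \<beta> \<beta>v y u" for u
    by (simp add: fun_eq_iff word_prod_append)
  then show ?thesis
    using word_prod_rev[OF rs2, of "rev y"] by (simp add: fun_eq_iff word_prod_append)
qed

end

subsection \<open>Growth of matrix powers\<close>

definition enum_index :: "nat \<Rightarrow> 'v::finite" where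
  "enum_index = (SOME f. bij_betw f {0..<CARD('v)} UNIV)"

lemma bij_enum_index: "bij_betw (enum_index :: nat \<Rightarrow> 'v::finite) {0..<CARD('v)} UNIV"
  unfolding enum_index_def using someI_ex[OF ex_bij_betw_nat_finite[of "UNIV :: 'v set"]] by simp

lemma inj_enum_index: "inj_on (enum_index :: nat \<Rightarrow> 'v::finite) {0..<CARD('v)}"
  by (rule bij_betw_imp_inj_on[OF bij_enum_index])

lemma enum_index_surj: "\<exists>i<CARD('v). u = (enum_index i :: 'v::finite)"
proof -
  have "bij_betw (enum_index :: nat \<Rightarrow> 'v) {0..<CARD('v)} UNIV" by (rule bij_enum_index)
  then have "u \<in> enum_index ` {0..<CARD('v)}" by (simp add: bij_betw_def)
  then show ?thesis by auto
qed

text \<open>Renumbers the vertices so that the Jordan form bounds for number-indexed matrices apply;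
  determinant and characteristic polynomial do not depend on the numbering.\<close>

definition jmat :: "complex^'v::finite^'v \<Rightarrow> complex Matrix.mat" where
  "jmat A = Matrix.mat CARD('v) CARD('v) (\<lambda>(i, j). A $ enum_index i $ enum_index j)"

lemma jmat_carrier [simp]: "jmat (A :: complex^'v::finite^'v) \<in> carrier_mat CARD('v) CARD('v)"
  by (simp add: jmat_def)

lemma det_jmat: "Determinant.det (jmat A) = det (A :: complex^'v::finite^'v)"
proof -
  let ?n = "CARD('v)" and ?f = "enum_index :: nat \<Rightarrow> 'v"
  have bij: "bij_betw ?f {0..<?n} UNIV" by (rule bij_enum_index)
  have bij': "bij_betw (inv_into {0..<?n} ?f) UNIV {0..<?n}" by (rule bij_betw_inv_into[OF bij])
  have inj: "inj_on ?f {0..<?n}" using bij by (rule bij_betw_imp_inj_on)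
  have "Determinant.det (jmat A) =
      (\<Sum>p\<in>{p. p permutes {0..<?n}}. of_int (sign p) * (\<Prod>i = 0..<?n. A $ ?f i $ ?f (p i)))"
    by (subst det_def'[OF jmat_carrier])
      (auto simp: jmat_def permutes_in_image intro!: sum.cong prod.cong)
  also have "\<dots> = (\<Sum>p\<in>{p. p permutes (UNIV :: 'v set)}. of_int (sign p) * (\<Prod>i\<in>UNIV. A $ i $ p i))"
  proof (rule sum.reindex_bij_witness[where i = "map_permutation UNIV (inv_into {0..<?n} ?f)"
        and j = "map_permutation {0..<?n} ?f"])
    fix p assume p: "p \<in> {p. p permutes {0..<?n}}"
    show "map_permutation UNIV (inv_into {0..<?n} ?f) (map_permutation {0..<?n} ?f p) = p"
      by (rule map_permutation_compose_inv[of ?f "{0..<?n}"])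
        (use p bij inj in \<open>auto simp: bij_betw_def\<close>)
    show "map_permutation {0..<?n} ?f p \<in> {p. p permutes UNIV}"
      using map_permutation_permutes[OF bij] p by blast
    have "(\<Prod>i\<in>UNIV. A $ i $ map_permutation {0..<?n} ?f p i) =
        (\<Prod>i\<in>{0..<?n}. A $ ?f i $ map_permutation {0..<?n} ?f p (?f i))"
      by (rule prod.reindex_bij_betw[OF bij, symmetric])
    also have "\<dots> = (\<Prod>i = 0..<?n. A $ ?f i $ ?f (p i))"
      by (rule prod.cong) (simp_all add: map_permutation_apply[OF inj])
    finally show "of_int (sign (map_permutation {0..<?n} ?f p)) * (\<Prod>i\<in>UNIV. A $ i $ map_permutation {0..<?n} ?f p i) =
        of_int (sign p) * (\<Prod>i = 0..<?n. A $ ?f i $ ?f (p i))"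
      using sign_map_permutation[OF inj, of p] p by simp
  next
    fix p assume p: "p \<in> {p. p permutes (UNIV :: 'v set)}"
    show "map_permutation UNIV (inv_into {0..<?n} ?f) p \<in> {p. p permutes {0..<?n}}"
      using map_permutation_permutes[OF bij'] p by blast
    show "map_permutation {0..<?n} ?f (map_permutation UNIV (inv_into {0..<?n} ?f) p) = p"
      by (rule map_permutation_compose_inv[OF bij'])
        (use p bij inj in \<open>auto simp: bij_betw_def f_inv_into_f\<close>)
  qed
  finally show ?thesis by (simp add: Determinants.det_def)
qed

lemma char_poly_jmat: "poly (char_poly (jmat A)) x = det (mat x - (A :: complex^'v::finite^'v))"
proof -
  have inj: "i < CARD('v) \<Longrightarrow> j < CARD('v) \<Longrightarrow> (enum_index i :: 'v) = enum_index j \<longleftrightarrow> i = j" for i j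
    using inj_enum_index[unfolded inj_on_def, THEN bspec, THEN bspec, of i j] by auto
  have "poly (char_poly (jmat A)) x = Determinant.det (jmat (mat x - A))"
    unfolding char_poly_def
  proof (rule poly_det_cong[of _ "CARD('v)"])
    show "char_poly_matrix (jmat A) \<in> carrier_mat CARD('v) CARD('v)"
      unfolding char_poly_matrix_def using jmat_carrier[of A] by auto
    show "poly (char_poly_matrix (jmat A) $$ (i, j)) x = jmat (mat x - A) $$ (i, j)"
      if "i < CARD('v)" "j < CARD('v)" for i j
      using that inj[OF that] by (simp add: char_poly_matrix_def jmat_def Finite_Cartesian_Product.mat_def)
  qed simp
  then show ?thesis by (simp add: det_jmat)
qed

primrec rpow :: "('v::finite \<Rightarrow> 'v \<Rightarrow> real) \<Rightarrow> nat \<Rightarrow> 'v \<Rightarrow> 'v \<Rightarrow> real" where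
  "rpow m 0 i j = (if i = j then 1 else 0)"
| "rpow m (Suc k) i j = (\<Sum>l\<in>UNIV. rpow m k i l * m l j)"

definition cmat :: "('v::finite \<Rightarrow> 'v \<Rightarrow> real) \<Rightarrow> complex^'v^'v" where
  "cmat m = (\<chi> i j. complex_of_real (m i j))"

lemma pow_jmat:
  assumes "i < CARD('v)" "j < CARD('v)"
  shows "(jmat (cmat (m :: 'v::finite \<Rightarrow> 'v \<Rightarrow> real)) ^\<^sub>m k) $$ (i, j) =
    complex_of_real (rpow m k (enum_index i) (enum_index j))"
  using assms
proof (induction k arbitrary: j)
  case 0
  have "(enum_index i :: 'v) = enum_index j \<longleftrightarrow> i = j"
    using inj_enum_index[unfolded inj_on_def, THEN bspec, THEN bspec, of i j] 0 by auto
  then show ?case using 0 by (simp add: jmat_def)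
next
  case (Suc k)
  let ?n = "CARD('v)" and ?J = "jmat (cmat m)"
  have c: "?J ^\<^sub>m k \<in> carrier_mat ?n ?n" by (rule pow_carrier_mat[OF jmat_carrier])
  have "(?J ^\<^sub>m Suc k) $$ (i, j) = (\<Sum>l = 0..<?n. (?J ^\<^sub>m k) $$ (i, l) * ?J $$ (l, j))"
    using c Suc.prems by (simp add: scalar_prod_def jmat_def)
  also have "\<dots> = (\<Sum>l = 0..<?n. complex_of_real (rpow m k (enum_index i) (enum_index l) * m (enum_index l) (enum_index j)))"
    using Suc by (intro sum.cong) (simp_all add: jmat_def cmat_def)
  also have "\<dots> = (\<Sum>l\<in>UNIV. complex_of_real (rpow m k (enum_index i) l * m l (enum_index j)))"
    by (rule sum.reindex_bij_betw[OF bij_enum_index])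
  finally show ?case by simp
qed

lemma rpow_scale: "rpow (\<lambda>i j. c * m i j) k i j = c ^ k * rpow m k i j"
  by (induction k arbitrary: j) (simp_all add: sum_distrib_left mult_ac)

lemma det_scale: "det (\<chi> i j. c * (A :: complex^'v::finite^'v) $ i $ j) = c ^ CARD('v) * det A"
proof -
  have "(\<Prod>i\<in>UNIV. c * A $ i $ p i) = c ^ CARD('v) * (\<Prod>i\<in>UNIV. A $ i $ p i)" for p
    by (simp add: prod.distrib)
  then show ?thesis by (simp add: Determinants.det_def sum_distrib_left mult_ac)
qed

text \<open>After division by \<open>R\<close> all eigenvalues lie inside the unit disc, where the
  Jordan form bounds all powers at once; undoing the scaling returns the factor
  \<open>R ^ k\<close>.\<close>

lemma rpow_bound:
  assumes roots: "\<And>x. det (mat x - cmat m) = 0 \<Longrightarrow> cmod x < R" and "R > 0"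
  shows "\<exists>c. \<forall>k i j. rpow (m :: 'v::finite \<Rightarrow> 'v \<Rightarrow> real) k i j \<le> c * R ^ k"
proof -
  let ?m = "\<lambda>i j. (1 / R) * m i j"
  let ?J = "jmat (cmat ?m)"
  have J: "?J \<in> carrier_mat CARD('v) CARD('v)" by simp
  have "cmod x < 1" if "x \<in> spectrum ?J" for x
  proof -
    have "det (mat x - cmat ?m) = 0"
      using that unfolding spectrum_root_char_poly[OF J] by (simp add: char_poly_jmat)
    moreover have "mat (R * x) - cmat m = (\<chi> i j. of_real R * (mat x - cmat ?m) $ i $ j)"
      using \<open>R > 0\<close>
      by (simp add: Finite_Cartesian_Product.vec_eq_iff Finite_Cartesian_Product.mat_def cmat_def right_diff_distrib)
    ultimately have "det (mat (R * x) - cmat m) = 0" by (simp only: det_scale) simp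
    then show ?thesis using roots[of "R * x"] \<open>R > 0\<close> by (simp add: norm_mult)
  qed
  then have "spectral_radius ?J < 1"
    using spectral_radius_mem_max(1)[OF J] by auto
  then obtain c where c: "\<And>k. norm_bound (?J ^\<^sub>m k) c"
    using spectral_radius_jnf_norm_bound_less_1_upper_triangular[OF J] by blast
  have "rpow m k i j \<le> c * R ^ k" for k i j
  proof -
    obtain i' j' where ij: "i' < CARD('v)" "i = enum_index i'" "j' < CARD('v)" "j = enum_index j'"
      using enum_index_surj by metis
    have car: "?J ^\<^sub>m k \<in> carrier_mat CARD('v) CARD('v)" by (rule pow_carrier_mat[OF J])
    have "cmod ((?J ^\<^sub>m k) $$ (i', j')) \<le> c"
      using c[of k, unfolded norm_bound_def carrier_matD[OF car]] ij(1,3) by blast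
    then have "\<bar>rpow ?m k i j\<bar> \<le> c"
      using ij by (simp add: pow_jmat)
    then have "rpow m k i j / R ^ k \<le> c"
      unfolding rpow_scale using \<open>R > 0\<close> by (simp add: abs_mult field_simps power_one_over)
    then show ?thesis using \<open>R > 0\<close> by (simp add: field_simps)
  qed
  then show ?thesis by blast
qed

lemma det_roots_bounded: "\<exists>R>0. \<forall>x. det (mat x - (A :: complex^'v::finite^'v)) = 0 \<longrightarrow> cmod x < R"
proof -
  let ?S = "spectrum (jmat A)"
  have J: "jmat A \<in> carrier_mat CARD('v) CARD('v)" by simp
  have "finite ?S" by (rule card_finite_spectrum[OF J])
  then have B: "cmod x \<le> Max (insert 0 (cmod ` ?S))" if "x \<in> ?S" for x
    using that by (intro Max_ge) auto
  have "cmod x < Max (insert 0 (cmod ` ?S)) + 1" if "det (mat x - A) = 0" for x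
    using B[of x] that unfolding spectrum_root_char_poly[OF J] by (auto simp: char_poly_jmat)
  moreover have "0 \<le> Max (insert 0 (cmod ` ?S))" using \<open>finite ?S\<close> by (intro Max_ge) auto
  ultimately show ?thesis by (intro exI[of _ "Max (insert 0 (cmod ` ?S)) + 1"]) auto
qed

lemma det_eq_infinite:
  fixes A B :: "complex^'v::finite^'v"
  assumes "infinite X" "\<And>x. x \<in> X \<Longrightarrow> det (mat x - A) = det (mat x - B)"
  shows "det (mat x - A) = det (mat x - B)"
proof -
  let ?p = "char_poly (jmat A) - char_poly (jmat B)"
  have "X \<subseteq> {x. poly ?p x = 0}" using assms(2) by (auto simp: char_poly_jmat)
  then have "?p = 0" using poly_roots_finite[of ?p] assms(1) finite_subset by blast
  then show ?thesis by (metis char_poly_jmat right_minus_eq)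
qed

text \<open>\<open>A\<close> is unitriangular for the grading \<open>f\<close>. A permutation with
  nonzero product can only raise \<open>f\<close>; as the sum of \<open>f\<close> is invariant it
  raises it nowhere, hence it is the identity.\<close>

lemma det_order:
  fixes A :: "complex^'v::finite^'v" and f :: "'v \<Rightarrow> nat"
  assumes "\<And>i. A $ i $ i = 1" "\<And>i j. i \<noteq> j \<Longrightarrow> A $ i $ j \<noteq> 0 \<Longrightarrow> f i < f j"
  shows "det A = 1"
proof -
  have "(\<Prod>i\<in>UNIV. A $ i $ p i) = 0" if p: "p permutes UNIV" "p \<noteq> id" for p
  proof (rule ccontr)
    assume "\<not> ?thesis"
    then have nz: "A $ i $ p i \<noteq> 0" for i by auto
    have le: "f i \<le> f (p i)" for i
      using assms(2)[of i "p i"] nz[of i] by (cases "p i = i") auto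
    obtain i where "p i \<noteq> i" using p(2) by (auto simp: fun_eq_iff)
    then have "f i < f (p i)" using assms(2)[of i "p i"] nz[of i] by auto
    then have "(\<Sum>i\<in>UNIV. f i) < (\<Sum>i\<in>UNIV. f (p i))"
      using le by (intro sum_strict_mono_ex1) auto
    moreover have "(\<Sum>i\<in>UNIV. f (p i)) = (\<Sum>i\<in>UNIV. f i)"
      using sum.permute[OF p(1), of f] by (simp add: o_def)
    ultimately show False by simp
  qed
  then have "(\<Sum>p\<in>{p. p permutes UNIV}. of_int (sign p) * (\<Prod>i\<in>UNIV. A $ i $ p i)) =
      (\<Sum>p\<in>{id}. of_int (sign p) * (\<Prod>i\<in>UNIV. A $ i $ p i))"
    by (intro sum.mono_neutral_right) (auto simp: permutes_id)
  then show ?thesis using assms(1) by (simp add: Determinants.det_def sign_id)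
qed

subsection \<open>Deformed reflection representations\<close>

text \<open>Row \<open>i\<close> of the deformed Cartan matrix. The roots are the unit vectors, so
  the whole deformation sits in the coroots.\<close>

definition deformed_coroot :: "('v \<Rightarrow> 'v \<Rightarrow> bool) \<Rightarrow> ('v \<Rightarrow> 'v \<Rightarrow> complex) \<Rightarrow> 'v \<Rightarrow> complex^'v" where
  "deformed_coroot E q i = (\<chi> j. if i = j then 2 else if E i j then - q i j else 0)"

lemma pairing_axis: "pairing (axis k 1) h = h $ k"
proof -
  have "pairing (axis k 1) h = (\<Sum>j\<in>UNIV. if j = k then h $ k else 0)"
    unfolding pairing_def by (rule sum.cong) (auto simp: axis_def)
  then show ?thesis by simp
qed

text \<open>When \<open>j\<close> acts, of its neighbours only those to its right in the word, that
  is its out-neighbours, have acted already. Hence the coefficients solve a linear system that is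
  unitriangular for the orientation.\<close>

lemma word_coeff_equation:
  fixes \<alpha> :: "'v::finite \<Rightarrow> complex^'n"
  assumes "distinct w" "set w = UNIV" "\<And>i j. i \<noteq> j \<Longrightarrow> \<not> E j i \<Longrightarrow> pairing (\<alpha> i) (\<alpha>v j) = 0"
  shows "word_coeff \<alpha> \<alpha>v w x j + (\<Sum>k\<in>{k. (j, k) \<in> orient E w}. word_coeff \<alpha> \<alpha>v w x k * pairing (\<alpha> k) (\<alpha>v j))
    = pairing x (\<alpha>v j)"
proof -
  obtain a b where w: "w = a @ j # b" using assms(2) by (metis UNIV_I split_list)
  have d: "distinct (a @ j # b)" using assms(1) w by simp
  have set: "{k. (j, k) \<in> orient E w} = {k \<in> set b. E j k}"
  proof -
    have "(j, k) \<notin> orient E a" "(j, k) \<notin> orient E b" for k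
      using d orient_edge[of j k E a] orient_edge[of j k E b] by auto
    then show ?thesis using d by (auto simp: w orient_append)
  qed
  have suf: "word_coeff \<alpha> \<alpha>v w x k = word_coeff \<alpha> \<alpha>v b x k" if "k \<in> set b" for k
    using d that word_coeff_suffix[of k "a @ [j]" \<alpha> \<alpha>v b x] by (auto simp: w)
  have "word_coeff \<alpha> \<alpha>v w x j = word_coeff \<alpha> \<alpha>v (j # b) x j"
    unfolding w by (rule word_coeff_suffix) (use d in auto)
  also have "\<dots> = pairing x (\<alpha>v j) - (\<Sum>k\<in>set b. word_coeff \<alpha> \<alpha>v b x k * pairing (\<alpha> k) (\<alpha>v j))"
    by (rule word_coeff_Cons) (use d in auto)
  also have "(\<Sum>k\<in>set b. word_coeff \<alpha> \<alpha>v b x k * pairing (\<alpha> k) (\<alpha>v j)) =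
      (\<Sum>k\<in>{k \<in> set b. E j k}. word_coeff \<alpha> \<alpha>v b x k * pairing (\<alpha> k) (\<alpha>v j))"
  proof (rule sum.mono_neutral_right)
    show "\<forall>k\<in>set b - {k \<in> set b. E j k}. word_coeff \<alpha> \<alpha>v b x k * pairing (\<alpha> k) (\<alpha>v j) = 0"
    proof
      fix k assume k: "k \<in> set b - {k \<in> set b. E j k}"
      then have "k \<noteq> j" "\<not> E j k" using d by auto
      then show "word_coeff \<alpha> \<alpha>v b x k * pairing (\<alpha> k) (\<alpha>v j) = 0" by (simp add: assms(3))
    qed
  qed auto
  also have "\<dots> = (\<Sum>k\<in>{k. (j, k) \<in> orient E w}. word_coeff \<alpha> \<alpha>v w x k * pairing (\<alpha> k) (\<alpha>v j))"
    unfolding set by (rule sum.cong) (simp_all add: suf)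
  finally show ?thesis by simp
qed

lemma mat_vector: "mat t *v x = t *s (x :: complex^'v::finite)"
  by (simp add: Finite_Cartesian_Product.vec_eq_iff matrix_vector_mult_def Finite_Cartesian_Product.mat_def
      if_distrib[of "\<lambda>c. c * _"] sum.delta cong: if_cong)

section \<open>The characteristic polynomial of a deformed Coxeter element as a pencil of its
  orientation\<close>

context simple_graph
begin

text \<open>With \<open>U\<close> for \<open>unitri D q\<close> and \<open>C\<close> for the
  deformed Cartan matrix this is \<open>(t - 1) U + C\<close>. Equivalently, \<open>C\<close> is cut
  into \<open>U\<close> and the part against \<open>D\<close>, each with unit diagonal, and
  \<open>U\<close> is multiplied by \<open>t\<close>.\<close>

definition pencil :: "('v \<times> 'v) set \<Rightarrow> complex \<Rightarrow> ('v \<Rightarrow> 'v \<Rightarrow> complex) \<Rightarrow> complex^'v^'v" where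
  "pencil D t q = (\<chi> j k. if j = k then t + 1 else if (j, k) \<in> D then - t * q j k
     else if (k, j) \<in> D then - q j k else 0)"

definition unitri :: "('v \<times> 'v) set \<Rightarrow> ('v \<Rightarrow> 'v \<Rightarrow> complex) \<Rightarrow> complex^'v^'v" where
  "unitri D q = (\<chi> j k. if j = k then 1 else if (j, k) \<in> D then - q j k else 0)"

lemma deformed_system:
  assumes "\<And>i j. E i j \<Longrightarrow> q i j * q j i = 1"
  shows "reflection_system E (\<lambda>i. axis i 1) (deformed_coroot E q)"
  using assms sym_E irrefl_E
  by (auto simp: reflection_system_def pairing_axis deformed_coroot_def)

lemma det_unitri:
  assumes "D \<in> orientations_on E UNIV" shows "det (unitri D q) = 1"
\<comment> \<open>The grading counts proper ancestors; along an arc the ancestor set grows strictly,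
  the tail itself being new by acyclicity.\<close>
proof (rule det_order[where f = "\<lambda>k. card {j. (j, k) \<in> D\<^sup>+}"])
  fix i j assume "i \<noteq> j" "unitri D q $ i $ j \<noteq> 0"
  then have ij: "(i, j) \<in> D" by (auto simp: unitri_def split: if_splits)
  have "acyclic D" by (rule orientations_onD(3)[OF assms])
  then have "i \<notin> {l. (l, i) \<in> D\<^sup>+}" by (simp add: acyclic_def)
  moreover have "{l. (l, i) \<in> D\<^sup>+} \<subseteq> {l. (l, j) \<in> D\<^sup>+}" using ij by (auto intro: trancl_into_trancl)
  moreover have "i \<in> {l. (l, j) \<in> D\<^sup>+}" using ij by auto
  ultimately have "{l. (l, i) \<in> D\<^sup>+} \<subset> {l. (l, j) \<in> D\<^sup>+}" by blast
  then show "card {l. (l, i) \<in> D\<^sup>+} < card {l. (l, j) \<in> D\<^sup>+}" by (intro psubset_card_mono) auto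
qed (simp add: unitri_def)

lemma word_prod_linear_map: "Vector_Spaces.linear (*s) (*s) (word_prod \<alpha> \<alpha>v w :: complex^'n \<Rightarrow> _)"
  unfolding Vector_Spaces.linear_iff
  by (auto intro!: vec.vector_space_axioms simp: word_prod_linear)

text \<open>Writing \<open>c x = x - y\<close>, the coefficient system reads
  \<open>U y = C x\<close>, so \<open>U (t - c) = (t - 1) U + C\<close>, and \<open>U\<close> has
  determinant 1.\<close>

lemma det_coxeter:
  assumes w: "distinct w" "set w = UNIV"
  shows "det (mat t - matrix (word_prod (\<lambda>i. axis i 1) (deformed_coroot E q) w)) = det (pencil (orient E w) t q)"
proof -
  let ?D = "orient E w" and ?c = "word_prod (\<lambda>i. axis i 1) (deformed_coroot E q) w"
  let ?U = "unitri ?D q" and ?C = "\<chi> i. deformed_coroot E q i"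
  have D: "?D \<in> orientations_on E UNIV" using orient_mem[OF w(1)] w(2) by simp
  have N: "pencil ?D t q $ j $ k = (t - 1) * ?U $ j $ k + ?C $ j $ k" for j k
    using orientations_onD(1,2)[OF D, of j k] orientations_onD(1)[OF D, of k j] sym_E[of k j]
    by (auto simp: pencil_def unitri_def deformed_coroot_def algebra_simps)
  have "(?U ** (mat t - matrix ?c)) *v x = pencil ?D t q *v x" for x
  proof -
    let ?y = "\<chi> j. word_coeff (\<lambda>i. axis i 1) (deformed_coroot E q) w x j"
    have "(\<Sum>j\<in>UNIV. ?y $ j *s axis j 1) = ?y" by (rule basis_expansion)
    then have c: "?c x = x - ?y" by (simp add: word_prod_coeff)
    have Uy: "?U *v ?y = ?C *v x"
    proof (simp add: Finite_Cartesian_Product.vec_eq_iff, intro allI)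
      fix j
      have eq: "?y $ j + (\<Sum>k\<in>{k. (j, k) \<in> ?D}. ?y $ k * pairing (axis k 1) (deformed_coroot E q j)) =
          pairing x (deformed_coroot E q j)"
        using word_coeff_equation[OF w, of E "\<lambda>i. axis i 1" "deformed_coroot E q" x j]
        by (simp add: pairing_axis deformed_coroot_def)
      have "(?U *v ?y) $ j = (\<Sum>k\<in>UNIV. (if k = j then ?y $ j else 0) +
          (if (j, k) \<in> ?D then ?y $ k * deformed_coroot E q j $ k else 0))"
        unfolding matrix_vector_mult_def vec_lambda_beta
      proof (rule sum.cong[OF HOL.refl])
        fix k
        show "?U $ j $ k * word_coeff (\<lambda>i. axis i 1) (deformed_coroot E q) w x k =
            (if k = j then word_coeff (\<lambda>i. axis i 1) (deformed_coroot E q) w x j else 0) +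
            (if (j, k) \<in> ?D then word_coeff (\<lambda>i. axis i 1) (deformed_coroot E q) w x k *
               deformed_coroot E q j $ k else 0)"
          using orientations_onD(1)[OF D, of j k] irrefl_E[of j]
          by (auto simp: unitri_def deformed_coroot_def)
      qed
      also have "\<dots> = ?y $ j + (\<Sum>k\<in>{k. (j, k) \<in> ?D}. ?y $ k * deformed_coroot E q j $ k)"
        by (simp add: sum.distrib sum.inter_filter[symmetric])
      also have "\<dots> = pairing x (deformed_coroot E q j)"
        using eq by (simp add: pairing_axis)
      also have "\<dots> = (?C *v x) $ j"
        by (simp add: matrix_vector_mult_def pairing_def mult.commute)
      finally show "(?U *v ?y) $ j = (?C *v x) $ j" .
    qed
    have "(?U ** (mat t - matrix ?c)) *v x = ?U *v (t *s x - ?c x)"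
      by (simp add: matrix_vector_mul_assoc[symmetric] matrix_vector_mult_diff_rdistrib mat_vector
          matrix_works[OF word_prod_linear_map])
    also have "t *s x - ?c x = (t - 1) *s x + ?y"
      by (simp add: c Finite_Cartesian_Product.vec_eq_iff algebra_simps)
    also have "?U *v ((t - 1) *s x + ?y) = (t - 1) *s (?U *v x) + ?C *v x"
      by (simp only: matrix_vector_right_distrib vector_scalar_commute Uy)
    also have "\<dots> = pencil ?D t q *v x"
    proof -
      have "(pencil ?D t q *v x) $ j = ((t - 1) *s (?U *v x) + ?C *v x) $ j" for j
        unfolding matrix_vector_mult_def vec_lambda_beta vector_add_component vector_smult_component N
          distrib_right sum.distrib sum_distrib_left mult.assoc ..
      then show ?thesis by (simp add: Finite_Cartesian_Product.vec_eq_iff)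
    qed
    finally show ?thesis .
  qed
  then have "?U ** (mat t - matrix ?c) = pencil ?D t q" by (simp add: matrix_eq)
  then have "det ?U * det (mat t - matrix ?c) = det (pencil ?D t q)" by (metis det_mul)
  then show ?thesis by (simp add: det_unitri[OF D])
qed

lemma det_conjugate:
  assumes "word_prod \<alpha> \<alpha>v w' = word_prod \<alpha> \<alpha>v (u @ w @ rev u)" and rs: "reflection_system E \<alpha> \<alpha>v"
  shows "det (mat t - matrix (word_prod \<alpha> \<alpha>v w')) = det (mat t - matrix (word_prod \<alpha> \<alpha>v w :: complex^'v \<Rightarrow> _))"
proof -
  let ?P = "matrix (word_prod \<alpha> \<alpha>v u)" and ?Q = "matrix (word_prod \<alpha> \<alpha>v (rev u))"
    and ?c = "matrix (word_prod \<alpha> \<alpha>v w)"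
  have lin: "matrix (word_prod \<alpha> \<alpha>v v) *v x = word_prod \<alpha> \<alpha>v v x" for v x
    by (rule matrix_works[OF word_prod_linear_map])
  have PQ: "?P ** ?Q = mat 1"
    using word_prod_rev[OF rs, of u]
    by (simp add: matrix_eq matrix_vector_mul_assoc[symmetric] lin word_prod_append)
  have "mat t - matrix (word_prod \<alpha> \<alpha>v w') = ?P ** (mat t - ?c) ** ?Q"
    using word_prod_rev[OF rs, of u]
    by (simp add: matrix_eq matrix_vector_mul_assoc[symmetric] lin word_prod_append assms(1)
        matrix_vector_mult_diff_rdistrib mat_vector matrix_vector_mult_diff_distrib vector_scalar_commute)
  then have "det (mat t - matrix (word_prod \<alpha> \<alpha>v w')) = det (?P ** ?Q) * det (mat t - ?c)"
    by (simp add: det_mul)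
  then show ?thesis by (simp add: PQ)
qed

text \<open>Up to sign, for \<open>t = r^2\<close> an arc of \<open>D\<close> contributes
  \<open>t * g / r\<close> and a reversed arc \<open>g * r\<close>, both equal to
  \<open>r * g\<close>; the diagonal is \<open>r^2 + 1 = r * (r + 1 / r)\<close>.\<close>

lemma pencil_gauge:
  assumes D: "D \<in> orientations_on E UNIV" and "r \<noteq> 0"
  shows "pencil D (r\<^sup>2) (\<lambda>j k. g j k * (if (j, k) \<in> D then 1 / r else r)) =
    (\<chi> j k. r * (mat (r + 1 / r) - (\<chi> j k. if E j k then g j k else 0)) $ j $ k)"
proof (intro Finite_Cartesian_Product.vec_eq_iff[THEN iffD2] allI)
  fix j k
  show "pencil D (r\<^sup>2) (\<lambda>j k. g j k * (if (j, k) \<in> D then 1 / r else r)) $ j $ k =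
      (\<chi> j k. r * (mat (r + 1 / r) - (\<chi> j k. if E j k then g j k else 0)) $ j $ k) $ j $ k"
    using orientations_onD(1,2)[OF D, of j k] orientations_onD(1)[OF D, of k j] sym_E[of k j] irrefl_E[of j] \<open>r \<noteq> 0\<close>
    by (auto simp: pencil_def Finite_Cartesian_Product.mat_def field_simps power2_eq_square)
qed

section \<open>Walks and weighted walk counts\<close>

inductive walk :: "('v \<Rightarrow> 'v \<Rightarrow> int) \<Rightarrow> 'v \<Rightarrow> 'v \<Rightarrow> nat \<Rightarrow> int \<Rightarrow> bool" for \<delta> where
  walk_nil: "walk \<delta> u u 0 0"
| walk_step: "walk \<delta> u v k d \<Longrightarrow> E v w \<Longrightarrow> walk \<delta> u w (Suc k) (d + \<delta> v w)"

lemma walk_append: "walk \<delta> v w l e \<Longrightarrow> walk \<delta> u v k d \<Longrightarrow> walk \<delta> u w (k + l) (d + e)"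
proof (induction rule: walk.induct)
  case (walk_step v v' l e w)
  then show ?case using walk.walk_step[of \<delta> u v' "k + l" "d + e" w] by (simp add: add.assoc)
qed simp

lemma walk_repeat: "walk \<delta> u u k d \<Longrightarrow> walk \<delta> u u (n * k) (of_nat n * d)"
proof (induction n)
  case (Suc n)
  then show ?case using walk_append[of \<delta> u u "n * k" "of_nat n * d" u k d] by (simp add: algebra_simps)
qed (simp add: walk_nil)

lemma walk_rev:
  assumes "\<And>u v. E u v \<Longrightarrow> \<delta> v u = - \<delta> u v"
  shows "walk \<delta> u v k d \<Longrightarrow> walk \<delta> v u k (- d)"
proof (induction rule: walk.induct)
  case (walk_step u v k d w)
  have "walk \<delta> w v 1 (\<delta> w v)"
    using walk.walk_step[OF walk_nil[of \<delta> w] sym_E[OF walk_step.hyps(2)]] by simp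
  have "- (d + \<delta> v w) = \<delta> w v + - d" "Suc k = 1 + k"
    using assms[OF walk_step.hyps(2)] by simp_all
  then show ?case using walk_append[OF walk_step.IH \<open>walk \<delta> w v 1 (\<delta> w v)\<close>] by (simp only:)
qed (simp add: walk_nil)

text \<open>On an edge this is 1 if only \<open>D'\<close> points from \<open>u\<close> to
  \<open>v\<close>, -1 if only \<open>D\<close> does, and 0 if they agree. It is antisymmetric, and
  once it vanishes on closed walks of a connected graph it is the difference of a vertex
  potential.\<close>

definition orient_diff :: "('v \<times> 'v) set \<Rightarrow> ('v \<times> 'v) set \<Rightarrow> 'v \<Rightarrow> 'v \<Rightarrow> int" where
  "orient_diff D D' u v = of_bool ((u, v) \<in> D') - of_bool ((u, v) \<in> D)"

definition exp_weight :: "('v \<Rightarrow> 'v \<Rightarrow> int) \<Rightarrow> real \<Rightarrow> 'v \<Rightarrow> 'v \<Rightarrow> real" where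
  "exp_weight \<delta> y u v = (if E u v then exp (y * of_int (\<delta> u v)) else 0)"

lemma rpow_nonneg: "0 \<le> rpow (exp_weight \<delta> y) k u v"
  by (induction k arbitrary: v) (auto simp: exp_weight_def intro!: sum_nonneg)

text \<open>An entry of a power of a nonnegative matrix is a sum over walks, so it dominates the
  contribution of any single walk.\<close>

lemma rpow_walk: "walk \<delta> u v k d \<Longrightarrow> exp (y * of_int d) \<le> rpow (exp_weight \<delta> y) k u v"
proof (induction rule: walk.induct)
  case (walk_step u v k d w)
  have "exp (y * of_int (d + \<delta> v w)) = exp (y * of_int d) * exp_weight \<delta> y v w"
    using walk_step.hyps by (simp add: exp_weight_def exp_add[symmetric] algebra_simps)
  also have "\<dots> \<le> rpow (exp_weight \<delta> y) k u v * exp_weight \<delta> y v w"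
    using walk_step.IH by (rule mult_right_mono) (simp add: exp_weight_def)
  also have "\<dots> \<le> (\<Sum>l\<in>UNIV. rpow (exp_weight \<delta> y) k u l * exp_weight \<delta> y l w)"
    using rpow_nonneg[of \<delta> y k u]
    by (intro member_le_sum[where f = "\<lambda>l. rpow (exp_weight \<delta> y) k u l * exp_weight \<delta> y l w"])
      (auto simp: exp_weight_def)
  finally show ?case by simp
qed simp

lemma orient_diff_antisym:
  assumes "D \<in> orientations_on E UNIV" "D' \<in> orientations_on E UNIV" "E u v"
  shows "orient_diff D D' v u = - orient_diff D D' u v"
  using orientations_onD(2)[OF assms(1), of u v] orientations_onD(2)[OF assms(2), of u v] assms(3)
  by (auto simp: orient_diff_def)

section \<open>Two orientations whose deformed Coxeter elements have the same characteristic
  polynomials\<close>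

context
  fixes D D' :: "('v \<times> 'v) set"
  assumes D: "D \<in> orientations_on E UNIV" and D': "D' \<in> orientations_on E UNIV"
    and same: "\<And>q t. (\<And>i j. E i j \<Longrightarrow> q i j * q j i = 1) \<Longrightarrow> det (pencil D t q) = det (pencil D' t q)"
begin

abbreviation "\<delta> \<equiv> orient_diff D D'"

text \<open>With \<open>t = r\<^sup>2\<close> the weights \<open>q\<close> may be rescaled along \<open>D\<close> or along \<open>D'\<close> so that the pencil becomes
  \<open>r\<close> times a characteristic matrix of a weighted adjacency matrix that no longer mentions the
  orientation; comparing both rescalings shifts the exponent.\<close>

lemma det_shift:
  "det (mat (complex_of_real (2 * cosh \<rho>)) - cmat (exp_weight \<delta> y)) =
   det (mat (complex_of_real (2 * cosh \<rho>)) - cmat (exp_weight \<delta> (y + 2 * \<rho>)))"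
proof -
  define r where "r = complex_of_real (exp \<rho>)"
  have r0: "r \<noteq> 0" by (simp add: r_def)
  define g where "g z j k = complex_of_real (exp (z * of_int (\<delta> j k)))" for z j k
  let ?q = "\<lambda>D z j k. g z j k * (if (j, k) \<in> D then 1 / r else r)"
  have r2: "complex_of_real (exp (2 * \<rho>)) = r * r" "complex_of_real (exp (- (2 * \<rho>))) = 1 / (r * r)"
  proof -
    have "exp (2 * \<rho>) = exp \<rho> * exp \<rho>" by (simp add: exp_add[symmetric])
    then show "complex_of_real (exp (2 * \<rho>)) = r * r" "complex_of_real (exp (- (2 * \<rho>))) = 1 / (r * r)"
      by (simp_all add: r_def exp_minus inverse_eq_divide)
  qed
  have rr: "complex_of_real (2 * cosh \<rho>) = r + 1 / r"
    by (simp add: r_def cosh_field_def exp_minus field_simps)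
  \<comment> \<open>Where the orientations differ, the factors \<open>1 / r\<close> and
    \<open>r\<close> trade places. Their quotient is compensated by
    \<open>exp (2 * \<rho> * \<delta>)\<close>, hence the shift of \<open>y\<close> by
    \<open>2 * \<rho>\<close>.\<close>
  have q: "?q D y = ?q D' (y + 2 * \<rho>)"
  proof (intro ext)
    fix j k
    show "?q D y j k = ?q D' (y + 2 * \<rho>) j k"
    proof (cases "(j, k) \<in> D"; cases "(j, k) \<in> D'")
      assume "(j, k) \<in> D" "(j, k) \<notin> D'"
      then have "g (y + 2 * \<rho>) j k = g y j k * (1 / (r * r))"
        by (simp add: g_def orient_diff_def algebra_simps exp_add exp_diff r2[symmetric] exp_minus field_simps)
      then show ?thesis using \<open>(j, k) \<in> D\<close> \<open>(j, k) \<notin> D'\<close> r0 by simp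
    next
      assume "(j, k) \<notin> D" "(j, k) \<in> D'"
      then have "g (y + 2 * \<rho>) j k = g y j k * (r * r)"
        by (simp add: g_def orient_diff_def algebra_simps exp_add r2[symmetric])
      then show ?thesis using \<open>(j, k) \<notin> D\<close> \<open>(j, k) \<in> D'\<close> r0 by simp
    qed (simp_all add: g_def orient_diff_def)
  qed
  have "?q D y i j * ?q D y j i = 1" if "E i j" for i j
  proof -
    have "g y i j * g y j i = 1"
      using orient_diff_antisym[OF D D' that]
      by (simp add: g_def exp_add[symmetric] flip: of_real_mult)
    then have "g y i j * (g y j i * c) = c" for c by (simp add: mult.assoc[symmetric])
    then show ?thesis
      using orientations_onD(2)[OF D, of i j] that r0 \<open>g y i j * g y j i = 1\<close> by (auto simp: field_simps)
  qed
  then have "det (pencil D (r\<^sup>2) (?q D y)) = det (pencil D' (r\<^sup>2) (?q D' (y + 2 * \<rho>)))"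
    using same[of "?q D y" "r\<^sup>2"] q by simp
  moreover have "(\<chi> j k. if E j k then g z j k else 0) = cmat (exp_weight \<delta> z)" for z
    by (simp add: cmat_def exp_weight_def g_def Finite_Cartesian_Product.vec_eq_iff)
  ultimately show ?thesis
    using r0 unfolding pencil_gauge[OF D r0] pencil_gauge[OF D' r0] det_scale rr by simp
qed

text \<open>A shift by \<open>2 * \<rho>\<close> is available only at the single point
  \<open>2 * cosh \<rho>\<close>. Reaching \<open>y\<close> from 0 in \<open>n + 1\<close> equal
  steps gives equality at one point for each \<open>n\<close>; both sides being polynomials in
  \<open>x\<close>, these infinitely many points suffice.\<close>

lemma det_exp_weight:
  "det (mat x - cmat (exp_weight \<delta> y)) = det (mat x - cmat (exp_weight \<delta> 0))"
proof (cases "y = 0")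
  case False
  define c where "c n = 2 * cosh (y / (2 * real (Suc n)))" for n
  have step: "det (mat (complex_of_real (c n)) - cmat (exp_weight \<delta> (of_nat l * (y / real (Suc n))))) =
      det (mat (complex_of_real (c n)) - cmat (exp_weight \<delta> 0))" for n l
  proof (induction l)
    case (Suc l)
    have "of_nat (Suc l) * (y / real (Suc n)) = of_nat l * (y / real (Suc n)) + 2 * (y / (2 * real (Suc n)))"
    proof -
      have "2 * (y / (2 * real (Suc n))) = y / real (Suc n)" by (simp del: of_nat_Suc)
      then show ?thesis unfolding of_nat_Suc[of l] distrib_right by simp
    qed
    then show ?case using Suc det_shift[of "y / (2 * real (Suc n))" "of_nat l * (y / real (Suc n))"]
      by (simp add: c_def)
  qed simp
  have "inj (\<lambda>n. complex_of_real (c n))"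
  proof (rule injI)
    fix m n assume "complex_of_real (c m) = complex_of_real (c n)"
    then have "cosh \<bar>y / (2 * real (Suc m))\<bar> = cosh \<bar>y / (2 * real (Suc n))\<bar>"
      unfolding cosh_real_abs by (simp add: c_def)
    then have "\<bar>y / (2 * real (Suc m))\<bar> = \<bar>y / (2 * real (Suc n))\<bar>"
      using cosh_real_nonneg_less_iff[of "\<bar>y / (2 * real (Suc m))\<bar>" "\<bar>y / (2 * real (Suc n))\<bar>"]
        cosh_real_nonneg_less_iff[of "\<bar>y / (2 * real (Suc n))\<bar>" "\<bar>y / (2 * real (Suc m))\<bar>"]
      by (simp only: abs_ge_zero simp_thms less_irrefl HOL.True_implies_equals)
    then show "m = n" using False by (simp add: abs_divide)
  qed
  then have "infinite (range (\<lambda>n. complex_of_real (c n)))" by (rule range_inj_infinite)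
  then show ?thesis
  proof (rule det_eq_infinite)
    fix x assume "x \<in> range (\<lambda>n. complex_of_real (c n))"
    then obtain n where "x = complex_of_real (c n)" by auto
    then show "det (mat x - cmat (exp_weight \<delta> y)) = det (mat x - cmat (exp_weight \<delta> 0))"
      using step[of n "Suc n"] by simp
  qed
qed simp

text \<open>All matrices \<open>exp_weight \<delta> y\<close> have the same characteristic
  polynomial, so their powers grow at a rate \<open>R\<close> independent of \<open>y\<close>.
  Repeating a closed walk with nonzero sum would exceed this rate once \<open>y\<close> is large in
  the right direction.\<close>

lemma closed_walk_zero:
  assumes "walk \<delta> u u k d"
  shows "d = 0"
proof (rule ccontr)
  assume "d \<noteq> 0"
  obtain R where R: "R > 0" "\<And>x. det (mat x - cmat (exp_weight \<delta> 0)) = 0 \<Longrightarrow> cmod x < R"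
    using det_roots_bounded by blast
  \<comment> \<open>Chosen so that one turn of the walk has weight
    \<open>exp (y * d) = exp 1 * R ^ k\<close>, a factor \<open>exp 1\<close> above the growth
    bound.\<close>
  define y where "y = (1 + real k * ln R) / of_int d"
  have "\<exists>c. \<forall>k i j. rpow (exp_weight \<delta> y) k i j \<le> c * R ^ k"
  proof (rule rpow_bound)
    show "cmod x < R" if "det (mat x - cmat (exp_weight \<delta> y)) = 0" for x
      by (rule R(2)) (use that in \<open>simp only: det_exp_weight[of x y]\<close>)
  qed (fact R(1))
  then obtain c where c: "\<And>k i j. rpow (exp_weight \<delta> y) k i j \<le> c * R ^ k" by blast
  have "exp 1 ^ m \<le> c" for m :: nat
  proof -
    have "exp (y * of_int (of_nat m * d)) = exp (real m * (1 + real k * ln R))"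
      using \<open>d \<noteq> 0\<close> by (simp add: y_def)
    also have "\<dots> = exp 1 ^ m * R ^ (m * k)"
      using R(1) by (simp add: algebra_simps exp_add exp_of_nat_mult ln_realpow[symmetric] power_mult mult.commute[of m k]
            flip: exp_of_nat_mult)
    finally have "exp 1 ^ m * R ^ (m * k) \<le> c * R ^ (m * k)"
      using rpow_walk[OF walk_repeat[OF assms, of m], of y] c[of "m * k" u u] by simp
    then show ?thesis using R(1) by simp
  qed
  moreover obtain m where "c < exp 1 ^ m" using real_arch_pow[of "exp 1 :: real" c] by auto
  ultimately show False by (meson not_less)
qed

text \<open>Closed walks have sum zero, so \<open>\<delta>\<close> is the difference of a potential
  \<open>p\<close>. At the boundary of the set \<open>M\<close> where \<open>p\<close> is maximal,
  \<open>D'\<close> directs all edges inwards and \<open>D\<close> outwards. Unless \<open>M\<close>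
  is everything, a source of \<open>D\<close> inside \<open>M\<close>, or of \<open>D'\<close>
  outside \<open>M\<close>, is then a source in the whole graph other than \<open>r\<close>.\<close>

lemma rooted_orientations_eq:
  assumes conn: "connected_graph E" and rD: "D \<in> rooted_orientations E UNIV r" and rD': "D' \<in> rooted_orientations E UNIV r"
  shows "D = D'"
proof -
  have anti: "E u v \<Longrightarrow> \<delta> v u = - \<delta> u v" for u v by (rule orient_diff_antisym[OF D D'])
  have ex: "\<exists>k d. walk \<delta> r v k d" for v
  proof -
    have "E\<^sup>*\<^sup>* r v" using conn by (simp add: connected_graph_def)
    then show ?thesis by induction (blast intro: walk.intros)+
  qed
  define p where "p v = (SOME d. \<exists>k. walk \<delta> r v k d)" for v
  have p: "\<exists>k. walk \<delta> r v k (p v)" for v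
    unfolding p_def by (rule someI_ex) (use ex in blast)
  have uniq: "d = p v" if "walk \<delta> r v k d" for v k d
  proof -
    obtain l where "walk \<delta> r v l (p v)" using p by blast
    from closed_walk_zero[OF walk_append[OF walk_rev[OF anti this] that]] show ?thesis by simp
  qed
  have pE: "p v = p u + \<delta> u v" if "E u v" for u v
    using p[of u] walk_step[OF _ that] uniq by metis
  define M where "M = {v. p v = Max (range p)}"
  have M: "p u < p v" if "u \<notin> M" "v \<in> M" for u v
    using that Max_ge[of "range p" "p u"] unfolding M_def by fastforce
  have "Max (range p) \<in> range p" by (rule Max_in) auto
  then obtain v0 where "Max (range p) = p v0" by (rule rangeE)
  then have "M \<noteq> {}" unfolding M_def by auto
  have cross: "(u, v) \<in> D' \<and> (u, v) \<notin> D" if "u \<notin> M" "v \<in> M" "E u v" for u v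
    using M[OF that(1,2)] pE[OF that(3)] by (auto simp: orient_diff_def split: if_splits)
  have "M = UNIV"
  proof (rule ccontr)
    assume "M \<noteq> UNIV"
    show False
    proof (cases "r \<in> M")
      case False
      obtain x where "x \<in> M" using \<open>M \<noteq> {}\<close> by blast
      obtain s where s: "s \<in> M" "\<And>u. (u, s) \<notin> D \<inter> M \<times> M"
        using source_exists[OF restrict_orientation[OF D subset_UNIV] \<open>x \<in> M\<close>] by blast
      have "(u, s) \<notin> D" for u
        using s cross[of u s] orientations_onD(1)[OF D, of u s] by blast
      then have "s = r" using rootedD(2)[OF rD] by blast
      then show False using s False by simp
    next
      case True
      obtain x where "x \<in> - M" using \<open>M \<noteq> UNIV\<close> by blast
      obtain s where s: "s \<in> - M" "\<And>u. (u, s) \<notin> D' \<inter> (- M) \<times> (- M)"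
        using source_exists[OF restrict_orientation[OF D' subset_UNIV] \<open>x \<in> - M\<close>] by blast
      have "(u, s) \<notin> D'" for u
        using s cross[of s u] orientations_onD(1,2)[OF D', of u s] sym_E[of u s] by blast
      then have "s = r" using rootedD(2)[OF rD'] by blast
      then show False using s True by simp
    qed
  qed
  then have "u \<in> M" for u by simp
  then have const: "p u = Max (range p)" for u unfolding M_def mem_Collect_eq .
  have "p u = p v" for u v by (rule const[of u, folded const[of v]])
  note peq = this
  have "\<delta> u v = 0" if "E u v" for u v using pE[OF that] peq[of u v] by linarith
  then have "(u, v) \<in> D \<longleftrightarrow> (u, v) \<in> D'" if "E u v" for u v
    using that unfolding orient_diff_def by fastforce
  then have "(u, v) \<in> D \<longleftrightarrow> (u, v) \<in> D'" for u v
    using orientations_onD(1)[OF D, of u v] orientations_onD(1)[OF D', of u v] by blast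
  then show ?thesis by auto
qed

end

end

section \<open>Coxeter elements\<close>

context simple_graph
begin

text \<open>Repeatedly moving the complement of the set reachable from \<open>r\<close> to the end of the word enlarges
  that set, until \<open>r\<close> is the only source.\<close>

lemma rotate_to_rooted:
  assumes conn: "connected_graph E"
    and comm: "\<And>w w'. distinct w \<Longrightarrow> distinct w' \<Longrightarrow> set w = UNIV \<Longrightarrow> set w' = UNIV \<Longrightarrow>
      orient E w = orient E w' \<Longrightarrow> P w' \<Longrightarrow> P w"
    and rot: "\<And>a b. distinct (a @ b) \<Longrightarrow> set (a @ b) = UNIV \<Longrightarrow> P (b @ a) \<Longrightarrow> P (a @ b)"
    and rooted: "\<And>w. distinct w \<Longrightarrow> set w = UNIV \<Longrightarrow> orient E w \<in> rooted_orientations E UNIV r \<Longrightarrow> P w"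
    and w: "distinct w" "set w = UNIV"
  shows "P w"
  using w
proof (induction "card (- ((orient E w)\<^sup>* `` {r}))" arbitrary: w rule: less_induct)
  case less
  let ?D = "orient E w" and ?S = "(orient E w)\<^sup>* `` {r}"
  have D: "?D \<in> orientations_on E UNIV" using orient_mem[OF less.prems(1)] less.prems(2) by simp
  have rS: "r \<in> ?S" by auto
  have closed: "v \<in> ?S" if "(u, v) \<in> ?D" "u \<in> ?S" for u v
    using that by (auto intro: rtrancl_into_rtrancl)
  show ?case
  proof (cases "?S = UNIV")
    case True
    have "v = r" if no: "\<And>u. (u, v) \<notin> ?D" for v
    proof -
      have "(r, v) \<in> ?D\<^sup>*" using True by auto
      then show ?thesis by (cases rule: rtranclE) (use no in auto)
    qed
    then show ?thesis using D by (intro rooted less.prems) (auto simp: rooted_orientations_def)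
  next
    case False
    \<comment> \<open>No arc leaves the reachable set, so its complement is an initial segment and
      can be listed first.\<close>
    obtain a b where ab: "distinct (a @ b)" "set a = - ?S" "set b = UNIV - (- ?S)"
        "orient E (a @ b) = ?D" "orient E a = ?D \<inter> (- ?S) \<times> (- ?S)"
        "orient E b = ?D \<inter> (UNIV - - ?S) \<times> (UNIV - - ?S)"
      by (rule orientation_word_split[OF D, of "- ?S"]) (use closed in blast)+
    have b: "set b = ?S" using ab(3) by simp
    have ba: "distinct (b @ a)" "set (b @ a) = UNIV" using ab(1,2) b by auto
    \<comment> \<open>Connectedness provides an edge between the reachable set and its complement.
      Rotation turns all such edges outwards, so \<open>v\<close> becomes reachable, while arcs
      inside the reachable set survive.\<close>
    obtain u v where uv: "u \<in> ?S" "v \<notin> ?S" "E u v"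
    proof -
      obtain x where "x \<notin> ?S" using False by auto
      have "E\<^sup>*\<^sup>* r x" using conn by (simp add: connected_graph_def)
      then have "x \<in> ?S \<or> (\<exists>u v. u \<in> ?S \<and> v \<notin> ?S \<and> E u v)"
      proof induction
        case base
        show ?case using rS by blast
      next
        case (step y z)
        then show ?case by blast
      qed
      with \<open>x \<notin> ?S\<close> that show ?thesis by blast
    qed
    let ?D' = "orient E (b @ a)"
    have sub: "orient E b \<subseteq> ?D'" by (auto simp: orient_append)
    have reach: "y \<in> ?S \<and> (r, y) \<in> ?D'\<^sup>*" if "(r, y) \<in> ?D\<^sup>*" for y
      using that
    proof induction
      case base
      show ?case using rS by simp
    next
      case (step y z)
      then have "z \<in> ?S" using closed by blast
      then have "(y, z) \<in> orient E b" using step ab(6) by blast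
      then show ?case using step.IH \<open>z \<in> ?S\<close> sub by (meson rtrancl.rtrancl_into_rtrancl subsetD)
    qed
    have "(u, v) \<in> ?D'" using uv ab(2) b by (simp add: orient_append)
    moreover have "(r, u) \<in> ?D'\<^sup>*" using reach uv(1) by blast
    ultimately have "v \<in> ?D'\<^sup>* `` {r}" by (auto intro: rtrancl_into_rtrancl)
    moreover have "?S \<subseteq> ?D'\<^sup>* `` {r}" using reach by blast
    ultimately have "- (?D'\<^sup>* `` {r}) \<subset> - ?S" using uv(2) by blast
    then have "card (- (?D'\<^sup>* `` {r})) < card (- ?S)" by (intro psubset_card_mono) auto
    then have "P (b @ a)" by (rule less.hyps[OF _ ba])
    moreover have set_ab: "set (a @ b) = UNIV" using ba(2) by auto
    ultimately have "P (a @ b)" by (intro rot[OF ab(1)])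
    with set_ab show ?thesis using comm[OF less.prems(1) ab(1) less.prems(2) _ ab(4)[symmetric]] by blast
  qed
qed

end

section \<open>Linear independence of roots and dual vectors of coroots\<close>

lemma indep_coeffs:
  fixes \<alpha> :: "'v::finite \<Rightarrow> complex^'n"
  assumes "inj \<alpha>" "vec.independent (range \<alpha>)" "(\<Sum>i\<in>UNIV. c i *s \<alpha> i) = 0"
  shows "c i = 0"
proof -
  have "(\<Sum>x\<in>range \<alpha>. c (inv_into UNIV \<alpha> x) *s x) = (\<Sum>i\<in>UNIV. c i *s \<alpha> i)"
    by (subst sum.reindex[OF assms(1)]) (simp add: assms(1))
  then have "c (inv_into UNIV \<alpha> (\<alpha> i)) = 0"
    using assms(3) vec.independentD[OF assms(2), of "range \<alpha>" "\<lambda>x. c (inv_into UNIV \<alpha> x)" "\<alpha> i"] by simp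
  then show ?thesis using assms(1) by simp
qed

lemma dual_vector:
  fixes h :: "'v::finite \<Rightarrow> complex^'n"
  assumes "inj h" "vec.independent (range h)"
  obtains \<omega> where "\<And>i. pairing \<omega> (h i) = (if i = j then 1 else 0)"
proof -
  obtain g :: "complex^'n \<Rightarrow> complex^'n" where g: "Vector_Spaces.linear (*s) (*s) g"
    "\<And>x. x \<in> range h \<Longrightarrow> g x = (if x = h j then 1 else 0)"
    using vec.linear_independent_extend[OF assms(2), of "\<lambda>x. if x = h j then 1 else 0"] by blast
  \<comment> \<open>\<open>g\<close> is vector valued and 1 is the all-ones vector here, so any
    fixed coordinate turns \<open>g\<close> into the desired functional.\<close>
  let ?k = "undefined :: 'n"
  let ?\<omega> = "\<chi> k. g (axis k 1) $ ?k"
  have "pairing ?\<omega> x = g x $ ?k" for x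
  proof -
    have "g x = g (\<Sum>k\<in>UNIV. x $ k *s axis k 1)" by (simp add: basis_expansion)
    also have "\<dots> = (\<Sum>k\<in>UNIV. x $ k *s g (axis k 1))"
      by (simp add: vec.linear_sum[OF g(1)] vec.linear_scale[OF g(1)])
    finally show ?thesis by (simp add: pairing_def mult.commute)
  qed
  then have "pairing ?\<omega> (h i) = (if i = j then 1 else 0)" for i
    using g(2)[of "h i"] assms(1) by (auto simp: inj_eq)
  then show ?thesis by (rule that)
qed

section \<open>Coxeter elements correspond to acyclic orientations\<close>

locale simply_laced = simple_graph E for E :: "'v::finite \<Rightarrow> 'v \<Rightarrow> bool" +
  fixes \<alpha> \<alpha>v :: "'v \<Rightarrow> complex^'d"
  assumes inj_root: "inj \<alpha>" and indep_root: "vec.independent (range \<alpha>)"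
    and inj_coroot: "inj \<alpha>v" and indep_coroot: "vec.independent (range \<alpha>v)"
    and pairing_root: "pairing (\<alpha> j) (\<alpha>v i) = (if i = j then 2 else if E i j then - 1 else 0)"
begin

lemma reflection_system: "reflection_system E \<alpha> \<alpha>v"
  using sym_E irrefl_E by (auto simp: reflection_system_def pairing_root)

text \<open>For a weight \<open>\<omega>\<close> dual to the coroot of \<open>j\<close>, the
  coefficient of \<open>v\<close> is the sum of the coefficients of its out-neighbours, plus 1 if
  \<open>v = j\<close>. So it counts directed paths from \<open>v\<close> to \<open>j\<close>; the
  lemma records what is needed of this count.\<close>

lemma coeff_nonneg:
  assumes \<omega>: "\<And>i. pairing \<omega> (\<alpha>v i) = (if i = j then 1 else 0)" and "distinct w"
  defines "y \<equiv> word_coeff \<alpha> \<alpha>v w \<omega>"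
  shows "(\<forall>i. Im (y i) = 0 \<and> 0 \<le> Re (y i)) \<and> (j \<notin> set w \<longrightarrow> (\<forall>i. y i = 0)) \<and>
    (j \<in> set w \<longrightarrow> 1 \<le> Re (y j)) \<and> (\<forall>i. (i, j) \<in> orient E w \<longrightarrow> y i \<noteq> 0)"
  using assms(2) unfolding y_def
proof (induction w)
  case (Cons v w)
  let ?y = "word_coeff \<alpha> \<alpha>v w \<omega>" and ?z = "word_coeff \<alpha> \<alpha>v (v # w) \<omega>"
  have IH: "\<And>i. Im (?y i) = 0" "\<And>i. 0 \<le> Re (?y i)" "\<And>i. j \<notin> set w \<Longrightarrow> ?y i = 0"
    "j \<in> set w \<Longrightarrow> 1 \<le> Re (?y j)" "\<And>i. (i, j) \<in> orient E w \<Longrightarrow> ?y i \<noteq> 0"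
    using Cons by auto
  have v: "v \<notin> set w" using Cons.prems by simp
  have other: "?z i = ?y i" if "i \<noteq> v" for i using that by simp
  have "?z v = pairing \<omega> (\<alpha>v v) - (\<Sum>k\<in>set w. ?y k * pairing (\<alpha> k) (\<alpha>v v))"
    by (rule word_coeff_Cons[OF v])
  also have "(\<Sum>k\<in>set w. ?y k * pairing (\<alpha> k) (\<alpha>v v)) = - (\<Sum>k\<in>{k \<in> set w. E v k}. ?y k)"
    unfolding sum.inter_filter[OF finite_set] sum_negf[symmetric]
    by (rule sum.cong) (use v in \<open>auto simp: pairing_root\<close>)
  finally have zv: "?z v = (if v = j then 1 else 0) + (\<Sum>k\<in>{k \<in> set w. E v k}. ?y k)"
    by (simp add: \<omega>)
  have S: "Im (\<Sum>k\<in>{k \<in> set w. E v k}. ?y k) = 0" "0 \<le> Re (\<Sum>k\<in>{k \<in> set w. E v k}. ?y k)"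
    by (simp_all add: IH(1,2) sum_nonneg)
  have "Im (?z i) = 0 \<and> 0 \<le> Re (?z i)" for i
    using IH(1,2) S zv other[of i] by (cases "i = v") auto
  moreover have "?z i = 0" if "j \<notin> set (v # w)" for i
    using that IH(3) zv other[of i] by (cases "i = v") auto
  moreover have "1 \<le> Re (?z j)" if "j \<in> set (v # w)"
    using that IH(4) S zv other[of j] by (cases "j = v") auto
  moreover have "?z i \<noteq> 0" if "(i, j) \<in> orient E (v # w)" for i
  proof (cases "(i, j) \<in> orient E w")
    case True
    then show ?thesis using IH(5) orient_edge[of i j E w] v other[of i] by auto
  next
    case False
    then have i: "i = v" "j \<in> set w" "E v j" using that by auto
    have "Re (?y j) \<le> Re (\<Sum>k\<in>{k \<in> set w. E v k}. ?y k)"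
      unfolding Re_sum by (rule member_le_sum) (use i IH(2) in auto)
    then have "1 \<le> Re (?z v)" using IH(4)[OF i(2)] S(2) zv by (simp split: if_splits)
    then have "?z v \<noteq> 0" by (metis zero_complex.sel(1) not_one_le_zero)
    then show ?thesis unfolding i(1) .
  qed
  ultimately show ?case by blast
qed simp

text \<open>For adjacent \<open>i\<close> and \<open>j\<close> the number of directed paths from
  \<open>i\<close> to \<open>j\<close> is nonzero exactly if the edge points from \<open>i\<close>
  to \<open>j\<close>, and the product determines these numbers because the roots are
  independent.\<close>

lemma word_prod_inj:
  assumes w: "distinct w" "set w = UNIV" and w': "distinct w'" "set w' = UNIV"
    and eq: "word_prod \<alpha> \<alpha>v w = word_prod \<alpha> \<alpha>v w'"
  shows "orient E w = orient E w'"
proof -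
  have "(i, j) \<in> orient E w \<longleftrightarrow> (i, j) \<in> orient E w'" for i j
  proof -
    obtain \<omega> where \<omega>: "\<And>i. pairing \<omega> (\<alpha>v i) = (if i = j then 1 else 0)"
      using dual_vector[OF inj_coroot indep_coroot] by blast
    have iff: "(i, j) \<in> orient E v \<longleftrightarrow> E i j \<and> word_coeff \<alpha> \<alpha>v v \<omega> i \<noteq> 0"
      if v: "distinct v" "set v = UNIV" for v
    proof
      show "(i, j) \<in> orient E v \<Longrightarrow> E i j \<and> word_coeff \<alpha> \<alpha>v v \<omega> i \<noteq> 0"
        using coeff_nonneg[OF \<omega> v(1)] orient_edge[of i j E v] by blast
      assume r: "E i j \<and> word_coeff \<alpha> \<alpha>v v \<omega> i \<noteq> 0"
      \<comment> \<open>Letters to the left of \<open>i\<close> do not change its coefficient; were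
        \<open>j\<close> among them, the suffix starting at \<open>i\<close> would give the
        coefficient 0.\<close>
      obtain a b where ab: "v = a @ i # b" using v(2) by (metis UNIV_I split_list)
      have "word_coeff \<alpha> \<alpha>v v \<omega> i = word_coeff \<alpha> \<alpha>v (i # b) \<omega> i"
        unfolding ab by (rule word_coeff_suffix) (use v ab in auto)
      then have "j \<in> set (i # b)"
        using r coeff_nonneg[OF \<omega>, of "i # b"] v(1) ab
        by (metis distinct_append)
      moreover have "j \<noteq> i" using r irrefl_E by auto
      ultimately show "(i, j) \<in> orient E v" using r by (auto simp: ab orient_append)
    qed
    have "(\<Sum>k\<in>UNIV. (word_coeff \<alpha> \<alpha>v w \<omega> k - word_coeff \<alpha> \<alpha>v w' \<omega> k) *s \<alpha> k) =
        (\<Sum>k\<in>UNIV. word_coeff \<alpha> \<alpha>v w \<omega> k *s \<alpha> k) - (\<Sum>k\<in>UNIV. word_coeff \<alpha> \<alpha>v w' \<omega> k *s \<alpha> k)"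
      by (simp add: sum_subtractf[symmetric] vector_sub_rdistrib)
    also have "\<dots> = 0"
      using word_prod_coeff[of \<alpha> \<alpha>v w \<omega>] word_prod_coeff[of \<alpha> \<alpha>v w' \<omega>] eq by simp
    finally have "word_coeff \<alpha> \<alpha>v w \<omega> i - word_coeff \<alpha> \<alpha>v w' \<omega> i = 0"
      by (rule indep_coeffs[OF inj_root indep_root])
    then show ?thesis using iff[OF w] iff[OF w'] by simp
  qed
  then show ?thesis by auto
qed

lemma word_prod_orient:
  assumes "distinct w" "distinct w'" "set w = set w'" "orient E w = orient E w'"
  shows "word_prod \<alpha> \<alpha>v w = word_prod \<alpha> \<alpha>v w'"
  using comm_eq_word_prod[OF reflection_system sym_E comm_eq_orient[OF assms]] by auto

definition coxeter_of :: "('v \<times> 'v) set \<Rightarrow> complex^'d \<Rightarrow> complex^'d" where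
  "coxeter_of D = word_prod \<alpha> \<alpha>v (SOME w. distinct w \<and> set w = UNIV \<and> orient E w = D)"

lemma coxeter_of_orient:
  assumes "distinct w" "set w = UNIV" shows "coxeter_of (orient E w) = word_prod \<alpha> \<alpha>v w"
proof -
  let ?w = "SOME v. distinct v \<and> set v = UNIV \<and> orient E v = orient E w"
  have "distinct ?w \<and> set ?w = UNIV \<and> orient E ?w = orient E w"
    by (rule someI[of _ w]) (use assms in auto)
  then show ?thesis unfolding coxeter_of_def using assms by (intro word_prod_orient) auto
qed

lemma coxeter_elements_eq: "coxeter_elements \<alpha> \<alpha>v = coxeter_of ` orientations_on E UNIV"
proof -
  have "coxeter_elements \<alpha> \<alpha>v = {word_prod \<alpha> \<alpha>v w | w. distinct w \<and> set w = UNIV}"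
    by (simp add: coxeter_elements_def word_prod_def)
  also have "\<dots> = coxeter_of ` orientations_on E UNIV"
  proof (intro equalityI subsetI)
    fix c assume "c \<in> {word_prod \<alpha> \<alpha>v w | w. distinct w \<and> set w = UNIV}"
    then obtain w where w: "distinct w" "set w = UNIV" "c = word_prod \<alpha> \<alpha>v w" by blast
    then show "c \<in> coxeter_of ` orientations_on E UNIV"
      using coxeter_of_orient[OF w(1,2)] orient_mem[OF w(1)] by (metis imageI)
  next
    fix c assume "c \<in> coxeter_of ` orientations_on E UNIV"
    then obtain D where D: "D \<in> orientations_on E UNIV" "c = coxeter_of D" by blast
    obtain w where "distinct w" "set w = UNIV" "orient E w = D" using orientation_word[OF D(1)] by blast
    then show "c \<in> {word_prod \<alpha> \<alpha>v w | w. distinct w \<and> set w = UNIV}"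
      using coxeter_of_orient[of w] D(2) by blast
  qed
  finally show ?thesis .
qed

lemma card_coxeter_elements: "card (coxeter_elements \<alpha> \<alpha>v) = card (acyclic_orientations E)"
proof -
  have "inj_on coxeter_of (orientations_on E UNIV)"
  proof (rule inj_onI)
    fix D D' assume D: "D \<in> orientations_on E UNIV" "D' \<in> orientations_on E UNIV" "coxeter_of D = coxeter_of D'"
    obtain w where w: "distinct w" "set w = UNIV" "orient E w = D" using orientation_word[OF D(1)] by blast
    obtain w' where w': "distinct w'" "set w' = UNIV" "orient E w' = D'" using orientation_word[OF D(2)] by blast
    show "D = D'"
      using word_prod_inj[OF w(1,2) w'(1,2)] coxeter_of_orient[OF w(1,2)] coxeter_of_orient[OF w'(1,2)]
        w(3) w'(3) D(3) by simp
  qed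
  then show ?thesis unfolding coxeter_elements_eq by (simp add: card_image)
qed

subsection \<open>Conjugacy classes\<close>

lemma word_prod_GL: "word_prod \<alpha> \<alpha>v w \<in> carrier GL"
proof (induction w)
  case Nil
  have "\<one>\<^bsub>GL\<^esub> = word_prod \<alpha> \<alpha>v []" by (simp add: GL_def word_prod_def)
  then show ?case
    using Group.monoid.one_closed[OF group.is_monoid[OF group_GL]] by metis
next
  case (Cons v w)
  have "simple_reflection \<alpha> \<alpha>v v \<in> carrier GL"
    by (rule simple_reflection_in_GL) (simp add: pairing_root)
  then have "simple_reflection \<alpha> \<alpha>v v \<otimes>\<^bsub>GL\<^esub> word_prod \<alpha> \<alpha>v w \<in> carrier GL"
    by (rule Group.monoid.m_closed[OF group.is_monoid[OF group_GL] _ Cons])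
  moreover have "simple_reflection \<alpha> \<alpha>v v \<otimes>\<^bsub>GL\<^esub> word_prod \<alpha> \<alpha>v w = word_prod \<alpha> \<alpha>v (v # w)"
    by (auto simp: GL_def)
  ultimately show ?case by (simp only:)
qed

lemma word_prod_mult: "word_prod \<alpha> \<alpha>v a \<otimes>\<^bsub>GL\<^esub> word_prod \<alpha> \<alpha>v b = word_prod \<alpha> \<alpha>v (a @ b)"
  by (auto simp: GL_def word_prod_append)

lemma word_prod_inv: "inv\<^bsub>GL\<^esub> (word_prod \<alpha> \<alpha>v w) = word_prod \<alpha> \<alpha>v (rev w)"
proof (rule group.inv_equality[OF group_GL])
  have "word_prod \<alpha> \<alpha>v (rev w) \<otimes>\<^bsub>GL\<^esub> word_prod \<alpha> \<alpha>v w = word_prod \<alpha> \<alpha>v (rev w @ rev (rev w))"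
    by (simp add: word_prod_mult)
  also have "\<dots> = id" using word_prod_rev[OF reflection_system, of "rev w"] by (auto simp: fun_eq_iff)
  finally show "word_prod \<alpha> \<alpha>v (rev w) \<otimes>\<^bsub>GL\<^esub> word_prod \<alpha> \<alpha>v w = \<one>\<^bsub>GL\<^esub>" by (simp add: GL_def)
qed (rule word_prod_GL)+

text \<open>Reflections are involutions, so inverses add nothing and the generated group consists of
  products of words.\<close>

lemma carrier_weyl_group: "carrier (weyl_group \<alpha> \<alpha>v) = range (word_prod \<alpha> \<alpha>v)"
proof -
  have s: "simple_reflection \<alpha> \<alpha>v i = word_prod \<alpha> \<alpha>v [i]" for i by (simp add: word_prod_def)
  have car: "carrier (weyl_group \<alpha> \<alpha>v) = generate GL (range (simple_reflection \<alpha> \<alpha>v))"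
    using word_prod_GL[of "[_]"]
    by (simp add: weyl_group_def carrier_subgroup_generated s[symmetric] Int_absorb1 image_subset_iff)
  show ?thesis unfolding car
  proof (intro equalityI subsetI)
    fix u assume "u \<in> generate GL (range (simple_reflection \<alpha> \<alpha>v))"
    then show "u \<in> range (word_prod \<alpha> \<alpha>v)"
    proof induction
      case one
      have "\<one>\<^bsub>GL\<^esub> = word_prod \<alpha> \<alpha>v []" by (simp add: GL_def word_prod_def)
      then show ?case by blast
    next
      case (incl h)
      then show ?case using s by blast
    next
      case (inv h)
      then obtain i where "h = word_prod \<alpha> \<alpha>v [i]" using s by blast
      then show ?case using word_prod_inv by blast
    next
      case (eng h1 h2)
      then show ?case using word_prod_mult by blast
    qed
  next
    fix u assume "u \<in> range (word_prod \<alpha> \<alpha>v)"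
    then obtain w where "u = word_prod \<alpha> \<alpha>v w" by blast
    moreover have "word_prod \<alpha> \<alpha>v w \<in> generate GL (range (simple_reflection \<alpha> \<alpha>v))"
    proof (induction w)
      case Nil
      have "\<one>\<^bsub>GL\<^esub> = word_prod \<alpha> \<alpha>v []" by (simp add: GL_def word_prod_def)
      then show ?case using generate.one by metis
    next
      case (Cons v w)
      have "simple_reflection \<alpha> \<alpha>v v \<in> generate GL (range (simple_reflection \<alpha> \<alpha>v))"
        by (rule generate.incl) blast
      from generate.eng[OF this Cons] show ?case by (simp only: s word_prod_mult append_Cons append_Nil)
    qed
    ultimately show "u \<in> generate GL (range (simple_reflection \<alpha> \<alpha>v))" by simp
  qed
qed

lemma conjugacy_class_eq:
  "conjugacy_class (weyl_group \<alpha> \<alpha>v) (word_prod \<alpha> \<alpha>v w) = {word_prod \<alpha> \<alpha>v (u @ w @ rev u) | u. True}"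
proof -
  have mult: "x \<otimes>\<^bsub>weyl_group \<alpha> \<alpha>v\<^esub> y = x \<otimes>\<^bsub>GL\<^esub> y" for x y by (simp add: weyl_group_def subgroup_generated_def)
  have inv: "inv\<^bsub>weyl_group \<alpha> \<alpha>v\<^esub> x = inv\<^bsub>GL\<^esub> x" if "x \<in> carrier (weyl_group \<alpha> \<alpha>v)" for x
    using that group.inv_subgroup_generated[OF group_GL] unfolding weyl_group_def by blast
  have elt: "word_prod \<alpha> \<alpha>v u \<otimes>\<^bsub>weyl_group \<alpha> \<alpha>v\<^esub> word_prod \<alpha> \<alpha>v w \<otimes>\<^bsub>weyl_group \<alpha> \<alpha>v\<^esub> inv\<^bsub>weyl_group \<alpha> \<alpha>v\<^esub> word_prod \<alpha> \<alpha>v u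
      = word_prod \<alpha> \<alpha>v (u @ w @ rev u)" for u
    using inv[of "word_prod \<alpha> \<alpha>v u"] carrier_weyl_group by (simp add: mult word_prod_inv word_prod_mult)
  show ?thesis
    unfolding conjugacy_class_def carrier_weyl_group
  proof (intro equalityI subsetI; (erule CollectE exE conjE)+; intro CollectI)
    fix x u assume "x = u \<otimes>\<^bsub>weyl_group \<alpha> \<alpha>v\<^esub> word_prod \<alpha> \<alpha>v w \<otimes>\<^bsub>weyl_group \<alpha> \<alpha>v\<^esub> inv\<^bsub>weyl_group \<alpha> \<alpha>v\<^esub> u"
      "u \<in> range (word_prod \<alpha> \<alpha>v)"
    then show "\<exists>u. x = word_prod \<alpha> \<alpha>v (u @ w @ rev u) \<and> True" using elt by (metis rangeE)
  next
    fix x u assume "x = word_prod \<alpha> \<alpha>v (u @ w @ rev u)"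
    then show "\<exists>u. x = u \<otimes>\<^bsub>weyl_group \<alpha> \<alpha>v\<^esub> word_prod \<alpha> \<alpha>v w \<otimes>\<^bsub>weyl_group \<alpha> \<alpha>v\<^esub> inv\<^bsub>weyl_group \<alpha> \<alpha>v\<^esub> u \<and>
        u \<in> range (word_prod \<alpha> \<alpha>v)"
      by (intro exI[of _ "word_prod \<alpha> \<alpha>v u"] conjI rangeI) (simp only: elt)
  qed
qed

lemma conjugacy_class_cong:
  assumes "word_prod \<alpha> \<alpha>v w' = word_prod \<alpha> \<alpha>v (u @ w @ rev u)"
  shows "conjugacy_class (weyl_group \<alpha> \<alpha>v) (word_prod \<alpha> \<alpha>v w') = conjugacy_class (weyl_group \<alpha> \<alpha>v) (word_prod \<alpha> \<alpha>v w)"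
proof -
  have 1: "word_prod \<alpha> \<alpha>v (v @ w' @ rev v) = word_prod \<alpha> \<alpha>v ((v @ u) @ w @ rev (v @ u))" for v
    using assms by (auto simp: fun_eq_iff word_prod_append)
  have 2: "word_prod \<alpha> \<alpha>v (v @ w @ rev v) = word_prod \<alpha> \<alpha>v ((v @ rev u) @ w' @ rev (v @ rev u))" for v
  proof -
    have c: "word_prod \<alpha> \<alpha>v (rev u) (word_prod \<alpha> \<alpha>v u x) = x" for x
      using word_prod_rev[OF reflection_system, of "rev u" x] by (simp add: word_prod_append)
    show ?thesis using assms by (auto simp: fun_eq_iff word_prod_append c)
  qed
  show ?thesis unfolding conjugacy_class_eq using 1 2 by blast
qed

text \<open>A conjugacy in the Weyl group is a relation between simple reflections, so it holds in
  every deformation. This yields equal pencil determinants for all \<open>q\<close> and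
  \<open>t\<close>, as the comparison of rooted orientations requires.\<close>

lemma conj_rooted_eq:
  assumes conn: "connected_graph E"
    and w: "distinct w" "set w = UNIV" "orient E w \<in> rooted_orientations E UNIV r"
    and w': "distinct w'" "set w' = UNIV" "orient E w' \<in> rooted_orientations E UNIV r"
    and eq: "word_prod \<alpha> \<alpha>v w' = word_prod \<alpha> \<alpha>v (u @ w @ rev u)"
  shows "orient E w = orient E w'"
proof (rule rooted_orientations_eq[OF _ _ _ conn w(3) w'(3)])
  fix q :: "'v \<Rightarrow> 'v \<Rightarrow> complex" and t
  assume q: "\<And>i j. E i j \<Longrightarrow> q i j * q j i = 1"
  let ?\<beta> = "\<lambda>i. axis i 1 :: complex^'v" and ?\<beta>v = "deformed_coroot E q"
  have rs: "reflection_system E ?\<beta> ?\<beta>v" by (rule deformed_system[OF q])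
  interpret two_reflection_systems E \<alpha> \<alpha>v ?\<beta> ?\<beta>v
  proof
    show "pairing (\<alpha> i) (\<alpha>v j) = -1" if "E i j" for i j
      using that sym_E[OF that] irrefl_E by (auto simp: pairing_root)
    show "c i = 0" if "(\<Sum>i\<in>UNIV. c i *s \<alpha> i) = 0" for c i
      by (rule indep_coeffs[OF inj_root indep_root that])
  qed (fact reflection_system rs)+
  have "word_prod ?\<beta> ?\<beta>v w' = word_prod ?\<beta> ?\<beta>v (u @ w @ rev u)" by (rule word_prod_transfer[OF eq])
  from det_conjugate[OF this rs, of t]
  show "det (pencil (orient E w) t q) = det (pencil (orient E w') t q)"
    by (simp add: det_coxeter[OF w(1,2)] det_coxeter[OF w'(1,2)])
qed (use w w' in \<open>auto dest: rootedD(1)\<close>)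

lemma card_conjugacy_classes:
  assumes conn: "connected_graph E"
  shows "card (conjugacy_class (weyl_group \<alpha> \<alpha>v) ` coxeter_elements \<alpha> \<alpha>v) = card (rooted_orientations E UNIV r)"
proof -
  let ?C = "conjugacy_class (weyl_group \<alpha> \<alpha>v)"
  have "inj_on (\<lambda>D. ?C (coxeter_of D)) (rooted_orientations E UNIV r)"
  proof (rule inj_onI)
    fix D D' assume D: "D \<in> rooted_orientations E UNIV r" "D' \<in> rooted_orientations E UNIV r"
      "?C (coxeter_of D) = ?C (coxeter_of D')"
    obtain w where w: "distinct w" "set w = UNIV" "orient E w = D"
      using orientation_word[OF rootedD(1)[OF D(1)]] by blast
    obtain w' where w': "distinct w'" "set w' = UNIV" "orient E w' = D'"
      using orientation_word[OF rootedD(1)[OF D(2)]] by blast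
    have "?C (word_prod \<alpha> \<alpha>v w) = ?C (word_prod \<alpha> \<alpha>v w')"
      using D(3) coxeter_of_orient[OF w(1,2)] coxeter_of_orient[OF w'(1,2)] w(3) w'(3) by simp
    moreover have "word_prod \<alpha> \<alpha>v w' \<in> ?C (word_prod \<alpha> \<alpha>v w')"
      unfolding conjugacy_class_eq by (rule CollectI, rule exI[of _ "[]"]) simp
    ultimately obtain u where "word_prod \<alpha> \<alpha>v w' = word_prod \<alpha> \<alpha>v (u @ w @ rev u)"
      unfolding conjugacy_class_eq by blast
    then show "D = D'"
      using conj_rooted_eq[OF conn w(1,2) D(1)[folded w(3)] w'(1,2) D(2)[folded w'(3)]] w(3) w'(3) by simp
  qed
  moreover have "?C ` coxeter_elements \<alpha> \<alpha>v = (\<lambda>D. ?C (coxeter_of D)) ` rooted_orientations E UNIV r"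
  proof (intro equalityI subsetI)
    fix X assume "X \<in> ?C ` coxeter_elements \<alpha> \<alpha>v"
    then obtain D where D: "D \<in> orientations_on E UNIV" "X = ?C (coxeter_of D)"
      unfolding coxeter_elements_eq by blast
    obtain w where w: "distinct w" "set w = UNIV" "orient E w = D" using orientation_word[OF D(1)] by blast
    have "?C (word_prod \<alpha> \<alpha>v w) \<in> (\<lambda>D. ?C (coxeter_of D)) ` rooted_orientations E UNIV r"
    proof (rule rotate_to_rooted[OF conn, where P = "\<lambda>w. ?C (word_prod \<alpha> \<alpha>v w) \<in> (\<lambda>D. ?C (coxeter_of D)) ` rooted_orientations E UNIV r"])
      fix v v' assume "distinct v" "distinct v'" "set v = UNIV" "set v' = UNIV" "orient E v = orient E v'"
        "?C (word_prod \<alpha> \<alpha>v v') \<in> (\<lambda>D. ?C (coxeter_of D)) ` rooted_orientations E UNIV r"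
      then show "?C (word_prod \<alpha> \<alpha>v v) \<in> (\<lambda>D. ?C (coxeter_of D)) ` rooted_orientations E UNIV r"
        using word_prod_orient[of v v'] by simp
    next
      fix a b assume *: "?C (word_prod \<alpha> \<alpha>v (b @ a)) \<in> (\<lambda>D. ?C (coxeter_of D)) ` rooted_orientations E UNIV r"
      \<comment> \<open>\<open>a @ b\<close> is \<open>b @ a\<close> conjugated by
        \<open>a\<close>.\<close>
      have "word_prod \<alpha> \<alpha>v (a @ b) = word_prod \<alpha> \<alpha>v (a @ (b @ a) @ rev a)"
        using word_prod_rev[OF reflection_system, of a] by (auto simp: fun_eq_iff word_prod_append)
      from conjugacy_class_cong[OF this] * show "?C (word_prod \<alpha> \<alpha>v (a @ b)) \<in> (\<lambda>D. ?C (coxeter_of D)) ` rooted_orientations E UNIV r"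
        by simp
    next
      fix v assume v: "distinct v" "set v = UNIV" "orient E v \<in> rooted_orientations E UNIV r"
      show "?C (word_prod \<alpha> \<alpha>v v) \<in> (\<lambda>D. ?C (coxeter_of D)) ` rooted_orientations E UNIV r"
        by (rule image_eqI[OF _ v(3)]) (simp add: coxeter_of_orient[OF v(1,2)])
    qed (use w in auto)
    then show "X \<in> (\<lambda>D. ?C (coxeter_of D)) ` rooted_orientations E UNIV r"
      using coxeter_of_orient[OF w(1,2)] w(3) D(2) by simp
  next
    fix X assume "X \<in> (\<lambda>D. ?C (coxeter_of D)) ` rooted_orientations E UNIV r"
    then obtain D where D: "D \<in> rooted_orientations E UNIV r" "X = ?C (coxeter_of D)" by (rule imageE)
    show "X \<in> ?C ` coxeter_elements \<alpha> \<alpha>v"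
      unfolding coxeter_elements_eq D(2) by (intro imageI rootedD(1)[OF D(1)])
  qed
  ultimately show ?thesis by (simp add: card_image)
qed

end

section \<open>Presented algebras\<close>

lemma alg_class_carrier [simp]: "alg_class R t \<in> carrier (presented_algebra UNIV R)"
  by (simp add: alg_class_in_carrier)

text \<open>From here on, algebra is done with equalities between classes of terms. With all
  generators allowed every class lies in the carrier, so no membership conditions arise.\<close>

lemma alg_class_simps:
  "alg_class R (Add s t) = alg_class R s \<oplus>\<^bsub>presented_algebra UNIV R\<^esub> alg_class R t"
  "alg_class R (Mult s t) = alg_class R s \<otimes>\<^bsub>presented_algebra UNIV R\<^esub> alg_class R t"
  "alg_class R (Scale c t) = c \<odot>\<^bsub>presented_algebra UNIV R\<^esub> alg_class R t"
  "alg_class R Zero = \<zero>\<^bsub>presented_algebra UNIV R\<^esub>"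
  by (simp_all add: presented_algebra_ops)

lemma alg_scale_laws:
  "alg_class R (Scale (c + d) t) = alg_class R (Add (Scale c t) (Scale d t))"
  "alg_class R (Scale c (Add s t)) = alg_class R (Add (Scale c s) (Scale c t))"
  "alg_class R (Scale c (Scale d t)) = alg_class R (Scale (c * d) t)"
  "alg_class R (Scale 1 t) = alg_class R t"
  "alg_class R (Scale 0 t) = alg_class R Zero"
  "alg_class R (Scale c Zero) = alg_class R Zero"
proof -
  show *: "alg_class R (Scale c (Scale d t)) = alg_class R (Scale (c * d) t)" for c d t
    by (simp add: alg_class_eq_iff alg_cong.Scale_Scale)
  show 0: "alg_class R (Scale 0 t) = alg_class R Zero" for t
    by (simp add: alg_class_eq_iff alg_cong.Scale_zero)
  have "alg_class R (Scale c Zero) = alg_class R (Scale c (Scale 0 Zero))"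
    unfolding alg_class_eq_iff by (intro alg_cong.Scale alg_cong.sym[OF alg_cong.Scale_zero])
  then show "alg_class R (Scale c Zero) = alg_class R Zero" by (simp add: * 0)
qed (simp_all add: alg_class_eq_iff alg_cong.Scale_Add alg_cong.Add_Scale alg_cong.Scale_one)

lemma alg_mult_laws:
  "alg_class R (Mult (Add s t) u) = alg_class R (Add (Mult s u) (Mult t u))"
  "alg_class R (Mult u (Add s t)) = alg_class R (Add (Mult u s) (Mult u t))"
  "alg_class R (Mult (Scale c s) t) = alg_class R (Scale c (Mult s t))"
  "alg_class R (Mult s (Scale c t)) = alg_class R (Scale c (Mult s t))"
  "alg_class R (Mult Zero t) = alg_class R Zero"
  "alg_class R (Mult t Zero) = alg_class R Zero"
proof -
  show 1: "alg_class R (Mult (Scale c s) t) = alg_class R (Scale c (Mult s t))"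
    and 2: "alg_class R (Mult s (Scale c t)) = alg_class R (Scale c (Mult s t))" for c s t
    by (simp_all add: alg_class_eq_iff alg_cong.Mult_Scale_left alg_cong.Mult_Scale_right)
  have "alg_class R (Mult Zero t) = alg_class R (Mult (Scale 0 Zero) t)"
    unfolding alg_class_eq_iff by (intro alg_cong.Mult alg_cong.refl alg_cong.sym[OF alg_cong.Scale_zero])
  then show "alg_class R (Mult Zero t) = alg_class R Zero" by (simp add: 1 alg_scale_laws)
  have "alg_class R (Mult t Zero) = alg_class R (Mult t (Scale 0 Zero))"
    unfolding alg_class_eq_iff by (intro alg_cong.Mult alg_cong.refl alg_cong.sym[OF alg_cong.Scale_zero])
  then show "alg_class R (Mult t Zero) = alg_class R Zero" by (simp add: 2 alg_scale_laws)
qed (simp_all add: alg_class_eq_iff alg_cong.Mult_Add_left alg_cong.Mult_Add_right)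

lemma alg_add_laws:
  "alg_class R (Add s t) = alg_class R (Add t s)"
  "alg_class R (Add (Add s t) u) = alg_class R (Add s (Add t u))"
  "alg_class R (Add t Zero) = alg_class R t"
  "alg_class R (Add Zero t) = alg_class R t"
  "alg_class R (Add t (Scale (-1) t)) = alg_class R Zero"
proof -
  show 1: "alg_class R (Add s t) = alg_class R (Add t s)" for s t
    by (simp add: alg_class_eq_iff alg_cong.Add_comm)
  show 0: "alg_class R (Add Zero t) = alg_class R t"
    by (simp add: alg_class_eq_iff alg_cong.Add_Zero)
  show "alg_class R (Add t Zero) = alg_class R t" by (simp add: 1[of t] 0)
  have "alg_class R (Add t (Scale (-1) t)) = alg_class R (Add (Scale 1 t) (Scale (-1) t))"
    by (simp add: alg_class_simps(1) alg_scale_laws(4))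
  also have "\<dots> = alg_class R (Scale (1 + -1) t)" by (rule alg_scale_laws(1)[symmetric])
  also have "\<dots> = alg_class R Zero" by (simp add: alg_scale_laws)
  finally show "alg_class R (Add t (Scale (-1) t)) = alg_class R Zero" .
qed (simp add: alg_class_eq_iff alg_cong.Add_assoc)

lemma alg_class_cong:
  "alg_class R s = alg_class R s' \<Longrightarrow> alg_class R t = alg_class R t' \<Longrightarrow> alg_class R (Add s t) = alg_class R (Add s' t')"
  "alg_class R s = alg_class R s' \<Longrightarrow> alg_class R t = alg_class R t' \<Longrightarrow> alg_class R (Mult s t) = alg_class R (Mult s' t')"
  "alg_class R t = alg_class R t' \<Longrightarrow> alg_class R (Scale c t) = alg_class R (Scale c t')"
  by (simp_all only: alg_class_simps)

lemma alg_add_ac: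
  "alg_class R (Add s (Add t u)) = alg_class R (Add t (Add s u))"
proof -
  have "alg_class R (Add s (Add t u)) = alg_class R (Add (Add s t) u)" by (simp only: alg_add_laws(2))
  also have "\<dots> = alg_class R (Add (Add t s) u)" by (intro alg_class_cong alg_add_laws(1) HOL.refl)
  finally show ?thesis by (simp only: alg_add_laws(2))
qed

lemma alg_eq_neg:
  assumes "alg_class R (Add s t) = alg_class R Zero"
  shows "alg_class R s = alg_class R (Scale (-1) t)"
proof -
  have "alg_class R s = alg_class R (Add s (Add t (Scale (-1) t)))"
    using alg_class_cong(1)[OF HOL.refl alg_add_laws(5)[of R t], of s] by (simp add: alg_add_laws)
  also have "\<dots> = alg_class R (Add (Add s t) (Scale (-1) t))" by (simp only: alg_add_laws(2))
  also have "\<dots> = alg_class R (Add Zero (Scale (-1) t))" by (intro alg_class_cong assms HOL.refl)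
  finally show ?thesis by (simp only: alg_add_laws(4))
qed

subsection \<open>Lie algebra laws\<close>

text \<open>Antisymmetry and Jacobi, arranged by use: \<open>lie_right\<close> turns a bracket on
  the right into left-normed ones, \<open>lie_left\<close> is the derivation rule for
  \<open>x\<close>, and \<open>lie_swap\<close> exchanges the last two entries of a left-normed
  bracket.\<close>

lemma lie_class_laws:
  assumes R: "lie_laws \<subseteq> R"
  shows lie_anti: "alg_class R (Mult s t) = alg_class R (Scale (-1) (Mult t s))"
    and lie_right: "alg_class R (Mult x (Mult s t)) =
      alg_class R (Add (Mult (Mult x s) t) (Scale (-1) (Mult (Mult x t) s)))"
    and lie_left: "alg_class R (Mult x (Mult s t)) = alg_class R (Add (Mult (Mult x s) t) (Mult s (Mult x t)))"
    and lie_swap: "alg_class R (Mult (Mult x s) t) = alg_class R (Add (Mult (Mult x t) s) (Mult x (Mult s t)))"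
proof -
  let ?C = "alg_class R"
  have sq: "?C (Mult t t) = ?C Zero" for t
    unfolding alg_class_eq_iff by (rule alg_cong.rel) (use R in \<open>auto simp: lie_laws_def\<close>)
  have jac: "?C (Add (Mult s (Mult t u)) (Add (Mult t (Mult u s)) (Mult u (Mult s t)))) = ?C Zero" for s t u
    unfolding alg_class_eq_iff by (rule alg_cong.rel) (use R in \<open>auto simp: lie_laws_def\<close>)
  show anti: "?C (Mult s t) = ?C (Scale (-1) (Mult t s))" for s t
  proof (rule alg_eq_neg)
    have "?C (Mult (Add s t) (Add s t)) = ?C (Add (Mult s (Add s t)) (Mult t (Add s t)))"
      by (rule alg_mult_laws)
    also have "\<dots> = ?C (Add (Add (Mult s s) (Mult s t)) (Add (Mult t s) (Mult t t)))"
      by (intro alg_class_cong(1) alg_mult_laws)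
    also have "\<dots> = ?C (Add (Add Zero (Mult s t)) (Add (Mult t s) Zero))"
      by (intro alg_class_cong(1) sq HOL.refl)
    also have "\<dots> = ?C (Add (Mult s t) (Mult t s))"
      by (intro alg_class_cong(1) alg_add_laws)
    finally show "?C (Add (Mult s t) (Mult t s)) = ?C Zero" by (simp only: sq)
  qed
  show right: "?C (Mult x (Mult s t)) = ?C (Add (Mult (Mult x s) t) (Scale (-1) (Mult (Mult x t) s)))" for x s t
  proof -
    have Z: "?C (Scale (-1) (Mult t (Mult x s))) = ?C (Mult (Mult x s) t)"
      using anti[of "Mult x s" t] by simp
    have "?C (Mult s (Mult t x)) = ?C (Scale (-1) (Mult (Mult t x) s))" by (rule anti)
    also have "\<dots> = ?C (Scale (-1) (Mult (Scale (-1) (Mult x t)) s))"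
      by (intro alg_class_cong anti HOL.refl)
    also have "\<dots> = ?C (Scale (-1) (Scale (-1) (Mult (Mult x t) s)))"
      by (intro alg_class_cong(3) alg_mult_laws)
    also have "\<dots> = ?C (Mult (Mult x t) s)" by (simp add: alg_scale_laws)
    finally have Y: "?C (Mult s (Mult t x)) = ?C (Mult (Mult x t) s)" .
    have "?C (Mult x (Mult s t)) = ?C (Scale (-1) (Add (Mult s (Mult t x)) (Mult t (Mult x s))))"
      by (rule alg_eq_neg[OF jac])
    also have "\<dots> = ?C (Add (Scale (-1) (Mult s (Mult t x))) (Scale (-1) (Mult t (Mult x s))))"
      by (rule alg_scale_laws)
    also have "\<dots> = ?C (Add (Scale (-1) (Mult (Mult x t) s)) (Mult (Mult x s) t))"
      by (intro alg_class_cong(1) alg_class_cong(3) Y Z)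
    finally show ?thesis by (simp only: alg_add_laws(1)[of R "Scale (-1) (Mult (Mult x t) s)"])
  qed
  show "?C (Mult x (Mult s t)) = ?C (Add (Mult (Mult x s) t) (Mult s (Mult x t)))"
  proof -
    have "?C (Scale (-1) (Mult (Mult x t) s)) = ?C (Mult s (Mult x t))"
      using anti[of s "Mult x t"] by simp
    then show ?thesis by (rule HOL.trans[OF right alg_class_cong(1)[OF HOL.refl]])
  qed
  show "?C (Mult (Mult x s) t) = ?C (Add (Mult (Mult x t) s) (Mult x (Mult s t)))"
  proof -
    let ?A = "Mult (Mult x s) t" and ?B = "Mult (Mult x t) s"
    have "?C (Add ?B (Mult x (Mult s t))) = ?C (Add ?B (Add ?A (Scale (-1) ?B)))"
      by (intro alg_class_cong(1) right HOL.refl)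
    also have "\<dots> = ?C (Add ?A (Add ?B (Scale (-1) ?B)))" by (rule alg_add_ac)
    also have "\<dots> = ?C (Add ?A Zero)" by (intro alg_class_cong(1) alg_add_laws HOL.refl)
    finally show ?thesis by (simp only: alg_add_laws(3))
  qed
qed

subsection \<open>Spans\<close>

text \<open>A linear span inside the set of terms, closed under the congruence, so that membership
  depends only on the class and rewriting needs no choice of representatives.\<close>

inductive_set tspan :: "('x alg_term \<times> 'x alg_term) set \<Rightarrow> 'x alg_term set \<Rightarrow> 'x alg_term set" for R A where
  tspan_Zero: "Zero \<in> tspan R A"
| tspan_base: "a \<in> A \<Longrightarrow> a \<in> tspan R A"
| tspan_Add: "s \<in> tspan R A \<Longrightarrow> t \<in> tspan R A \<Longrightarrow> Add s t \<in> tspan R A"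
| tspan_Scale: "t \<in> tspan R A \<Longrightarrow> Scale c t \<in> tspan R A"
| tspan_cong: "s \<in> tspan R A \<Longrightarrow> (s, t) \<in> alg_cong R \<Longrightarrow> t \<in> tspan R A"

lemma tspan_eq: "alg_class R t = alg_class R s \<Longrightarrow> s \<in> tspan R A \<Longrightarrow> t \<in> tspan R A"
  using tspan_cong[of s R A t] by (simp add: alg_class_eq_iff[symmetric])

lemma tspan_sub:
  assumes "t \<in> tspan R A" "A \<subseteq> tspan R B" shows "t \<in> tspan R B"
  using assms(1) by induction (use assms(2) in \<open>auto intro: tspan.intros\<close>)

lemma tspan_mono: "t \<in> tspan R A \<Longrightarrow> A \<subseteq> B \<Longrightarrow> t \<in> tspan R B"
  by (erule tspan_sub) (auto intro: tspan_base)

lemma tspan_image: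
  assumes "t \<in> tspan R A" and "\<And>a. a \<in> A \<Longrightarrow> f a \<in> tspan R' B"
    and f: "alg_class R' (f Zero) = alg_class R' Zero" "\<And>s t. alg_class R' (f (Add s t)) = alg_class R' (Add (f s) (f t))"
    "\<And>c t. alg_class R' (f (Scale c t)) = alg_class R' (Scale c (f t))"
    and cong: "\<And>s t. alg_class R s = alg_class R t \<Longrightarrow> alg_class R' (f s) = alg_class R' (f t)"
  shows "f t \<in> tspan R' B"
  using assms(1)
proof induction
  case tspan_Zero
  show ?case by (rule tspan_eq[OF f(1)]) (rule tspan.tspan_Zero)
next
  case (tspan_Add s t)
  show ?case by (rule tspan_eq[OF f(2)]) (rule tspan.tspan_Add[OF tspan_Add.IH])
next
  case (tspan_Scale t c)
  show ?case by (rule tspan_eq[OF f(3)]) (rule tspan.tspan_Scale[OF tspan_Scale.IH])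
next
  case (tspan_cong s t)
  have "alg_class R' (f s) = alg_class R' (f t)"
    by (rule cong) (use tspan_cong.hyps in \<open>simp add: alg_class_eq_iff\<close>)
  then show ?case using tspan_eq tspan_cong.IH by metis
qed (rule assms(2))

lemma tspan_Mult:
  assumes "s \<in> tspan R A" "t \<in> tspan R B" "\<And>a b. a \<in> A \<Longrightarrow> b \<in> B \<Longrightarrow> Mult a b \<in> tspan R C"
  shows "Mult s t \<in> tspan R C"
proof (rule tspan_image[OF assms(1), where f = "\<lambda>s. Mult s t"])
  fix a assume a: "a \<in> A"
  show "Mult a t \<in> tspan R C"
    by (rule tspan_image[OF assms(2), where f = "\<lambda>t. Mult a t"])
      (assumption | rule assms(3)[OF a] alg_mult_laws alg_class_cong(2)[OF HOL.refl])+
qed (assumption | rule alg_mult_laws alg_class_cong(2)[OF _ HOL.refl])+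

subsection \<open>Weights\<close>

text \<open>Instantiated twice: with the adjoint action of the Cartan subalgebra on the Lie algebra,
  and with the induced derivations of the enveloping algebra.\<close>

locale term_action =
  fixes R :: "('x alg_term \<times> 'x alg_term) set" and \<delta> :: "'h \<Rightarrow> 'x alg_term \<Rightarrow> 'x alg_term"
  assumes act_Zero: "alg_class R (\<delta> h Zero) = alg_class R Zero"
    and act_Add: "alg_class R (\<delta> h (Add s t)) = alg_class R (Add (\<delta> h s) (\<delta> h t))"
    and act_Scale: "alg_class R (\<delta> h (Scale c t)) = alg_class R (Scale c (\<delta> h t))"
    and act_cong: "alg_class R s = alg_class R t \<Longrightarrow> alg_class R (\<delta> h s) = alg_class R (\<delta> h t)"
begin

definition has_weight :: "('h \<Rightarrow> complex) \<Rightarrow> 'x alg_term \<Rightarrow> bool" where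
  "has_weight \<mu> t \<longleftrightarrow> (\<forall>h. alg_class R (\<delta> h t) = alg_class R (Scale (\<mu> h) t))"

lemma has_weight_tspan:
  assumes "t \<in> tspan R A" "\<And>a. a \<in> A \<Longrightarrow> has_weight \<mu> a"
  shows "has_weight \<mu> t"
  using assms(1)
proof induction
  case tspan_Zero
  show ?case by (simp add: has_weight_def act_Zero alg_scale_laws)
next
  case (tspan_Add s t)
  show ?case unfolding has_weight_def
  proof
    fix h
    have "alg_class R (\<delta> h (Add s t)) = alg_class R (Add (\<delta> h s) (\<delta> h t))" by (rule act_Add)
    also have "\<dots> = alg_class R (Add (Scale (\<mu> h) s) (Scale (\<mu> h) t))"
      using tspan_Add.IH by (intro alg_class_cong(1)) (auto simp: has_weight_def)
    finally show "alg_class R (\<delta> h (Add s t)) = alg_class R (Scale (\<mu> h) (Add s t))"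
      by (simp only: alg_scale_laws(2))
  qed
next
  case (tspan_Scale t c)
  show ?case unfolding has_weight_def
  proof
    fix h
    have "alg_class R (\<delta> h (Scale c t)) = alg_class R (Scale c (\<delta> h t))" by (rule act_Scale)
    also have "\<dots> = alg_class R (Scale c (Scale (\<mu> h) t))"
      using tspan_Scale.IH by (intro alg_class_cong(3)) (auto simp: has_weight_def)
    also have "\<dots> = alg_class R (Scale (\<mu> h) (Scale c t))" by (simp only: alg_scale_laws(3) mult.commute)
    finally show "alg_class R (\<delta> h (Scale c t)) = alg_class R (Scale (\<mu> h) (Scale c t))" .
  qed
next
  case (tspan_cong s t)
  then have "alg_class R s = alg_class R t" by (simp add: alg_class_eq_iff)
  then show ?case using tspan_cong.IH act_cong alg_class_cong(3) unfolding has_weight_def by metis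
qed (rule assms(2))

text \<open>A product of operators \<open>\<delta> h - z\<close>. It scales a vector of weight
  \<open>\<mu>\<close> by the product of the numbers \<open>\<mu> h - z\<close>, so it can be made
  to kill one weight and not another.\<close>

primrec act_list :: "('h \<times> complex) list \<Rightarrow> 'x alg_term \<Rightarrow> 'x alg_term" where
  "act_list [] t = t"
| "act_list (hz # L) t = Add (\<delta> (fst hz) (act_list L t)) (Scale (- snd hz) (act_list L t))"

lemma act_list_cong: "alg_class R s = alg_class R t \<Longrightarrow> alg_class R (act_list L s) = alg_class R (act_list L t)"
proof (induction L)
  case (Cons a L)
  then show ?case unfolding act_list.simps by (intro alg_class_cong act_cong)
qed simp

lemma act_list_Zero: "alg_class R (act_list L Zero) = alg_class R Zero"
proof (induction L)
  case (Cons a L)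
  have "alg_class R (act_list (a # L) Zero) = alg_class R (Add (\<delta> (fst a) Zero) (Scale (- snd a) Zero))"
    unfolding act_list.simps using Cons by (intro alg_class_cong act_cong)
  also have "\<dots> = alg_class R (Add Zero Zero)" by (intro alg_class_cong(1) act_Zero alg_scale_laws)
  finally show ?case by (simp only: alg_add_laws(3))
qed simp

lemma act_list_Scale: "alg_class R (act_list L (Scale c t)) = alg_class R (Scale c (act_list L t))"
proof (induction L)
  case (Cons a L)
  let ?u = "act_list L t"
  have "alg_class R (act_list (a # L) (Scale c t)) =
      alg_class R (Add (\<delta> (fst a) (Scale c ?u)) (Scale (- snd a) (Scale c ?u)))"
    unfolding act_list.simps using Cons by (intro alg_class_cong act_cong)
  also have "\<dots> = alg_class R (Add (Scale c (\<delta> (fst a) ?u)) (Scale c (Scale (- snd a) ?u)))"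
    by (intro alg_class_cong(1) act_Scale) (simp only: alg_scale_laws(3) mult.commute)
  finally show ?case by (simp only: alg_scale_laws(2) act_list.simps)
qed simp

lemma act_list_Add: "alg_class R (act_list L (Add s t)) = alg_class R (Add (act_list L s) (act_list L t))"
proof (induction L)
  case (Cons a L)
  let ?u = "act_list L s" and ?v = "act_list L t"
  have "alg_class R (act_list (a # L) (Add s t)) =
      alg_class R (Add (\<delta> (fst a) (Add ?u ?v)) (Scale (- snd a) (Add ?u ?v)))"
    unfolding act_list.simps using Cons by (intro alg_class_cong act_cong)
  also have "\<dots> = alg_class R (Add (Add (\<delta> (fst a) ?u) (\<delta> (fst a) ?v)) (Add (Scale (- snd a) ?u) (Scale (- snd a) ?v)))"
    by (intro alg_class_cong(1) act_Add alg_scale_laws)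
  also have "\<dots> = alg_class R (Add (Add (\<delta> (fst a) ?u) (Scale (- snd a) ?u)) (Add (\<delta> (fst a) ?v) (Scale (- snd a) ?v)))"
    unfolding alg_add_laws(2) by (intro alg_class_cong(1) alg_add_ac HOL.refl)
  finally show ?case by (simp only: act_list.simps)
qed simp

lemma act_list_weight:
  assumes "has_weight \<mu> t"
  shows "alg_class R (act_list L t) = alg_class R (Scale (\<Prod>(h, z)\<leftarrow>L. \<mu> h - z) t)"
proof (induction L)
  case (Cons a L)
  obtain h z where a: "a = (h, z)" by (cases a)
  let ?p = "\<Prod>(h, z)\<leftarrow>L. \<mu> h - z"
  have "alg_class R (act_list (a # L) t) = alg_class R (Add (\<delta> h (Scale ?p t)) (Scale (- z) (Scale ?p t)))"
    unfolding act_list.simps a fst_conv snd_conv by (intro alg_class_cong act_cong Cons)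
  also have "\<dots> = alg_class R (Add (Scale ?p (Scale (\<mu> h) t)) (Scale (- z * ?p) t))"
  proof (intro alg_class_cong(1))
    have "alg_class R (\<delta> h (Scale ?p t)) = alg_class R (Scale ?p (\<delta> h t))" by (rule act_Scale)
    also have "\<dots> = alg_class R (Scale ?p (Scale (\<mu> h) t))"
      using assms by (intro alg_class_cong(3)) (simp add: has_weight_def)
    finally show "alg_class R (\<delta> h (Scale ?p t)) = alg_class R (Scale ?p (Scale (\<mu> h) t))" .
  qed (rule alg_scale_laws(3))
  also have "\<dots> = alg_class R (Add (Scale (?p * \<mu> h) t) (Scale (- z * ?p) t))"
    by (intro alg_class_cong(1) alg_scale_laws(3) HOL.refl)
  also have "\<dots> = alg_class R (Scale (?p * \<mu> h + - z * ?p) t)" by (rule alg_scale_laws(1)[symmetric])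
  finally show ?case by (simp add: a algebra_simps)
qed (simp add: alg_scale_laws)

text \<open>Each spanning vector has a weight different from \<open>\<mu>\<close> at some
  \<open>h\<close> and is killed by the factor \<open>\<delta> h - m a h\<close>. The product of
  such factors kills \<open>u\<close>, yet acts on it by a nonzero scalar because \<open>u\<close>
  has weight \<open>\<mu>\<close>.\<close>

lemma weight_zero:
  assumes u: "u \<in> tspan R A" and A: "\<And>a. a \<in> A \<Longrightarrow> has_weight (m a) a \<and> m a \<noteq> \<mu>" and w: "has_weight \<mu> u"
  shows "alg_class R u = alg_class R Zero"
proof -
  \<comment> \<open>The surrounding lists \<open>M\<close> and \<open>N\<close> let the annihilators
    of two summands be concatenated: each still kills its own summand in the presence of the
    other.\<close>
  have "\<exists>L. (\<forall>(h, z)\<in>set L. z \<noteq> \<mu> h) \<and> (\<forall>M N. alg_class R (act_list (M @ L @ N) u) = alg_class R Zero)"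
    using u
  proof induction
    case tspan_Zero
    show ?case by (rule exI[of _ "[]"]) (simp add: act_list_Zero)
  next
    case (tspan_base a)
    then have a: "has_weight (m a) a" "m a \<noteq> \<mu>" using A by auto
    then obtain h where "m a h \<noteq> \<mu> h" by (auto simp: fun_eq_iff)
    moreover have "(\<Prod>(h', z)\<leftarrow>M @ [(h, m a h)] @ N. m a h' - z) = 0" for M N by simp
    ultimately show ?case
      by (intro exI[of _ "[(h, m a h)]"]) (simp add: act_list_weight[OF a(1)] alg_scale_laws)
  next
    case (tspan_Add s t)
    then obtain L L' where L: "\<forall>(h, z)\<in>set L. z \<noteq> \<mu> h" "\<And>M N. alg_class R (act_list (M @ L @ N) s) = alg_class R Zero"
      and L': "\<forall>(h, z)\<in>set L'. z \<noteq> \<mu> h" "\<And>M N. alg_class R (act_list (M @ L' @ N) t) = alg_class R Zero"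
      by blast
    have "alg_class R (act_list (M @ (L @ L') @ N) (Add s t)) = alg_class R Zero" for M N
    proof -
      have "alg_class R (act_list (M @ (L @ L') @ N) s) = alg_class R Zero"
        using L(2)[of M "L' @ N"] by simp
      moreover have "alg_class R (act_list (M @ (L @ L') @ N) t) = alg_class R Zero"
        using L'(2)[of "M @ L" N] by simp
      ultimately have "alg_class R (Add (act_list (M @ (L @ L') @ N) s) (act_list (M @ (L @ L') @ N) t)) = alg_class R (Add Zero Zero)"
        by (rule alg_class_cong(1))
      then show ?thesis by (simp only: act_list_Add alg_add_laws(3))
    qed
    moreover have "\<forall>(h, z)\<in>set (L @ L'). z \<noteq> \<mu> h" using L(1) L'(1) by auto
    ultimately show ?case by blast
  next
    case (tspan_Scale t c)
    then obtain L where L: "\<forall>(h, z)\<in>set L. z \<noteq> \<mu> h" "\<And>M N. alg_class R (act_list (M @ L @ N) t) = alg_class R Zero"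
      by blast
    have "alg_class R (act_list (M @ L @ N) (Scale c t)) = alg_class R Zero" for M N
      using alg_class_cong(3)[OF L(2)[of M N], of c] by (simp only: act_list_Scale alg_scale_laws(6))
    then show ?case using L(1) by blast
  next
    case (tspan_cong s t)
    then have st: "alg_class R s = alg_class R t" by (simp add: alg_class_eq_iff)
    show ?case using tspan_cong.IH act_list_cong[OF st] by metis
  qed
  then obtain L where L: "\<forall>(h, z)\<in>set L. z \<noteq> \<mu> h" "alg_class R (act_list ([] @ L @ []) u) = alg_class R Zero"
    by blast
  let ?p = "\<Prod>(h, z)\<leftarrow>L. \<mu> h - z"
  have "?p \<noteq> 0" using L(1) by (induction L) auto
  have "alg_class R (Scale ?p u) = alg_class R Zero"
    using L(2) act_list_weight[OF w, of L] by simp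
  then have "alg_class R (Scale (1 / ?p) (Scale ?p u)) = alg_class R (Scale (1 / ?p) Zero)"
    by (rule alg_class_cong(3))
  then show ?thesis using \<open>?p \<noteq> 0\<close> by (simp add: alg_scale_laws)
qed

text \<open>Split \<open>t\<close> into a part \<open>s\<close> of weight \<open>\<mu>\<close> and a
  rest \<open>u\<close>; then \<open>u = t - s\<close> has weight \<open>\<mu>\<close> as well and
  vanishes by \<open>weight_zero\<close>.\<close>

lemma weight_component:
  assumes t: "t \<in> tspan R A" and A: "\<And>a. a \<in> A \<Longrightarrow> has_weight (m a) a" and w: "has_weight \<mu> t"
  shows "t \<in> tspan R {a \<in> A. m a = \<mu>}"
proof -
  have "\<exists>s u. s \<in> tspan R {a \<in> A. m a = \<mu>} \<and> u \<in> tspan R {a \<in> A. m a \<noteq> \<mu>} \<and> alg_class R t = alg_class R (Add s u)"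
    using t
  proof induction
    case tspan_Zero
    show ?case by (intro exI[of _ Zero]) (simp add: tspan.tspan_Zero alg_add_laws)
  next
    case (tspan_base a)
    show ?case
    proof (cases "m a = \<mu>")
      case True
      then show ?thesis using tspan_base
        by (intro exI[of _ a] exI[of _ Zero]) (simp add: tspan.tspan_Zero tspan.tspan_base alg_add_laws)
    next
      case False
      then show ?thesis using tspan_base
        by (intro exI[of _ a] exI[of _ Zero]) (simp add: tspan.tspan_Zero tspan.tspan_base alg_add_laws)
    qed
  next
    case (tspan_Add t1 t2)
    then obtain s1 u1 s2 u2 where *: "s1 \<in> tspan R {a \<in> A. m a = \<mu>}" "u1 \<in> tspan R {a \<in> A. m a \<noteq> \<mu>}"
      "alg_class R t1 = alg_class R (Add s1 u1)" "s2 \<in> tspan R {a \<in> A. m a = \<mu>}"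
      "u2 \<in> tspan R {a \<in> A. m a \<noteq> \<mu>}" "alg_class R t2 = alg_class R (Add s2 u2)"
      by blast
    have "alg_class R (Add t1 t2) = alg_class R (Add (Add s1 u1) (Add s2 u2))"
      using *(3,6) by (rule alg_class_cong(1))
    also have "\<dots> = alg_class R (Add (Add s1 s2) (Add u1 u2))"
      unfolding alg_add_laws(2) by (intro alg_class_cong(1) alg_add_ac HOL.refl)
    finally show ?case using *(1,2,4,5) by (blast intro: tspan.tspan_Add)
  next
    case (tspan_Scale t c)
    then obtain s u where *: "s \<in> tspan R {a \<in> A. m a = \<mu>}" "u \<in> tspan R {a \<in> A. m a \<noteq> \<mu>}"
      "alg_class R t = alg_class R (Add s u)" by blast
    have "alg_class R (Scale c t) = alg_class R (Scale c (Add s u))" using *(3) by (rule alg_class_cong(3))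
    also have "\<dots> = alg_class R (Add (Scale c s) (Scale c u))" by (rule alg_scale_laws)
    finally show ?case using *(1,2) by (blast intro: tspan.tspan_Scale)
  next
    case (tspan_cong s t)
    then have "alg_class R s = alg_class R t" by (simp add: alg_class_eq_iff)
    then show ?case using tspan_cong.IH by simp
  qed
  then obtain s u where su: "s \<in> tspan R {a \<in> A. m a = \<mu>}" "u \<in> tspan R {a \<in> A. m a \<noteq> \<mu>}"
    "alg_class R t = alg_class R (Add s u)" by blast
  have ws: "has_weight \<mu> s" by (rule has_weight_tspan[OF su(1)]) (use A in auto)
  have "alg_class R (Add t (Scale (-1) s)) = alg_class R (Add (Add s u) (Scale (-1) s))"
    using su(3) by (rule alg_class_cong(1)) (rule HOL.refl)
  also have "\<dots> = alg_class R (Add u (Add s (Scale (-1) s)))"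
    unfolding alg_add_laws(1)[of R s u] alg_class_cong(1)[OF alg_add_laws(1)[of R s u] HOL.refl] by (rule alg_add_laws(2))
  also have "\<dots> = alg_class R (Add u Zero)" by (intro alg_class_cong(1) alg_add_laws HOL.refl)
  finally have u: "alg_class R u = alg_class R (Add t (Scale (-1) s))" by (simp only: alg_add_laws(3))
  have "has_weight \<mu> (Add t (Scale (-1) s))"
  proof (rule has_weight_tspan)
    show "Add t (Scale (-1) s) \<in> tspan R {t, s}"
      by (intro tspan_Add tspan_Scale tspan_base) simp_all
  qed (use w ws in auto)
  then have "has_weight \<mu> u"
    using act_cong[OF u] alg_class_cong(3)[OF u] unfolding has_weight_def by simp
  then have "alg_class R u = alg_class R Zero"
    using weight_zero[OF su(2), of m \<mu>] A by auto
  then have "alg_class R (Add s u) = alg_class R (Add s Zero)" by (rule alg_class_cong(1)[OF HOL.refl])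
  then have "alg_class R t = alg_class R s" using su(3) by (simp only: alg_add_laws(3))
  then show ?thesis using su(1) by (rule tspan_eq)
qed

end

subsection \<open>Dimensions\<close>

text \<open>Dual functionals make the vectors independent; since the functionals separate points,
  they also supply the coordinates of every vector.\<close>

lemma dim_dual_basis:
  fixes V :: "(complex, 'm) module"
  assumes V: "vectorspace complex_field V" and I: "finite I"
    and b: "\<And>i. i \<in> I \<Longrightarrow> b i \<in> carrier V"
    and add: "\<And>i x y. i \<in> I \<Longrightarrow> x \<in> carrier V \<Longrightarrow> y \<in> carrier V \<Longrightarrow> \<psi> i (x \<oplus>\<^bsub>V\<^esub> y) = \<psi> i x + \<psi> i y"
    and scale: "\<And>i c x. i \<in> I \<Longrightarrow> x \<in> carrier V \<Longrightarrow> \<psi> i (c \<odot>\<^bsub>V\<^esub> x) = c * \<psi> i x"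
    and dual: "\<And>i j. i \<in> I \<Longrightarrow> j \<in> I \<Longrightarrow> \<psi> i (b j) = (if i = j then 1 else (0::complex))"
    and inj: "\<And>x y. x \<in> carrier V \<Longrightarrow> y \<in> carrier V \<Longrightarrow> (\<And>i. i \<in> I \<Longrightarrow> \<psi> i x = \<psi> i y) \<Longrightarrow> x = y"
  shows "vectorspace.dim complex_field V = card I"
proof -
  interpret V: vectorspace complex_field V by (rule V)
  have K: "carrier complex_field = UNIV" "\<zero>\<^bsub>complex_field\<^esub> = 0" by (simp_all add: complex_field_def)
  have zero: "\<psi> i \<zero>\<^bsub>V\<^esub> = 0" if "i \<in> I" for i
  proof -
    have "\<psi> i \<zero>\<^bsub>V\<^esub> = \<psi> i (\<zero>\<^bsub>V\<^esub> \<oplus>\<^bsub>V\<^esub> \<zero>\<^bsub>V\<^esub>)" by simp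
    then show ?thesis using add[OF that, of "\<zero>\<^bsub>V\<^esub>" "\<zero>\<^bsub>V\<^esub>"] by simp
  qed
  have lin: "\<psi> i (V.lincomb a A) = (\<Sum>v\<in>A. a v * \<psi> i v)"
    if "i \<in> I" "finite A" "A \<subseteq> carrier V" for i a A
    using that(2,3)
  proof induction
    case empty
    show ?case using zero[OF that(1)] by (simp add: V.lincomb_def)
  next
    case (insert x A)
    have car: "a v \<odot>\<^bsub>V\<^esub> v \<in> carrier V" if "v \<in> insert x A" for v
      using that insert.prems by (intro V.smult_closed) (auto simp: K)
    have "V.lincomb a (insert x A) = a x \<odot>\<^bsub>V\<^esub> x \<oplus>\<^bsub>V\<^esub> V.lincomb a A"
      unfolding V.lincomb_def by (rule V.finsum_insert) (use insert car in auto)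
    moreover have "V.lincomb a A \<in> carrier V"
      by (rule V.lincomb_closed) (use insert in \<open>auto simp: K\<close>)
    ultimately show ?case
      using insert car[of x] by (simp add: add[OF that(1)] scale[OF that(1)])
  qed
  have bI: "inj_on b I"
    by (rule inj_onI) (metis dual zero_neq_one)
  let ?B = "b ` I"
  have B: "finite ?B" "?B \<subseteq> carrier V" using I b by auto
  have lin_b: "\<psi> i (V.lincomb a ?B) = a (b i)" if "i \<in> I" for i a
  proof -
    have "\<psi> i (V.lincomb a ?B) = (\<Sum>j\<in>I. a (b j) * \<psi> i (b j))"
      unfolding lin[OF that B] by (rule sum.reindex_cong[OF bI HOL.refl HOL.refl])
    also have "\<dots> = (\<Sum>j\<in>I. if j = i then a (b i) else 0)"
      by (rule sum.cong) (use that dual in auto)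
    finally show ?thesis using that I by simp
  qed
  have "V.lin_indpt ?B"
  proof (rule V.finite_lin_indpt2[OF B])
    fix a assume "V.lincomb a ?B = \<zero>\<^bsub>V\<^esub>"
    then show "\<forall>v\<in>?B. a v = \<zero>\<^bsub>complex_field\<^esub>" using lin_b[of _ a] zero K by auto
  qed
  moreover have "V.gen_set ?B"
  proof (rule equalityI)
    show "V.span ?B \<subseteq> carrier V" by (rule V.span_is_subset2[OF B(2)])
    show "carrier V \<subseteq> V.span ?B"
    proof
      fix x assume x: "x \<in> carrier V"
      define a where "a v = \<psi> (inv_into I b v) x" for v
      have "V.lincomb a ?B \<in> carrier V" by (rule V.lincomb_closed[OF B(2)]) (simp add: K)
      then have "x = V.lincomb a ?B"
        by (rule inj[OF x]) (simp add: lin_b a_def inv_into_f_f[OF bI])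
      then show "x \<in> V.span ?B" unfolding V.finite_span[OF B] using K by auto
    qed
  qed
  ultimately have "V.basis ?B" using B(2) by (simp add: V.basis_def)
  then show ?thesis using V.dim_basis[OF B(1)] by (simp add: card_image[OF bI])
qed

primrec tsum :: "('i \<Rightarrow> complex) \<Rightarrow> ('i \<Rightarrow> 'x alg_term) \<Rightarrow> 'i list \<Rightarrow> 'x alg_term" where
  "tsum c b [] = Zero"
| "tsum c b (i # is) = Add (Scale (c i) (b i)) (tsum c b is)"

lemma tsum_zero: "(\<And>i. i \<in> set is \<Longrightarrow> c i = 0) \<Longrightarrow> alg_class R (tsum c b is) = alg_class R Zero"
proof (induction "is")
  case (Cons i "is")
  have "alg_class R (tsum c b (i # is)) = alg_class R (Add (Scale 0 (b i)) Zero)"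
    using Cons by (simp only: tsum.simps) (intro alg_class_cong(1), simp_all)
  then show ?case by (simp only: alg_add_laws(3) alg_scale_laws(5))
qed simp

lemma tsum_add: "alg_class R (tsum (\<lambda>i. c i + d i) b is) = alg_class R (Add (tsum c b is) (tsum d b is))"
proof (induction "is")
  case Nil
  show ?case by (simp add: alg_add_laws)
next
  case (Cons i "is")
  have "alg_class R (tsum (\<lambda>i. c i + d i) b (i # is)) =
      alg_class R (Add (Add (Scale (c i) (b i)) (Scale (d i) (b i))) (Add (tsum c b is) (tsum d b is)))"
    unfolding tsum.simps by (intro alg_class_cong(1) alg_scale_laws Cons)
  also have "\<dots> = alg_class R (Add (Add (Scale (c i) (b i)) (tsum c b is)) (Add (Scale (d i) (b i)) (tsum d b is)))"
    unfolding alg_add_laws(2) by (intro alg_class_cong(1) alg_add_ac HOL.refl)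
  finally show ?case by (simp only: tsum.simps)
qed

lemma tsum_scale: "alg_class R (tsum (\<lambda>i. k * c i) b is) = alg_class R (Scale k (tsum c b is))"
proof (induction "is")
  case Nil
  show ?case by (simp add: alg_scale_laws)
next
  case (Cons i "is")
  have "alg_class R (tsum (\<lambda>i. k * c i) b (i # is)) =
      alg_class R (Add (Scale k (Scale (c i) (b i))) (Scale k (tsum c b is)))"
    unfolding tsum.simps by (intro alg_class_cong(1) alg_scale_laws(3)[symmetric] Cons)
  then show ?case by (simp only: tsum.simps alg_scale_laws(2))
qed

lemma tsum_delta:
  "distinct is \<Longrightarrow> j \<in> set is \<Longrightarrow> alg_class R (tsum (\<lambda>i. if i = j then 1 else 0) b is) = alg_class R (b j)"
proof (induction "is")
  case (Cons i "is")
  show ?case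
  proof (cases "i = j")
    case True
    then have "alg_class R (tsum (\<lambda>i. if i = j then 1 else 0) b (i # is)) = alg_class R (Add (b j) Zero)"
      unfolding tsum.simps
      by (intro alg_class_cong(1) tsum_zero) (use Cons.prems in \<open>auto simp: alg_scale_laws\<close>)
    then show ?thesis by (simp only: alg_add_laws(3))
  next
    case False
    then have "alg_class R (tsum (\<lambda>i. if i = j then 1 else 0) b (i # is)) = alg_class R (Add Zero (b j))"
      unfolding tsum.simps
      by (intro alg_class_cong(1)) (use Cons in \<open>auto simp: alg_scale_laws\<close>)
    then show ?thesis by (simp only: alg_add_laws(4))
  qed
qed simp

definition term_functional :: "('x alg_term \<times> 'x alg_term) set \<Rightarrow> ('x alg_term \<Rightarrow> complex) \<Rightarrow> bool" where
  "term_functional R \<psi> \<longleftrightarrow> \<psi> Zero = 0 \<and> (\<forall>s t. \<psi> (Add s t) = \<psi> s + \<psi> t) \<and>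
     (\<forall>c t. \<psi> (Scale c t) = c * \<psi> t) \<and> (\<forall>s t. alg_class R s = alg_class R t \<longrightarrow> \<psi> s = \<psi> t)"

lemma term_functionalD:
  assumes "term_functional R \<psi>"
  shows "\<psi> Zero = 0" "\<psi> (Add s t) = \<psi> s + \<psi> t" "\<psi> (Scale c t) = c * \<psi> t"
    "alg_class R s = alg_class R t \<Longrightarrow> \<psi> s = \<psi> t"
  using assms unfolding term_functional_def by blast+

lemma tspan_tsum:
  assumes "distinct is" and \<psi>: "\<And>i. i \<in> set is \<Longrightarrow> term_functional R (\<psi> i)"
    and dual: "\<And>i j. i \<in> set is \<Longrightarrow> j \<in> set is \<Longrightarrow> \<psi> i (b j) = (if i = j then 1 else 0)"
    and "t \<in> tspan R (b ` set is)"
  shows "alg_class R t = alg_class R (tsum (\<lambda>i. \<psi> i t) b is)"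
proof -
  have cong: "tsum c b is = tsum d b is" if "\<And>i. i \<in> set is \<Longrightarrow> c i = d i" for c d
    using that by (induction "is") auto
  show ?thesis using assms(4)
  proof induction
    case tspan_Zero
    show ?case by (rule tsum_zero[symmetric]) (rule term_functionalD(1)[OF \<psi>])
  next
    case (tspan_base a)
    then obtain j where j: "j \<in> set is" "a = b j" by auto
    have "tsum (\<lambda>i. \<psi> i a) b is = tsum (\<lambda>i. if i = j then 1 else 0) b is"
      by (rule cong) (use dual j in auto)
    then show ?case using tsum_delta[OF assms(1) j(1), of R b] j(2) by simp
  next
    case (tspan_Add s t)
    have "tsum (\<lambda>i. \<psi> i (Add s t)) b is = tsum (\<lambda>i. \<psi> i s + \<psi> i t) b is"
      by (rule cong) (rule term_functionalD(2)[OF \<psi>])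
    then show ?case using alg_class_cong(1)[OF tspan_Add.IH] by (simp only: tsum_add)
  next
    case (tspan_Scale t c)
    have "tsum (\<lambda>i. \<psi> i (Scale c t)) b is = tsum (\<lambda>i. c * \<psi> i t) b is"
      by (rule cong) (rule term_functionalD(3)[OF \<psi>])
    then show ?case using alg_class_cong(3)[OF tspan_Scale.IH] by (simp only: tsum_scale)
  next
    case (tspan_cong s t)
    then have st: "alg_class R s = alg_class R t" by (simp add: alg_class_eq_iff)
    have "tsum (\<lambda>i. \<psi> i s) b is = tsum (\<lambda>i. \<psi> i t) b is"
      by (rule cong) (rule term_functionalD(4)[OF \<psi> st])
    then show ?case using tspan_cong.IH st by simp
  qed
qed

lemma vectorspace_subalgebra:
  fixes V :: "(complex, 'x alg_term set) module" and R :: "('x alg_term \<times> 'x alg_term) set"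
  defines "P \<equiv> presented_algebra UNIV R"
  assumes ops: "\<And>x y. x \<oplus>\<^bsub>V\<^esub> y = x \<oplus>\<^bsub>P\<^esub> y" "\<And>c x. c \<odot>\<^bsub>V\<^esub> x = c \<odot>\<^bsub>P\<^esub> x" "\<zero>\<^bsub>V\<^esub> = \<zero>\<^bsub>P\<^esub>"
    and sub: "carrier V \<subseteq> carrier P"
    and closed: "\<zero>\<^bsub>P\<^esub> \<in> carrier V" "\<And>x y. x \<in> carrier V \<Longrightarrow> y \<in> carrier V \<Longrightarrow> x \<oplus>\<^bsub>P\<^esub> y \<in> carrier V"
      "\<And>c x. x \<in> carrier V \<Longrightarrow> c \<odot>\<^bsub>P\<^esub> x \<in> carrier V"
  shows "vectorspace complex_field V"
proof -
  interpret P: vectorspace complex_field P unfolding P_def by (rule vectorspace_presented_algebra)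
  have K: "carrier complex_field = UNIV" by (simp add: complex_field_def)
  have m: "x \<in> carrier P" if "x \<in> carrier V" for x using sub that by auto
  have "abelian_group V"
  proof (rule abelian_groupI)
    fix x assume x: "x \<in> carrier V"
    have "(-1) \<odot>\<^bsub>P\<^esub> x \<oplus>\<^bsub>P\<^esub> x = \<zero>\<^bsub>P\<^esub>"
    proof -
      obtain t where t: "x = alg_class R t"
        using m[OF x] unfolding P_def by (rule presented_algebra_cases)
      show ?thesis unfolding t P_def alg_class_simps[symmetric]
        using alg_add_laws(1)[of R "Scale (-1) t" t] alg_add_laws(5)[of R t] by simp
    qed
    then show "\<exists>y\<in>carrier V. y \<oplus>\<^bsub>V\<^esub> x = \<zero>\<^bsub>V\<^esub>"
      by (intro bexI[of _ "(-1) \<odot>\<^bsub>P\<^esub> x"]) (simp_all add: ops closed x)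
  qed (simp_all add: ops closed m P.a_ac)
  moreover have "cring complex_field"
    using field_complex_field by (simp add: field_def domain_def)
  ultimately have "Module.module complex_field V"
    by (intro moduleI) (simp_all add: ops closed m K P.smult_l_distr P.smult_r_distr P.smult_assoc1)
  then show ?thesis using field_complex_field by (rule vectorspace.intro)
qed

text \<open>The common last step of the dimension counts: a spanning family of terms, and
  functionals on terms that respect the congruence and are dual to it. Independence comes from the
  functionals instead of a normal form.\<close>

lemma dim_terms:
  fixes V :: "(complex, 'x alg_term set) module" and R :: "('x alg_term \<times> 'x alg_term) set"
  defines "P \<equiv> presented_algebra UNIV R"
  assumes ops: "\<And>x y. x \<oplus>\<^bsub>V\<^esub> y = x \<oplus>\<^bsub>P\<^esub> y" "\<And>c x. c \<odot>\<^bsub>V\<^esub> x = c \<odot>\<^bsub>P\<^esub> x" "\<zero>\<^bsub>V\<^esub> = \<zero>\<^bsub>P\<^esub>"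
    and I: "finite I"
    and carrier: "carrier V = alg_class R ` tspan R (b ` I)"
    and \<psi>: "\<And>i. i \<in> I \<Longrightarrow> term_functional R (\<psi> i)"
    and dual: "\<And>i j. i \<in> I \<Longrightarrow> j \<in> I \<Longrightarrow> \<psi> i (b j) = (if i = j then 1 else 0)"
  shows "vectorspace.dim complex_field V = card I"
proof -
  obtain "is" where "is": "set is = I" "distinct is" using finite_distinct_list[OF I] by blast
  define \<Psi> where "\<Psi> i x = \<psi> i (SOME t. x = alg_class R t)" for i x
  have \<Psi>: "\<Psi> i (alg_class R t) = \<psi> i t" if "i \<in> I" for i t
  proof -
    have "alg_class R t = alg_class R (SOME s. alg_class R t = alg_class R s)" by (rule someI[of _ t]) simp
    from term_functionalD(4)[OF \<psi>[OF that] this] show ?thesis unfolding \<Psi>_def ..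
  qed
  have V: "vectorspace complex_field V"
  proof (rule vectorspace_subalgebra[of V R, folded P_def])
    show "\<zero>\<^bsub>P\<^esub> \<in> carrier V"
      unfolding carrier P_def alg_class_simps[symmetric] by (intro imageI tspan.intros)
    show "x \<oplus>\<^bsub>P\<^esub> y \<in> carrier V" if "x \<in> carrier V" "y \<in> carrier V" for x y
      using that unfolding carrier P_def
      by (auto simp: alg_class_simps[symmetric] del: imageI intro!: imageI tspan_Add tspan_Scale)
    show "c \<odot>\<^bsub>P\<^esub> x \<in> carrier V" if "x \<in> carrier V" for c x
      using that unfolding carrier P_def
      by (auto simp: alg_class_simps[symmetric] del: imageI intro!: imageI tspan_Add tspan_Scale)
    show "carrier V \<subseteq> carrier P" by (auto simp: carrier P_def)
  qed (fact ops)+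
  show ?thesis
  proof (rule dim_dual_basis[OF V I, where b = "\<lambda>i. alg_class R (b i)" and \<psi> = \<Psi>])
    show "alg_class R (b i) \<in> carrier V" if "i \<in> I" for i
      unfolding carrier using that by (intro imageI tspan_base)
    show "\<Psi> i (x \<oplus>\<^bsub>V\<^esub> y) = \<Psi> i x + \<Psi> i y" if "i \<in> I" "x \<in> carrier V" "y \<in> carrier V" for i x y
      using that(2,3) unfolding carrier
      by (auto simp: ops P_def alg_class_simps(1)[symmetric] \<Psi>[OF that(1)] term_functionalD(2)[OF \<psi>[OF that(1)]])
    show "\<Psi> i (c \<odot>\<^bsub>V\<^esub> x) = c * \<Psi> i x" if "i \<in> I" "x \<in> carrier V" for i c x
      using that(2) unfolding carrier
      by (auto simp: ops P_def alg_class_simps(3)[symmetric] \<Psi>[OF that(1)] term_functionalD(3)[OF \<psi>[OF that(1)]])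
    show "\<Psi> i (alg_class R (b j)) = (if i = j then 1 else 0)" if "i \<in> I" "j \<in> I" for i j
      using \<Psi>[OF that(1)] dual[OF that] by simp
    fix x y assume xy: "x \<in> carrier V" "y \<in> carrier V" "\<And>i. i \<in> I \<Longrightarrow> \<Psi> i x = \<Psi> i y"
    then obtain s t where s: "x = alg_class R s" "s \<in> tspan R (b ` I)" and t: "y = alg_class R t" "t \<in> tspan R (b ` I)"
      unfolding carrier by auto
    have eq: "alg_class R u = alg_class R (tsum (\<lambda>i. \<psi> i u) b is)" if "u \<in> tspan R (b ` I)" for u
      by (rule tspan_tsum[OF "is"(2)]) (use \<psi> dual that "is"(1) in auto)
    have "tsum (\<lambda>i. \<psi> i s) b is' = tsum (\<lambda>i. \<psi> i t) b is'" if "set is' \<subseteq> I" for is'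
      using that by (induction is') (use xy(3) \<Psi> s(1) t(1) in auto)
    then show "x = y" using eq[OF s(2)] eq[OF t(2)] s(1) t(1) "is"(1) by simp
  qed
qed

section \<open>Operators on functions of words\<close>

type_synonym 'v op = "('v list \<Rightarrow> complex) \<Rightarrow> 'v list \<Rightarrow> complex"

definition op_linear :: "'v op \<Rightarrow> bool" where
  "op_linear P \<longleftrightarrow> (\<forall>\<phi> \<psi>. P (\<lambda>w. \<phi> w + \<psi> w) = (\<lambda>w. P \<phi> w + P \<psi> w)) \<and>
     (\<forall>c \<phi>. P (\<lambda>w. c * \<phi> w) = (\<lambda>w. c * P \<phi> w))"

lemma op_linearD:
  assumes "op_linear P"
  shows "P (\<lambda>w. \<phi> w + \<psi> w) = (\<lambda>w. P \<phi> w + P \<psi> w)" "P (\<lambda>w. c * \<phi> w) = (\<lambda>w. c * P \<phi> w)"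
    "P (\<lambda>w. 0) = (\<lambda>w. 0)" "P (\<lambda>w. \<phi> w - \<psi> w) = (\<lambda>w. P \<phi> w - P \<psi> w)"
proof -
  show 1: "P (\<lambda>w. \<phi> w + \<psi> w) = (\<lambda>w. P \<phi> w + P \<psi> w)" for \<phi> \<psi>
    using assms unfolding op_linear_def by blast
  show 2: "P (\<lambda>w. c * \<phi> w) = (\<lambda>w. c * P \<phi> w)" for c \<phi>
    using assms unfolding op_linear_def by blast
  show "P (\<lambda>w. 0) = (\<lambda>w. 0)" using 2[of 0 "\<lambda>_. 0"] by simp
  show "P (\<lambda>w. \<phi> w - \<psi> w) = (\<lambda>w. P \<phi> w - P \<psi> w)"
    using 1[of \<phi> "\<lambda>w. - 1 * \<psi> w"] 2[of "- 1" \<psi>] by simp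
qed

text \<open>Products act in reversed order because the operators are transposes of the action on words;
  \<open>\<kappa> = 1\<close> interprets the product as a commutator, \<open>\<kappa> = 0\<close> as composition.\<close>

primrec ev :: "complex \<Rightarrow> ('x \<Rightarrow> 'v op) \<Rightarrow> 'x alg_term \<Rightarrow> 'v op" where
  "ev \<kappa> \<gamma> (Gen x) = \<gamma> x"
| "ev \<kappa> \<gamma> Zero = (\<lambda>\<phi> w. 0)"
| "ev \<kappa> \<gamma> (Add s t) = (\<lambda>\<phi> w. ev \<kappa> \<gamma> s \<phi> w + ev \<kappa> \<gamma> t \<phi> w)"
| "ev \<kappa> \<gamma> (Scale c t) = (\<lambda>\<phi> w. c * ev \<kappa> \<gamma> t \<phi> w)"
| "ev \<kappa> \<gamma> (Mult s t) = (\<lambda>\<phi> w. ev \<kappa> \<gamma> t (ev \<kappa> \<gamma> s \<phi>) w - \<kappa> * ev \<kappa> \<gamma> s (ev \<kappa> \<gamma> t \<phi>) w)"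

definition op_subspace :: "('v list \<Rightarrow> complex) set \<Rightarrow> bool" where
  "op_subspace J \<longleftrightarrow> (\<lambda>w. 0) \<in> J \<and> (\<forall>\<phi>\<in>J. \<forall>\<psi>\<in>J. (\<lambda>w. \<phi> w + \<psi> w) \<in> J) \<and> (\<forall>c. \<forall>\<phi>\<in>J. (\<lambda>w. c * \<phi> w) \<in> J)"

lemma op_subspaceD:
  assumes "op_subspace J"
  shows "(\<lambda>w. 0) \<in> J" "\<phi> \<in> J \<Longrightarrow> \<psi> \<in> J \<Longrightarrow> (\<lambda>w. \<phi> w + \<psi> w) \<in> J" "\<phi> \<in> J \<Longrightarrow> (\<lambda>w. c * \<phi> w) \<in> J"
    "\<phi> \<in> J \<Longrightarrow> \<psi> \<in> J \<Longrightarrow> (\<lambda>w. \<phi> w - c * \<psi> w) \<in> J"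
proof -
  show "(\<lambda>w. 0) \<in> J" using assms unfolding op_subspace_def by blast
  show 1: "(\<lambda>w. \<phi> w + \<psi> w) \<in> J" if "\<phi> \<in> J" "\<psi> \<in> J" for \<phi> \<psi>
    using assms that unfolding op_subspace_def by blast
  show 2: "(\<lambda>w. c * \<phi> w) \<in> J" if "\<phi> \<in> J" for c \<phi>
    using assms that unfolding op_subspace_def by blast
  show "(\<lambda>w. \<phi> w - c * \<psi> w) \<in> J" if "\<phi> \<in> J" "\<psi> \<in> J"
    using 1[OF that(1) 2[OF that(2), of "- c"]] by simp
qed

text \<open>The relations of an algebra will be checked only on functions in \<open>J\<close>;
  invariance of \<open>J\<close> under the generators is what extends the check from relations to
  the whole congruence.\<close>

locale word_action =
  fixes \<gamma> :: "'x \<Rightarrow> 'v op" and J :: "('v list \<Rightarrow> complex) set"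
  assumes lin_gen: "op_linear (\<gamma> x)" and J: "op_subspace J" and J_gen: "\<phi> \<in> J \<Longrightarrow> \<gamma> x \<phi> \<in> J"
begin

lemma ev_linear: "op_linear (ev \<kappa> \<gamma> t)"
proof (induction t)
  case (Mult s t)
  then show ?case by (simp add: op_linear_def) (simp add: op_linearD algebra_simps)
qed (auto simp: op_linear_def op_linearD[OF lin_gen] algebra_simps)

lemma ev_J: "\<phi> \<in> J \<Longrightarrow> ev \<kappa> \<gamma> t \<phi> \<in> J"
  by (induction t arbitrary: \<phi>) (simp_all add: J_gen op_subspaceD[OF J])

lemma ev_cong:
  assumes R: "\<And>s t \<phi>. (s, t) \<in> R \<Longrightarrow> \<phi> \<in> J \<Longrightarrow> ev \<kappa> \<gamma> s \<phi> = ev \<kappa> \<gamma> t \<phi>"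
    and "(s, t) \<in> alg_cong R" "\<phi> \<in> J"
  shows "ev \<kappa> \<gamma> s \<phi> = ev \<kappa> \<gamma> t \<phi>"
  using assms(2,3)
proof (induction arbitrary: \<phi>)
  case (rel s t)
  then show ?case using R by blast
next
  case (trans s t u)
  then show ?case by simp
next
  case (Mult s s' t t')
  then show ?case by (simp add: ev_J)
qed (simp_all add: op_linearD[OF ev_linear] algebra_simps)

lemma term_functional_ev:
  assumes R: "\<And>s t \<phi>. (s, t) \<in> R \<Longrightarrow> \<phi> \<in> J \<Longrightarrow> ev \<kappa> \<gamma> s \<phi> = ev \<kappa> \<gamma> t \<phi>" and "\<phi> \<in> J"
  shows "term_functional R (\<lambda>t. ev \<kappa> \<gamma> t \<phi> w)"
  unfolding term_functional_def alg_class_eq_iff using ev_cong[OF R _ assms(2)] by auto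

end

lemma ev_lie_laws:
  assumes "word_action \<gamma> J" "(s, t) \<in> lie_laws"
  shows "ev 1 \<gamma> s \<phi> = ev 1 \<gamma> t \<phi>"
proof -
  interpret word_action \<gamma> J by fact
  show ?thesis using assms(2)
    by (auto simp: lie_laws_def op_linearD[OF ev_linear] algebra_simps)
qed

section \<open>Root spaces\<close>

context simply_laced
begin

definition wt :: "'v list \<Rightarrow> complex^'d" where
  "wt w = (\<Sum>i\<leftarrow>w. \<alpha> i)"

lemma wt_simps [simp]: "wt [] = 0" "wt (i # w) = \<alpha> i + wt w" "wt (a @ b) = wt a + wt b"
  by (simp_all add: wt_def)

subsection \<open>The dual of a lowest weight Verma module\<close>

abbreviation e_op :: "'v \<Rightarrow> 'v op" where
  "e_op i \<phi> \<equiv> (\<lambda>w. \<phi> (i # w))"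

abbreviation h_op :: "complex^'d \<Rightarrow> 'v op" where
  "h_op h \<phi> \<equiv> (\<lambda>w. pairing (wt w) h * \<phi> w)"

text \<open>Transpose of \<open>f_i\<close> on the module with basis the words and lowest weight 0.
  There \<open>f_i\<close> kills the empty word, and \<open>f_i e_j\<close> equals
  \<open>e_j f_i\<close>, minus the coroot of \<open>i\<close> when \<open>i = j\<close>; the coroot
  acts on the word \<open>w\<close> through its weight.\<close>

fun f_op :: "'v \<Rightarrow> ('v list \<Rightarrow> complex) \<Rightarrow> 'v list \<Rightarrow> complex" where
  "f_op i \<phi> [] = 0"
| "f_op i \<phi> (j # w) = f_op i (\<lambda>u. \<phi> (j # u)) w - (if i = j then pairing (wt w) (\<alpha>v i) * \<phi> w else 0)"

primrec km_op :: "('d, 'v) km_gen \<Rightarrow> 'v op" where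
  "km_op (Hgen h) = h_op h"
| "km_op (Egen i) = e_op i"
| "km_op (Fgen i) = f_op i"

lemma f_op_linear:
  "f_op i (\<lambda>w. \<phi> w + \<psi> w) w = f_op i \<phi> w + f_op i \<psi> w"
  "f_op i (\<lambda>w. c * \<phi> w) w = c * f_op i \<phi> w"
  "f_op i (\<lambda>w. \<phi> w - \<psi> w) w = f_op i \<phi> w - f_op i \<psi> w"
  "f_op i (\<lambda>w. 0) w = 0"
proof -
  show 1: "f_op i (\<lambda>w. \<phi> w + \<psi> w) w = f_op i \<phi> w + f_op i \<psi> w" for \<phi> \<psi>
    by (induction w arbitrary: \<phi> \<psi>) (simp_all add: algebra_simps)
  show 2: "f_op i (\<lambda>w. c * \<phi> w) w = c * f_op i \<phi> w" for c \<phi>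
    by (induction w arbitrary: \<phi>) (simp_all add: algebra_simps)
  show "f_op i (\<lambda>w. \<phi> w - \<psi> w) w = f_op i \<phi> w - f_op i \<psi> w"
    using 1[of \<phi> "\<lambda>w. - 1 * \<psi> w"] 2[of "- 1" \<psi>] by simp
  show "f_op i (\<lambda>w. 0) w = 0" using 2[of 0 "\<lambda>_. 0"] by simp
qed

lemma km_op_linear: "op_linear (km_op g)"
  by (cases g) (auto simp: op_linear_def f_op_linear algebra_simps)

text \<open>Functions that descend to the quotient of the free algebra by the two-sided ideal of the
  Serre elements; the contexts \<open>a\<close> and \<open>b\<close> account for the two
  sides.\<close>

definition serre_functions :: "('v list \<Rightarrow> complex) set" where
  "serre_functions = {\<phi>. (\<forall>a b i j. i \<noteq> j \<longrightarrow> \<not> E i j \<longrightarrow> \<phi> (a @ i # j # b) = \<phi> (a @ j # i # b)) \<and>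
     (\<forall>a b i j. E i j \<longrightarrow> \<phi> (a @ i # i # j # b) - 2 * \<phi> (a @ i # j # i # b) + \<phi> (a @ j # i # i # b) = 0)}"

lemma serre_functionsD:
  assumes "\<phi> \<in> serre_functions"
  shows "i \<noteq> j \<Longrightarrow> \<not> E i j \<Longrightarrow> \<phi> (a @ i # j # b) = \<phi> (a @ j # i # b)"
    and "E i j \<Longrightarrow> \<phi> (a @ i # i # j # b) - 2 * \<phi> (a @ i # j # i # b) + \<phi> (a @ j # i # i # b) = 0"
  using assms unfolding serre_functions_def by blast+

lemma cubic_iff: "x - 2 * y + z = 0 \<longleftrightarrow> x = 2 * y - (z :: complex)"
  by (auto simp: algebra_simps)

lemma serre_functionsI:
  assumes "\<And>a b i j. i \<noteq> j \<Longrightarrow> \<not> E i j \<Longrightarrow> \<phi> (a @ i # j # b) = \<phi> (a @ j # i # b)"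
    and "\<And>a b i j. E i j \<Longrightarrow> \<phi> (a @ i # i # j # b) - 2 * \<phi> (a @ i # j # i # b) + \<phi> (a @ j # i # i # b) = 0"
  shows "\<phi> \<in> serre_functions"
  using assms unfolding serre_functions_def by blast

lemma e_op_serre:
  assumes "\<phi> \<in> serre_functions" shows "e_op k \<phi> \<in> serre_functions"
  unfolding serre_functions_def
proof (intro CollectI conjI allI impI)
  fix a b i j assume "i \<noteq> j" "\<not> E i j"
  from serre_functionsD(1)[OF assms this, of "k # a" b]
  show "e_op k \<phi> (a @ i # j # b) = e_op k \<phi> (a @ j # i # b)" by simp
next
  fix a b i j assume "E i j"
  from serre_functionsD(2)[OF assms this, of "k # a" b]
  show "e_op k \<phi> (a @ i # i # j # b) - 2 * e_op k \<phi> (a @ i # j # i # b) + e_op k \<phi> (a @ j # i # i # b) = 0"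
    by simp
qed

lemma f_op_swap:
  assumes "\<phi> \<in> serre_functions" "i \<noteq> j" "\<not> E i j"
  shows "f_op k \<phi> (a @ i # j # b) = f_op k \<phi> (a @ j # i # b)"
  using assms(1)
proof (induction a arbitrary: \<phi>)
  case Nil
  have "(\<lambda>u. \<phi> (i # j # u)) = (\<lambda>u. \<phi> (j # i # u))"
    using serre_functionsD(1)[OF Nil assms(2,3), of "[]"] by auto
  then show ?case using assms(2,3) sym_E[of j i] by (auto simp: pairing_simps pairing_root)
next
  case (Cons x a)
  show ?case
    using Cons.IH[OF e_op_serre[OF Cons.prems]] serre_functionsD(1)[OF Cons.prems assms(2,3)]
    by (simp add: add.left_commute)
qed

text \<open>Moving \<open>f_k\<close> past a Serre element leaves only weight scalars. At the front
  of the word they cancel because of the Cartan entries 2 and -1; a longer prefix contributes a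
  common scalar, as the three words have the same weight.\<close>

lemma f_op_cubic:
  assumes "\<phi> \<in> serre_functions" and E: "E i j"
  shows "f_op k \<phi> (a @ i # i # j # b) - 2 * f_op k \<phi> (a @ i # j # i # b) + f_op k \<phi> (a @ j # i # i # b) = 0"
  using assms(1)
proof (induction a arbitrary: \<phi>)
  case Nil
  have ij: "i \<noteq> j" "E j i" using E irrefl_E sym_E by auto
  let ?A = "f_op k (\<lambda>u. \<phi> (i # i # j # u)) b" and ?B = "f_op k (\<lambda>u. \<phi> (i # j # i # u)) b"
    and ?C = "f_op k (\<lambda>u. \<phi> (j # i # i # u)) b"
  have "(\<lambda>u. \<phi> (i # i # j # u) - 2 * \<phi> (i # j # i # u) + \<phi> (j # i # i # u)) = (\<lambda>u. 0)"
    using serre_functionsD(2)[OF Nil E, of "[]"] by auto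
  then have "f_op k (\<lambda>u. \<phi> (i # i # j # u) - 2 * \<phi> (i # j # i # u) + \<phi> (j # i # i # u)) b = 0"
    by (simp only: f_op_linear)
  then have "?A - 2 * ?B + ?C = 0" by (simp only: f_op_linear)
  moreover have "pairing (\<alpha> j) (\<alpha>v i) = - 1" "pairing (\<alpha> i) (\<alpha>v j) = - 1"
    "pairing (\<alpha> i) (\<alpha>v i) = 2" "pairing (\<alpha> j) (\<alpha>v j) = 2"
    using ij E by (simp_all add: pairing_root)
  ultimately show ?case
    using ij unfolding append_Nil f_op.simps wt_simps pairing_simps
    by (cases "k = i"; cases "k = j") (simp_all add: algebra_simps)
next
  case (Cons x a)
  let ?c = "pairing (wt (a @ i # i # j # b)) (\<alpha>v k)"
  have w: "wt (a @ i # j # i # b) = wt (a @ i # i # j # b)" "wt (a @ j # i # i # b) = wt (a @ i # i # j # b)"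
    by (simp_all add: algebra_simps)
  have 1: "f_op k (e_op x \<phi>) (a @ i # i # j # b) - 2 * f_op k (e_op x \<phi>) (a @ i # j # i # b) +
      f_op k (e_op x \<phi>) (a @ j # i # i # b) = 0"
    by (rule Cons.IH[OF e_op_serre[OF Cons.prems]])
  have "?c * (\<phi> (a @ i # i # j # b) - 2 * \<phi> (a @ i # j # i # b) + \<phi> (a @ j # i # i # b)) = 0"
    using serre_functionsD(2)[OF Cons.prems E] by simp
  then have 2: "?c * \<phi> (a @ i # i # j # b) - 2 * (?c * \<phi> (a @ i # j # i # b)) + ?c * \<phi> (a @ j # i # i # b) = 0"
    by (simp add: algebra_simps)
  show ?case
    using 1 2 unfolding append_Cons f_op.simps w by (cases "k = x") (simp_all add: algebra_simps)
qed

lemma serre_subspace: "op_subspace serre_functions"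
  unfolding op_subspace_def
proof (intro conjI ballI allI)
  show "(\<lambda>w. 0) \<in> serre_functions" by (rule serre_functionsI) simp_all
next
  fix \<phi> \<psi> assume *: "\<phi> \<in> serre_functions" "\<psi> \<in> serre_functions"
  show "(\<lambda>w. \<phi> w + \<psi> w) \<in> serre_functions"
  proof (rule serre_functionsI)
    fix a b i j assume "E i j"
    from serre_functionsD(2)[OF *(1) this, of a b, unfolded cubic_iff]
      serre_functionsD(2)[OF *(2) this, of a b, unfolded cubic_iff]
    show "\<phi> (a @ i # i # j # b) + \<psi> (a @ i # i # j # b) - 2 * (\<phi> (a @ i # j # i # b) + \<psi> (a @ i # j # i # b)) +
        (\<phi> (a @ j # i # i # b) + \<psi> (a @ j # i # i # b)) = 0"
      by (simp add: algebra_simps)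
  next
    fix a b i j assume "i \<noteq> j" "\<not> E i j"
    from serre_functionsD(1)[OF *(1) this, of a b] serre_functionsD(1)[OF *(2) this, of a b]
    show "\<phi> (a @ i # j # b) + \<psi> (a @ i # j # b) = \<phi> (a @ j # i # b) + \<psi> (a @ j # i # b)" by simp
  qed
next
  fix c \<phi> assume *: "\<phi> \<in> serre_functions"
  show "(\<lambda>w. c * \<phi> w) \<in> serre_functions"
  proof (rule serre_functionsI)
    fix a b i j assume "E i j"
    have "c * (\<phi> (a @ i # i # j # b) - 2 * \<phi> (a @ i # j # i # b) + \<phi> (a @ j # i # i # b)) = 0"
      using serre_functionsD(2)[OF * \<open>E i j\<close>, of a b] by simp
    then show "c * \<phi> (a @ i # i # j # b) - 2 * (c * \<phi> (a @ i # j # i # b)) + c * \<phi> (a @ j # i # i # b) = 0"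
      by (simp add: algebra_simps)
  next
    fix a b i j assume "i \<noteq> j" "\<not> E i j"
    from serre_functionsD(1)[OF * this, of a b]
    show "c * \<phi> (a @ i # j # b) = c * \<phi> (a @ j # i # b)" by simp
  qed
qed

lemma h_op_serre:
  assumes "\<phi> \<in> serre_functions" shows "h_op h \<phi> \<in> serre_functions"
  unfolding serre_functions_def
proof (intro CollectI conjI allI impI)
  fix a b i j assume "i \<noteq> j" "\<not> E i j"
  then show "pairing (wt (a @ i # j # b)) h * \<phi> (a @ i # j # b) = pairing (wt (a @ j # i # b)) h * \<phi> (a @ j # i # b)"
    using serre_functionsD(1)[OF assms, of i j a b] by (simp add: algebra_simps)
next
  fix a b i j assume "E i j"
  let ?c = "pairing (wt (a @ i # i # j # b)) h"
  have w: "wt (a @ i # j # i # b) = wt (a @ i # i # j # b)" "wt (a @ j # i # i # b) = wt (a @ i # i # j # b)"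
    by (simp_all add: algebra_simps)
  have "?c * (\<phi> (a @ i # i # j # b) - 2 * \<phi> (a @ i # j # i # b) + \<phi> (a @ j # i # i # b)) = 0"
    using serre_functionsD(2)[OF assms \<open>E i j\<close>] by simp
  then show "pairing (wt (a @ i # i # j # b)) h * \<phi> (a @ i # i # j # b) -
      2 * (pairing (wt (a @ i # j # i # b)) h * \<phi> (a @ i # j # i # b)) +
      pairing (wt (a @ j # i # i # b)) h * \<phi> (a @ j # i # i # b) = 0"
    unfolding w by (simp add: algebra_simps)
qed

lemma km_op_serre: "\<phi> \<in> serre_functions \<Longrightarrow> km_op g \<phi> \<in> serre_functions"
proof (cases g)
  case (Fgen k)
  assume \<phi>: "\<phi> \<in> serre_functions"
  show ?thesis
    unfolding Fgen km_op.simps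
    by (rule serre_functionsI; (rule f_op_swap[OF \<phi>] | rule f_op_cubic[OF \<phi>]); assumption)
qed (simp_all add: e_op_serre h_op_serre)

lemma km_word_action: "word_action km_op serre_functions"
  by unfold_locales (fact km_op_linear serre_subspace | erule km_op_serre)+

lemma f_op_h: "f_op i (h_op h \<phi>) w = pairing (wt w) h * f_op i \<phi> w - pairing (\<alpha> i) h * f_op i \<phi> w"
proof (induction w arbitrary: \<phi>)
  case (Cons j w)
  have "f_op i (\<lambda>u. h_op h \<phi> (j # u)) w = f_op i (\<lambda>u. pairing (\<alpha> j) h * \<phi> (j # u) + h_op h (e_op j \<phi>) u) w"
    by (simp add: pairing_simps algebra_simps)
  also have "\<dots> = pairing (\<alpha> j) h * f_op i (e_op j \<phi>) w + f_op i (h_op h (e_op j \<phi>)) w"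
    by (simp only: f_op_linear)
  finally have *: "f_op i (\<lambda>u. h_op h \<phi> (j # u)) w =
      pairing (\<alpha> j) h * f_op i (e_op j \<phi>) w + f_op i (h_op h (e_op j \<phi>)) w" .
  show ?case unfolding f_op.simps(2) unfolding * Cons unfolding wt_simps pairing_simps
    by (cases "i = j") (simp_all add: algebra_simps)
qed simp

lemma f_op_comm:
  assumes "i \<noteq> j" "\<not> E i j"
  shows "f_op i (f_op j \<phi>) w = f_op j (f_op i \<phi>) w"
proof (induction w arbitrary: \<phi>)
  case (Cons k w)
  have ij: "pairing (\<alpha> i) (\<alpha>v j) = 0" "pairing (\<alpha> j) (\<alpha>v i) = 0"
    using assms sym_E[of j i] by (auto simp: pairing_root)
  have e: "e_op k (f_op m \<phi>) = (\<lambda>u. f_op m (e_op k \<phi>) u - (if m = k then h_op (\<alpha>v m) \<phi> u else 0))" for m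
    by (auto simp: fun_eq_iff)
  have 1: "f_op l (e_op k (f_op m \<phi>)) w = f_op l (f_op m (e_op k \<phi>)) w -
      (if m = k then f_op l (h_op (\<alpha>v m) \<phi>) w else 0)" for l m
    unfolding e by (cases "m = k") (simp_all add: f_op_linear)
  have 2: "f_op l (f_op m \<phi>) (k # w) = f_op l (e_op k (f_op m \<phi>)) w -
      (if l = k then pairing (wt w) (\<alpha>v l) * f_op m \<phi> w else 0)" for l m
    by (rule f_op.simps(2))
  show ?case
    using assms(1) Cons[of "e_op k \<phi>"] ij unfolding 2 1 f_op_h
    by (cases "i = k"; cases "j = k") simp_all
qed simp

text \<open>The Serre element of the \<open>f\<close> commutes with every \<open>e_k\<close> and
  kills the lowest weight vector, so it acts as zero on the whole word module.\<close>

lemma f_op_cube: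
  assumes E: "E i j"
  shows "f_op i (f_op i (f_op j \<phi>)) w - 2 * f_op i (f_op j (f_op i \<phi>)) w + f_op j (f_op i (f_op i \<phi>)) w = 0"
proof (induction w arbitrary: \<phi>)
  case (Cons k w)
  have ij: "i \<noteq> j" using E irrefl_E by auto
  have p: "pairing (\<alpha> i) (\<alpha>v j) = -1" "pairing (\<alpha> j) (\<alpha>v i) = -1"
    "pairing (\<alpha> i) (\<alpha>v i) = 2" "pairing (\<alpha> j) (\<alpha>v j) = 2"
    using E ij sym_E[of i j] by (auto simp: pairing_root)
  have e: "e_op k (f_op m \<phi>) = (\<lambda>u. f_op m (e_op k \<phi>) u - (if m = k then h_op (\<alpha>v m) \<phi> u else 0))" for m \<phi>
    by (auto simp: fun_eq_iff)
  have f: "f_op l (\<lambda>u. f_op m \<psi> u - (if m = k then \<theta> u else 0)) = (\<lambda>u. f_op l (f_op m \<psi>) u - (if m = k then f_op l \<theta> u else 0))"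
    for l m \<psi> \<theta>
    by (cases "m = k") (auto simp: fun_eq_iff f_op_linear)
  have h: "f_op l (h_op (\<alpha>v m) \<psi>) = (\<lambda>u. h_op (\<alpha>v m) (f_op l \<psi>) u - pairing (\<alpha> l) (\<alpha>v m) * f_op l \<psi> u)" for l m \<psi>
    by (simp add: fun_eq_iff f_op_h)
  have ffh: "f_op n (\<lambda>u. h_op (\<alpha>v m) (f_op l \<psi>) u - c * f_op l \<psi> u) u =
      pairing (wt u) (\<alpha>v m) * f_op n (f_op l \<psi>) u - pairing (\<alpha> n) (\<alpha>v m) * f_op n (f_op l \<psi>) u - c * f_op n (f_op l \<psi>) u"
    for l m n \<psi> c u
    by (simp add: f_op_linear f_op_h)
  \<comment> \<open>Transposed form of moving \<open>e_k\<close> through three \<open>f\<close>: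
    each passage may leave a coroot, which is then carried past further \<open>f\<close> and picks
    up Cartan entries.\<close>
  have *: "f_op l (f_op m (f_op n \<phi>)) (k # w) = f_op l (f_op m (f_op n (e_op k \<phi>))) w
     - (if n = k then pairing (wt w) (\<alpha>v n) * f_op l (f_op m \<phi>) w - pairing (\<alpha> l) (\<alpha>v n) * f_op l (f_op m \<phi>) w
          - pairing (\<alpha> m) (\<alpha>v n) * f_op l (f_op m \<phi>) w else 0)
     - (if m = k then pairing (wt w) (\<alpha>v m) * f_op l (f_op n \<phi>) w - pairing (\<alpha> l) (\<alpha>v m) * f_op l (f_op n \<phi>) w else 0)
     - (if l = k then pairing (wt w) (\<alpha>v l) * f_op m (f_op n \<phi>) w else 0)" for l m n
  proof -
    have 1: "e_op k (f_op m (f_op n \<phi>)) = (\<lambda>u. f_op m (f_op n (e_op k \<phi>)) u -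
        (if n = k then f_op m (h_op (\<alpha>v n) \<phi>) u else 0) - (if m = k then h_op (\<alpha>v m) (f_op n \<phi>) u else 0))"
      unfolding e f by (rule HOL.refl)
    have 2: "f_op l (e_op k (f_op m (f_op n \<phi>))) w = f_op l (f_op m (f_op n (e_op k \<phi>))) w -
        (if n = k then f_op l (f_op m (h_op (\<alpha>v n) \<phi>)) w else 0) - (if m = k then f_op l (h_op (\<alpha>v m) (f_op n \<phi>)) w else 0)"
      unfolding 1 by (cases "n = k"; cases "m = k") (simp_all add: f_op_linear)
    have 3: "f_op l (f_op m (f_op n \<phi>)) (k # w) = f_op l (e_op k (f_op m (f_op n \<phi>))) w -
        (if l = k then pairing (wt w) (\<alpha>v l) * f_op m (f_op n \<phi>) w else 0)"
      by (rule f_op.simps(2))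
    show ?thesis unfolding 3 2 h ffh by (rule HOL.refl)
  qed
  show ?case
    using Cons[of "e_op k \<phi>"] ij unfolding * p
    by (cases "k = i"; cases "k = j") (simp_all add: algebra_simps)
qed simp

abbreviation "B \<equiv> cartan_matrix E"
abbreviation "rels \<equiv> lie_laws \<union> km_relations B \<alpha> \<alpha>v"
abbreviation "evl \<equiv> ev 1 km_op"

lemma cartan_entry: "i \<noteq> j \<Longrightarrow> nat (1 - B $ i $ j) = (if E i j then 2 else 1)"
  by (simp add: cartan_matrix_def adjacency_matrix_def Finite_Cartesian_Product.mat_def)

lemma evl_rels:
  assumes "(s, t) \<in> rels" "\<phi> \<in> serre_functions"
  shows "evl s \<phi> = evl t \<phi>"
  using assms(1)
proof
  assume "(s, t) \<in> lie_laws"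
  then show ?thesis by (rule ev_lie_laws[OF km_word_action])
next
  assume "(s, t) \<in> km_relations B \<alpha> \<alpha>v"
  then show ?thesis
  proof cases
    case (H_f h i)
    then show ?thesis by (auto simp: fun_eq_iff f_op_h)
  next
    case (serre_e i j)
    then show ?thesis
    proof (cases "E i j")
      case True
      have "\<phi> (i # i # j # w) = 2 * \<phi> (i # j # i # w) - \<phi> (j # i # i # w)" for w
        using serre_functionsD(2)[OF assms(2) True, of "[]" w] by (simp add: algebra_simps)
      then show ?thesis
        using serre_e True by (auto simp: cartan_entry numeral_2_eq_2 fun_eq_iff)
    next
      case False
      then show ?thesis
        using serre_e serre_functionsD(1)[OF assms(2) serre_e(3) False, of "[]"]
        by (auto simp: cartan_entry fun_eq_iff)
    qed
  next
    case (serre_f i j)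
    then show ?thesis
    proof (cases "E i j")
      case True
      have "f_op j (f_op i (f_op i \<phi>)) w = 2 * f_op i (f_op j (f_op i \<phi>)) w - f_op i (f_op i (f_op j \<phi>)) w" for w
        using f_op_cube[OF True, of \<phi> w] by (simp add: algebra_simps)
      then show ?thesis
        using serre_f True by (auto simp: cartan_entry numeral_2_eq_2 fun_eq_iff f_op_linear)
    next
      case False
      then show ?thesis
        using serre_f f_op_comm[OF serre_f(3) False]
        by (auto simp: cartan_entry fun_eq_iff)
    qed
  qed (auto simp: fun_eq_iff pairing_simps algebra_simps)
qed

end

subsection \<open>Left-normed brackets\<close>

text \<open>Meant for nonempty words; \<open>hd []\<close> makes the value at the empty word
  arbitrary.\<close>

definition bracket :: "('v \<Rightarrow> 'x alg_term) \<Rightarrow> 'v list \<Rightarrow> 'x alg_term" where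
  "bracket x w = foldl (\<lambda>s v. Mult s (x v)) (x (hd w)) (tl w)"

lemma bracket_simps:
  "bracket x [v] = x v" "bracket x (v # w) = foldl (\<lambda>s v. Mult s (x v)) (x v) w"
  "w \<noteq> [] \<Longrightarrow> bracket x (w @ [v]) = Mult (bracket x w) (x v)"
  by (auto simp: bracket_def)

lemma foldl_Mult_cong:
  "alg_class R s = alg_class R t \<Longrightarrow>
    alg_class R (foldl (\<lambda>s v. Mult s (x v)) s w) = alg_class R (foldl (\<lambda>s v. Mult s (x v)) t w)"
proof (induction w arbitrary: s t)
  case (Cons v w)
  then show ?case unfolding foldl_Cons by (intro Cons.IH alg_class_cong(2)[OF _ HOL.refl])
qed simp

lemma foldl_Mult_Zero: "alg_class R (foldl (\<lambda>s v. Mult s (x v)) Zero w) = alg_class R Zero"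
proof (induction w)
  case (Cons v w)
  have "alg_class R (foldl (\<lambda>s v. Mult s (x v)) Zero (v # w)) = alg_class R (foldl (\<lambda>s v. Mult s (x v)) Zero w)"
    unfolding foldl_Cons by (rule foldl_Mult_cong[OF alg_mult_laws(5)])
  then show ?case using Cons by simp
qed simp

text \<open>\<open>[[z, u], v]\<close> and \<open>[[z, v], u]\<close> differ by
  \<open>[z, [u, v]]\<close>, which vanishes for commuting letters. The starting term
  \<open>y\<close> stays first; only the tail is rearranged.\<close>

lemma foldl_comm_eq:
  assumes R: "lie_laws \<subseteq> R" and comm: "\<And>u v. u \<noteq> v \<Longrightarrow> \<not> E u v \<Longrightarrow> alg_class R (Mult (x u) (x v)) = alg_class R Zero"
    and "comm_eq E w w'"
  shows "alg_class R (foldl (\<lambda>s v. Mult s (x v)) y w) = alg_class R (foldl (\<lambda>s v. Mult s (x v)) y w')"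
  using assms(3)
proof induction
  case (comm_swap u v a b w)
  let ?z = "foldl (\<lambda>s v. Mult s (x v)) y a"
  have "alg_class R (Mult (Mult ?z (x u)) (x v)) =
      alg_class R (Add (Mult (Mult ?z (x v)) (x u)) (Mult ?z (Mult (x u) (x v))))"
    by (rule lie_swap[OF R])
  also have "\<dots> = alg_class R (Add (Mult (Mult ?z (x v)) (x u)) (Mult ?z Zero))"
    by (intro alg_class_cong(1) alg_class_cong(2) comm comm_swap.hyps HOL.refl)
  also have "\<dots> = alg_class R (Add (Mult (Mult ?z (x v)) (x u)) Zero)"
    by (intro alg_class_cong(1) alg_mult_laws HOL.refl)
  also have "\<dots> = alg_class R (Mult (Mult ?z (x v)) (x u))" by (rule alg_add_laws)
  finally have "alg_class R (foldl (\<lambda>s v. Mult s (x v)) y (a @ u # v # b)) =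
      alg_class R (foldl (\<lambda>s v. Mult s (x v)) y (a @ v # u # b))"
    unfolding foldl_append foldl_Cons by (rule foldl_Mult_cong)
  then show ?case using comm_swap.IH by simp
qed simp

text \<open>By Jacobi \<open>[y, [b, v]] = [[y, b], v] - [[y, v], b]\<close>, and both summands are
  covered by the induction with \<open>y\<close> arbitrary. Letters are only permuted, hence the
  multisets.\<close>

lemma Mult_bracket:
  assumes R: "lie_laws \<subseteq> R" and "a \<noteq> []"
  shows "Mult y (bracket x a) \<in> tspan R {foldl (\<lambda>s v. Mult s (x v)) y w | w. mset w = mset a}"
  using assms(2)
proof (induction a arbitrary: y rule: rev_nonempty_induct)
  case (single v)
  have "Mult y (bracket x [v]) = foldl (\<lambda>s v. Mult s (x v)) y [v]" by (simp add: bracket_simps)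
  then show ?case by (intro tspan_base) blast
next
  case (snoc v a)
  let ?S = "{foldl (\<lambda>s v. Mult s (x v)) y w | w. mset w = mset (a @ [v])}"
  have "Mult (Mult y (bracket x a)) (x v) \<in> tspan R ?S"
  proof (rule tspan_Mult[OF snoc.IH tspan_base[of "x v" "{x v}"]])
    fix s t assume "s \<in> {foldl (\<lambda>s v. Mult s (x v)) y w | w. mset w = mset a}" "t \<in> {x v}"
    then obtain w where "mset w = mset a" "Mult s t = foldl (\<lambda>s v. Mult s (x v)) y (w @ [v])" by auto
    then show "Mult s t \<in> tspan R ?S" by (intro tspan_base CollectI exI[of _ "w @ [v]"]) simp
  qed simp
  moreover have "Mult (Mult y (x v)) (bracket x a) \<in> tspan R ?S"
  proof (rule tspan_mono[OF snoc.IH], rule subsetI)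
    fix s assume "s \<in> {foldl (\<lambda>s v. Mult s (x v)) (Mult y (x v)) w | w. mset w = mset a}"
    then obtain w where "mset w = mset a" "s = foldl (\<lambda>s v. Mult s (x v)) y (v # w)" by auto
    then show "s \<in> ?S" by (intro CollectI exI[of _ "v # w"]) simp
  qed
  ultimately show ?case
    unfolding bracket_simps(3)[OF snoc.hyps]
    by - (rule tspan_eq[OF lie_right[OF R]], (rule tspan_Add tspan_Scale | assumption)+)
qed

text \<open>Cut \<open>w\<close> at an occurrence of \<open>r\<close>. The initial bracket ending in
  \<open>r\<close> is, up to sign, the bracket of \<open>r\<close> with the letters before it, which
  expands into left-normed brackets starting with \<open>r\<close>; the remaining letters are then
  appended.\<close>

lemma bracket_rooted:
  assumes R: "lie_laws \<subseteq> R" and "r \<in> set w"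
  shows "bracket x w \<in> tspan R {bracket x (r # u) | u. mset (r # u) = mset w}"
proof -
  obtain a b where w: "w = a @ r # b" using assms(2) by (meson split_list)
  let ?f = "foldl (\<lambda>s v. Mult s (x v))"
  have ar: "bracket x (a @ [r]) \<in> tspan R {bracket x (r # u) | u. mset u = mset a}"
  proof (cases "a = []")
    case True
    then show ?thesis by (intro tspan_base) auto
  next
    case False
    have "Mult (x r) (bracket x a) \<in> tspan R {bracket x (r # u) | u. mset u = mset a}"
      using Mult_bracket[OF R False, of "x r" x] by (simp add: bracket_simps(2))
    then show ?thesis
      unfolding bracket_simps(3)[OF False] by - (rule tspan_eq[OF lie_anti[OF R]], rule tspan_Scale)
  qed
  have ext: "?f s b \<in> tspan R {bracket x (r # u @ b) | u. mset u = mset a}"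
    if "s \<in> tspan R {bracket x (r # u) | u. mset u = mset a}" for s
    using that
  proof (induction b arbitrary: s rule: rev_induct)
    case Nil
    then show ?case by simp
  next
    case (snoc v b)
    have "Mult (?f s b) (x v) \<in> tspan R {bracket x (r # u @ b @ [v]) | u. mset u = mset a}"
    proof (rule tspan_Mult[OF snoc.IH[OF snoc.prems] tspan_base[of "x v" "{x v}"]])
      fix p t assume "p \<in> {bracket x (r # u @ b) | u. mset u = mset a}" "t \<in> {x v}"
      then obtain u where "mset u = mset a" "Mult p t = bracket x (r # u @ b @ [v])"
        by (auto simp: bracket_simps(2))
      then show "Mult p t \<in> tspan R {bracket x (r # u @ b @ [v]) | u. mset u = mset a}"
        by (intro tspan_base) blast
    qed simp
    then show ?case by simp
  qed
  have "bracket x w = ?f (bracket x (a @ [r])) b" unfolding w by (cases a) (simp_all add: bracket_def)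
  then have "bracket x w \<in> tspan R {bracket x (r # u @ b) | u. mset u = mset a}" using ext[OF ar] by simp
  then show ?thesis
  proof (rule tspan_mono, intro subsetI)
    fix s assume "s \<in> {bracket x (r # u @ b) | u. mset u = mset a}"
    then obtain u where u: "mset u = mset a" "s = bracket x (r # (u @ b))" by blast
    then have "mset (r # u @ b) = mset w" by (simp add: w)
    with u(2) show "s \<in> {bracket x (r # u) | u. mset (r # u) = mset w}" by blast
  qed
qed

text \<open>Distinct indices may name the same term, so one index per term is selected before
  weights are compared.\<close>

lemma (in term_action) weight_component_family:
  assumes t: "t \<in> tspan R (b ` I)" and b: "\<And>i. i \<in> I \<Longrightarrow> has_weight (m i) (b i)" and w: "has_weight \<mu> t"
  shows "t \<in> tspan R (b ` {i \<in> I. m i = \<mu>})"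
proof -
  define ix where "ix = inv_into I b"
  have ix: "ix a \<in> I" "b (ix a) = a" if "a \<in> b ` I" for a
    using inv_into_into[OF that] f_inv_into_f[OF that] by (simp_all add: ix_def)
  have "t \<in> tspan R {a \<in> b ` I. m (ix a) = \<mu>}"
  proof (rule weight_component[OF t _ w])
    fix a assume "a \<in> b ` I"
    from ix[OF this] b[of "ix a"] show "has_weight (m (ix a)) a" by simp
  qed
  then show ?thesis
  proof (rule tspan_mono, intro subsetI)
    fix a assume "a \<in> {a \<in> b ` I. m (ix a) = \<mu>}"
    then show "a \<in> b ` {i \<in> I. m i = \<mu>}" using ix[of a] by (intro image_eqI[of _ _ "ix a"]) auto
  qed
qed

context simply_laced
begin

abbreviation "cls \<equiv> alg_class rels"
abbreviation hg :: "complex^'d \<Rightarrow> ('d, 'v) km_gen alg_term" where "hg h \<equiv> Gen (Hgen h)"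
abbreviation eg :: "'v \<Rightarrow> ('d, 'v) km_gen alg_term" where "eg i \<equiv> Gen (Egen i)"
abbreviation fg :: "'v \<Rightarrow> ('d, 'v) km_gen alg_term" where "fg i \<equiv> Gen (Fgen i)"

lemma lie_rels: "lie_laws \<subseteq> rels" by simp

lemma km_rel: "(s, t) \<in> km_relations B \<alpha> \<alpha>v \<Longrightarrow> cls s = cls t"
  unfolding alg_class_eq_iff by (rule alg_cong.rel) simp

lemma cls_ee: "i \<noteq> j \<Longrightarrow> \<not> E i j \<Longrightarrow> cls (Mult (eg i) (eg j)) = cls Zero"
  using km_rel[OF km_relations.serre_e[of i j B \<alpha> \<alpha>v]] by (simp add: cartan_entry)

sublocale hact: term_action rels "\<lambda>h t. Mult (hg h) t"
  by unfold_locales (rule alg_mult_laws alg_class_cong(2)[OF HOL.refl] | assumption)+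

lemma weight_Mult:
  assumes "hact.has_weight \<mu> s" "hact.has_weight \<nu> t"
  shows "hact.has_weight (\<lambda>h. \<mu> h + \<nu> h) (Mult s t)"
  unfolding hact.has_weight_def
proof
  fix h
  have "cls (Mult (hg h) (Mult s t)) = cls (Add (Mult (Mult (hg h) s) t) (Mult s (Mult (hg h) t)))"
    by (rule lie_left[OF lie_rels])
  also have "\<dots> = cls (Add (Mult (Scale (\<mu> h) s) t) (Mult s (Scale (\<nu> h) t)))"
    using assms unfolding hact.has_weight_def by (intro alg_class_cong(1) alg_class_cong(2)) auto
  also have "\<dots> = cls (Add (Scale (\<mu> h) (Mult s t)) (Scale (\<nu> h) (Mult s t)))"
    by (intro alg_class_cong(1) alg_mult_laws)
  finally show "cls (Mult (hg h) (Mult s t)) = cls (Scale (\<mu> h + \<nu> h) (Mult s t))"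
    by (simp only: alg_scale_laws(1))
qed

text \<open>The constant \<open>c\<close> is 1 for the \<open>e\<close> and -1 for the
  \<open>f\<close>.\<close>

lemma weight_bracket:
  assumes "\<And>v. hact.has_weight (\<lambda>h. c * pairing (\<alpha> v) h) (x v)" "w \<noteq> []"
  shows "hact.has_weight (\<lambda>h. c * pairing (wt w) h) (bracket x w)"
  using assms(2)
proof (induction w rule: rev_nonempty_induct)
  case (single v)
  then show ?case using assms(1)[of v] by (simp add: bracket_simps)
next
  case (snoc v w)
  then show ?case
    using weight_Mult[OF snoc.IH assms(1)[of v]]
    by (simp add: bracket_simps(3) pairing_simps algebra_simps)
qed

lemma weight_e: "hact.has_weight (\<lambda>h. 1 * pairing (\<alpha> v) h) (eg v)"
  unfolding hact.has_weight_def using km_rel[OF km_relations.H_e] by simp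

lemma weight_f: "hact.has_weight (\<lambda>h. - 1 * pairing (\<alpha> v) h) (fg v)"
  unfolding hact.has_weight_def using km_rel[OF km_relations.H_f] by simp

lemma weight_h: "hact.has_weight (\<lambda>h. 0) (hg h')"
  unfolding hact.has_weight_def using km_rel[OF km_relations.H_H] by (simp add: alg_scale_laws)

abbreviation "Hset \<equiv> range hg"

lemma weight_right: "hact.has_weight \<mu> t \<Longrightarrow> t \<in> tspan rels A \<Longrightarrow> Mult t (hg h) \<in> tspan rels A"
proof (rule tspan_eq[OF lie_anti[OF lie_rels]], rule tspan_Scale)
  assume *: "hact.has_weight \<mu> t" "t \<in> tspan rels A"
  have "cls (Mult (hg h) t) = cls (Scale (\<mu> h) t)" using *(1) by (simp add: hact.has_weight_def)
  then show "Mult (hg h) t \<in> tspan rels A" by (rule tspan_eq) (rule tspan_Scale[OF *(2)])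
qed

text \<open>The step of the triangular decomposition, stated so that the roles of \<open>e\<close> and \<open>f\<close> can be exchanged.\<close>

lemma bracket_opposite:
  assumes xy: "\<And>i j. Mult (x i) (y j) \<in> tspan rels Hset"
    and wx: "\<And>v. hact.has_weight (\<lambda>h. c * pairing (\<alpha> v) h) (x v)" and "w \<noteq> []"
  shows "Mult (bracket x w) (y j) \<in> tspan rels (Hset \<union> bracket x ` {w. w \<noteq> []})"
  using \<open>w \<noteq> []\<close>
proof (induction w rule: rev_nonempty_induct)
  case (single v)
  then show ?case using tspan_mono[OF xy[of v j]] by (simp add: bracket_simps)
next
  case (snoc v w)
  let ?T = "tspan rels (Hset \<union> bracket x ` {w. w \<noteq> []})" and ?b = "bracket x w"
  have "Mult (Mult ?b (y j)) (x v) \<in> ?T"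
  proof (rule tspan_Mult[OF snoc.IH tspan_base[of "x v" "{x v}"]])
    fix a t assume "a \<in> Hset \<union> bracket x ` {w. w \<noteq> []}" "t \<in> {x v}"
    then consider h where "a = hg h" "t = x v" | u where "u \<noteq> []" "a = bracket x u" "t = x v" by auto
    then show "Mult a t \<in> ?T"
    proof cases
      case 1
      have "cls (Mult a t) = cls (Scale (c * pairing (\<alpha> v) h) (bracket x [v]))"
        using wx[of v] 1 unfolding hact.has_weight_def bracket_simps(1) by blast
      then show ?thesis by (rule tspan_eq) (intro tspan_Scale tspan_base, blast)
    next
      case 2
      then have "Mult a t = bracket x (u @ [v])" by (simp add: bracket_simps(3))
      then show ?thesis by (intro tspan_base) blast
    qed
  qed simp
  \<comment> \<open>The inner bracket lies in the span of the Cartan generators, and bracketing with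
    these only rescales \<open>?b\<close>.\<close>
  moreover have "Mult ?b (Mult (x v) (y j)) \<in> ?T"
  proof (rule tspan_Mult[OF tspan_base[of ?b "{?b}"] xy[of v j]])
    fix a t assume "a \<in> {?b}" "t \<in> Hset"
    moreover have "?b \<in> ?T" using snoc.hyps by (intro tspan_base) blast
    ultimately show "Mult a t \<in> ?T" using weight_right[OF weight_bracket[OF wx snoc.hyps]] by blast
  qed simp
  ultimately show ?case
    unfolding bracket_simps(3)[OF snoc.hyps] by - (rule tspan_eq[OF lie_swap[OF lie_rels]], (rule tspan_Add | assumption)+)
qed

section \<open>Triangular decomposition\<close>

abbreviation "Tri \<equiv> Hset \<union> bracket eg ` {w. w \<noteq> []} \<union> bracket fg ` {w. w \<noteq> []}"

lemma e_f_H: "Mult (eg i) (fg j) \<in> tspan rels Hset"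
proof (cases "i = j")
  case True
  then have "cls (Mult (eg i) (fg j)) = cls (hg (\<alpha>v i))" using km_rel[OF km_relations.e_f] by simp
  then show ?thesis by (rule tspan_eq) (intro tspan_base, blast)
next
  case False
  then have "cls (Mult (eg i) (fg j)) = cls Zero" by (intro km_rel km_relations.e_f_neq)
  then show ?thesis by (rule tspan_eq) (rule tspan_Zero)
qed

lemma f_e_H: "Mult (fg i) (eg j) \<in> tspan rels Hset"
  by (rule tspan_eq[OF lie_anti[OF lie_rels]]) (rule tspan_Scale[OF e_f_H])

lemma Tri_cases:
  assumes "a \<in> Tri"
  obtains h where "a = hg h" | w where "w \<noteq> []" "a = bracket eg w" | w where "w \<noteq> []" "a = bracket fg w"
  using assms by blast

lemma Tri_weight: assumes "a \<in> Tri" shows "\<exists>\<mu>. hact.has_weight \<mu> a"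
  using assms by (cases rule: Tri_cases) (use weight_h weight_bracket[OF weight_e] weight_bracket[OF weight_f] in blast)+

text \<open>A span that contains the generators and absorbs brackets with them exhausts the algebra;
  this is the absorbing half.\<close>

lemma Tri_Mult_gen:
  assumes "t \<in> tspan rels Tri" shows "Mult t (Gen g) \<in> tspan rels Tri"
proof (rule tspan_Mult[OF assms tspan_base[of "Gen g" "{Gen g}"]])
  fix a s assume a: "a \<in> Tri" and "s \<in> {Gen g}"
  then have s: "s = Gen g" by simp
  have gen: "Mult (hg h) (Gen g) \<in> tspan rels Tri" for h
  proof (cases g)
    case (Hgen h')
    have "cls (Mult (hg h) (hg h')) = cls Zero" by (rule km_rel) (rule km_relations.H_H)
    then show ?thesis unfolding Hgen by (rule tspan_eq) (rule tspan_Zero)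
  next
    case (Egen v)
    have "cls (Mult (hg h) (eg v)) = cls (Scale (pairing (\<alpha> v) h) (bracket eg [v]))"
      unfolding bracket_simps(1) by (rule km_rel) (rule km_relations.H_e)
    then show ?thesis unfolding Egen by (rule tspan_eq) (intro tspan_Scale tspan_base, blast)
  next
    case (Fgen v)
    have "cls (Mult (hg h) (fg v)) = cls (Scale (- pairing (\<alpha> v) h) (bracket fg [v]))"
      unfolding bracket_simps(1) by (rule km_rel) (rule km_relations.H_f)
    then show ?thesis unfolding Fgen by (rule tspan_eq) (intro tspan_Scale tspan_base, blast)
  qed
  have "Mult a (Gen g) \<in> tspan rels Tri"
    using a
  proof (cases rule: Tri_cases)
    case (1 h)
    then show ?thesis using gen by simp
  next
    case (2 w)
    show ?thesis
    proof (cases g)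
      case (Hgen h)
      obtain \<mu> where "hact.has_weight \<mu> a" using Tri_weight[OF a] by blast
      from weight_right[OF this tspan_base[OF a]] show ?thesis unfolding Hgen .
    next
      case (Egen v)
      have "Mult a (eg v) = bracket eg (w @ [v])" using 2 by (simp add: bracket_simps(3))
      then show ?thesis unfolding Egen by (intro tspan_base) blast
    next
      case (Fgen v)
      have "Mult a (fg v) \<in> tspan rels (Hset \<union> bracket eg ` {w. w \<noteq> []})"
        unfolding 2(2) by (rule bracket_opposite[OF e_f_H weight_e 2(1)])
      then show ?thesis unfolding Fgen by (rule tspan_mono) blast
    qed
  next
    case (3 w)
    show ?thesis
    proof (cases g)
      case (Hgen h)
      obtain \<mu> where "hact.has_weight \<mu> a" using Tri_weight[OF a] by blast
      from weight_right[OF this tspan_base[OF a]] show ?thesis unfolding Hgen .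
    next
      case (Fgen v)
      have "Mult a (fg v) = bracket fg (w @ [v])" using 3 by (simp add: bracket_simps(3))
      then show ?thesis unfolding Fgen by (intro tspan_base) blast
    next
      case (Egen v)
      have "Mult a (eg v) \<in> tspan rels (Hset \<union> bracket fg ` {w. w \<noteq> []})"
        unfolding 3(2) by (rule bracket_opposite[OF f_e_H weight_f 3(1)])
      then show ?thesis unfolding Egen by (rule tspan_mono) blast
    qed
  qed
  then show "Mult a s \<in> tspan rels Tri" unfolding s .
qed simp

text \<open>Jacobi reduces bracketing with a compound term to successive bracketing with its
  factors, so the induction keeps \<open>u\<close> arbitrary.\<close>

lemma Tri_Mult: "u \<in> tspan rels Tri \<Longrightarrow> Mult u t \<in> tspan rels Tri"
proof (induction t arbitrary: u)
  case (Gen g)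
  then show ?case by (rule Tri_Mult_gen)
next
  case Zero
  show ?case by (rule tspan_eq[OF alg_mult_laws(6)]) (rule tspan_Zero)
next
  case (Add s t)
  show ?case
    by (rule tspan_eq[OF alg_mult_laws(2)]) (rule tspan_Add[OF Add.IH(1)[OF Add.prems] Add.IH(2)[OF Add.prems]])
next
  case (Scale c t)
  show ?case by (rule tspan_eq[OF alg_mult_laws(4)]) (rule tspan_Scale[OF Scale.IH[OF Scale.prems]])
next
  case (Mult s t)
  show ?case
    by (rule tspan_eq[OF lie_right[OF lie_rels]])
      (intro tspan_Add tspan_Scale Mult.IH(2)[OF Mult.IH(1)[OF Mult.prems]] Mult.IH(1)[OF Mult.IH(2)[OF Mult.prems]])
qed

lemma Tri_all: "t \<in> tspan rels Tri"
proof (induction t)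
  case (Gen g)
  show ?case
  proof (cases g)
    case (Egen v)
    then have "Gen g = bracket eg [v]" by (simp add: bracket_simps)
    then show ?thesis by (intro tspan_base) blast
  next
    case (Fgen v)
    then have "Gen g = bracket fg [v]" by (simp add: bracket_simps)
    then show ?thesis by (intro tspan_base) blast
  qed (intro tspan_base, blast)
next
  case (Mult s t)
  then show ?case by (intro Tri_Mult)
qed (rule tspan_Zero tspan_Add tspan_Scale; assumption)+

subsection \<open>Weights of positive roots\<close>

lemma wt_count: "wt w = root_lattice_vec \<alpha> (count_list w)"
proof (induction w)
  case (Cons v w)
  have "root_lattice_vec \<alpha> (count_list (v # w)) = (\<Sum>i\<in>UNIV. of_nat (count_list w i) *s \<alpha> i + (if i = v then \<alpha> v else 0))"
    unfolding root_lattice_vec_def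
    by (rule sum.cong) (auto simp: Finite_Cartesian_Product.vec_eq_iff algebra_simps)
  then show ?case using Cons by (simp add: sum.distrib root_lattice_vec_def add.commute)
qed (simp add: root_lattice_vec_def)

lemma lattice_coeffs:
  assumes "(\<Sum>i\<in>UNIV. c i *s \<alpha> i) = 0" shows "c i = 0"
  by (rule indep_coeffs[OF inj_root indep_root assms])

lemma root_lattice_vec_inj:
  assumes "root_lattice_vec \<alpha> c = root_lattice_vec \<alpha> d" shows "c = d"
proof
  fix i
  have "(\<Sum>i\<in>UNIV. (of_nat (c i) - of_nat (d i)) *s \<alpha> i) = root_lattice_vec \<alpha> c - root_lattice_vec \<alpha> d"
    unfolding root_lattice_vec_def sum_subtractf[symmetric] by (simp only: vector_sub_rdistrib)
  then have "(of_nat (c i) - of_nat (d i) :: complex) = 0" using assms by (intro lattice_coeffs) simp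
  then show "c i = d i" by simp
qed

lemma root_lattice_vec_neg:
  assumes "root_lattice_vec \<alpha> c = - root_lattice_vec \<alpha> d" shows "c i = 0"
proof -
  have "(\<Sum>i\<in>UNIV. of_nat (c i + d i) *s \<alpha> i) = root_lattice_vec \<alpha> c + root_lattice_vec \<alpha> d"
    unfolding root_lattice_vec_def sum.distrib[symmetric] of_nat_add by (simp only: vector_sadd_rdistrib)
  then have "(of_nat (c i + d i) :: complex) = 0" using assms by (intro lattice_coeffs) simp
  then show ?thesis by (simp only: of_nat_eq_0_iff)
qed

lemma pairing_eqD:
  fixes \<mu> \<nu> :: "complex^'d"
  assumes "\<And>h. pairing \<mu> h = pairing \<nu> h" shows "\<mu> = \<nu>"
proof -
  have "\<mu> $ k = \<nu> $ k" for k
  proof -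
    have "pairing x (axis k 1) = x $ k" for x :: "complex^'d"
    proof -
      have "pairing x (axis k 1) = (\<Sum>j\<in>UNIV. if j = k then x $ k else 0)"
        unfolding pairing_def by (rule sum.cong) (auto simp: axis_def)
      then show ?thesis by simp
    qed
    then show ?thesis using assms[of "axis k 1"] by simp
  qed
  then show ?thesis by (simp add: Finite_Cartesian_Product.vec_eq_iff)
qed

text \<open>In the triangular decomposition the Cartan part has weight 0 and the
  \<open>f\<close>-brackets have weights in the negative cone; independence of the roots keeps both
  apart from a nonzero positive weight.\<close>

lemma positive_weight:
  assumes "hact.has_weight (pairing (root_lattice_vec \<alpha> c)) t" "c \<noteq> (\<lambda>_. 0)"
  shows "t \<in> tspan rels (bracket eg ` {w. count_list w = c})"
proof -
  \<comment> \<open>A tagged index set, so that the weight of each spanning term can be read off its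
    tag and word.\<close>
  let ?I = "range Inl \<union> Inr ` (Inl ` {w. w \<noteq> []} \<union> Inr ` {w. w \<noteq> []}) :: (complex^'d + ('v list + 'v list)) set"
  let ?b = "case_sum hg (case_sum (bracket eg) (bracket fg))"
  define m :: "complex^'d + ('v list + 'v list) \<Rightarrow> complex^'d \<Rightarrow> complex" where
    "m = case_sum (\<lambda>h h'. 0) (case_sum (\<lambda>w h. 1 * pairing (wt w) h) (\<lambda>w h. - 1 * pairing (wt w) h))"
  have "Tri = ?b ` ?I" by (auto simp: image_Un image_image)
  then have "t \<in> tspan rels (?b ` ?I)" using Tri_all by simp
  moreover have "hact.has_weight (m i) (?b i)" if "i \<in> ?I" for i
    using that weight_h weight_bracket[OF weight_e] weight_bracket[OF weight_f] by (auto simp: m_def)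
  ultimately have "t \<in> tspan rels (?b ` {i \<in> ?I. m i = pairing (root_lattice_vec \<alpha> c)})"
    using assms(1) by (intro hact.weight_component_family)
  then show ?thesis
  proof (rule tspan_mono, intro subsetI)
    fix a assume "a \<in> ?b ` {i \<in> ?I. m i = pairing (root_lattice_vec \<alpha> c)}"
    then obtain i where ai: "a = ?b i" "i \<in> {i \<in> ?I. m i = pairing (root_lattice_vec \<alpha> c)}" by (rule imageE)
    then have i: "i \<in> ?I" "m i = pairing (root_lattice_vec \<alpha> c)" by simp_all
    obtain k where k: "c k \<noteq> 0" using assms(2) by (auto simp: fun_eq_iff)
    from i(1) consider h where "i = Inl h" | w where "i = Inr (Inl w)" | w where "i = Inr (Inr w)" by auto
    then show "a \<in> bracket eg ` {w. count_list w = c}"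
    proof cases
      case 1
      have "root_lattice_vec \<alpha> c = - root_lattice_vec \<alpha> (\<lambda>_. 0)"
        by (rule pairing_eqD) (use i(2) 1 in \<open>simp add: m_def fun_eq_iff root_lattice_vec_def pairing_simps\<close>)
      then have "c k = 0" by (rule root_lattice_vec_neg)
      then show ?thesis using k by simp
    next
      case 2
      have "root_lattice_vec \<alpha> c = root_lattice_vec \<alpha> (count_list w)"
        by (rule pairing_eqD) (use i(2) 2 in \<open>simp add: m_def fun_eq_iff wt_count\<close>)
      then have "count_list w = c" using root_lattice_vec_inj by metis
      then show ?thesis using ai(1) 2 by auto
    next
      case 3
      have "root_lattice_vec \<alpha> c = - root_lattice_vec \<alpha> (count_list w)"
        by (rule pairing_eqD) (use i(2) 3 in \<open>simp add: m_def fun_eq_iff wt_count pairing_simps\<close>)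
      then have "c k = 0" by (rule root_lattice_vec_neg)
      then show ?thesis using k by simp
    qed
  qed
qed

section \<open>Positive root spaces as spans of brackets\<close>

lemma bracket_weight:
  assumes "w \<noteq> []"
  shows "hact.has_weight (pairing (root_lattice_vec \<alpha> (count_list w))) (bracket eg w)"
  using weight_bracket[OF weight_e assms] by (simp add: wt_count)

lemma kac_moody_eq: "kac_moody B \<alpha> \<alpha>v = presented_algebra UNIV rels"
  by (simp add: kac_moody_def presented_lie_algebra_def)

lemma ad_h_cls: "ad_h B \<alpha> \<alpha>v h (cls t) = cls (Mult (hg h) t)"
  by (simp add: ad_h_def kac_moody_eq alg_class_simps)

lemma root_space_mem:
  "cls t \<in> carrier (root_space B \<alpha> \<alpha>v \<mu>) \<longleftrightarrow> hact.has_weight (pairing \<mu>) t"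
  by (simp add: root_space_def weight_space_def ad_h_cls hact.has_weight_def kac_moody_eq alg_class_simps)

lemma count_nonzero: "count_list w = c \<Longrightarrow> c \<noteq> (\<lambda>_. 0) \<Longrightarrow> w \<noteq> []"
  by auto

lemma carrier_root_space:
  assumes "c \<noteq> (\<lambda>_. 0)"
  shows "carrier (root_space B \<alpha> \<alpha>v (root_lattice_vec \<alpha> c)) = cls ` tspan rels (bracket eg ` {w. count_list w = c})"
proof (intro equalityI subsetI)
  fix x assume x: "x \<in> carrier (root_space B \<alpha> \<alpha>v (root_lattice_vec \<alpha> c))"
  then have "x \<in> carrier (presented_algebra UNIV rels)"
    by (simp add: root_space_def weight_space_def kac_moody_eq)
  then obtain t where t: "x = cls t" by (rule presented_algebra_cases)
  then have "t \<in> tspan rels (bracket eg ` {w. count_list w = c})"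
    using positive_weight[OF _ assms] x root_space_mem by blast
  then show "x \<in> cls ` tspan rels (bracket eg ` {w. count_list w = c})" using t by blast
next
  fix x assume "x \<in> cls ` tspan rels (bracket eg ` {w. count_list w = c})"
  then obtain t where t: "x = cls t" "t \<in> tspan rels (bracket eg ` {w. count_list w = c})" by blast
  have "hact.has_weight (pairing (root_lattice_vec \<alpha> c)) t"
    by (rule hact.has_weight_tspan[OF t(2)]) (use bracket_weight count_nonzero[OF _ assms] in auto)
  then show "x \<in> carrier (root_space B \<alpha> \<alpha>v (root_lattice_vec \<alpha> c))" using t(1) root_space_mem by blast
qed

subsection \<open>Multilinear root spaces\<close>

definition ind :: "'v set \<Rightarrow> 'v \<Rightarrow> nat" where
  "ind S i = (if i \<in> S then 1 else 0)"

lemma count_list_ind: "count_list w = ind S \<longleftrightarrow> distinct w \<and> set w = S"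
proof
  assume c: "count_list w = ind S"
  have "set w = S"
  proof (rule Set.set_eqI)
    fix i
    have "i \<in> set w \<longleftrightarrow> count_list w i \<noteq> 0" by (simp add: count_list_0_iff)
    then show "i \<in> set w \<longleftrightarrow> i \<in> S" by (simp add: c ind_def)
  qed
  moreover have "distinct w"
  proof (rule ccontr)
    assume "\<not> distinct w"
    then obtain a b d x where "w = a @ [x] @ b @ [x] @ d" using not_distinct_decomp by blast
    then have "count_list w x \<ge> 2" by (simp)
    then show False by (simp add: c ind_def split: if_splits)
  qed
  ultimately show "distinct w \<and> set w = S" by simp
next
  assume w: "distinct w \<and> set w = S"
  have "distinct w \<Longrightarrow> count_list w = ind (set w)"
    by (induction w) (auto simp: fun_eq_iff ind_def)
  then show "count_list w = ind S" using w by simp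
qed

definition rooted_rep :: "'v set \<Rightarrow> 'v \<Rightarrow> ('v \<times> 'v) set \<Rightarrow> 'v list" where
  "rooted_rep S r D = (SOME w. distinct (r # w) \<and> set (r # w) = S \<and> orient E (r # w) = D)"

lemma rooted_rep:
  assumes "D \<in> rooted_orientations E S r" "r \<in> S"
  shows "distinct (r # rooted_rep S r D)" "set (r # rooted_rep S r D) = S" "orient E (r # rooted_rep S r D) = D"
proof -
  have "\<exists>w. distinct (r # w) \<and> set (r # w) = S \<and> orient E (r # w) = D"
    using rooted_word[OF assms] by blast
  from someI_ex[OF this] show "distinct (r # rooted_rep S r D)" "set (r # rooted_rep S r D) = S"
    "orient E (r # rooted_rep S r D) = D" unfolding rooted_rep_def by blast+
qed

lemma orient_tl:
  assumes "distinct (r # w)" "distinct (r # w')" "orient E (r # w) = orient E (r # w')"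
  shows "orient E w = orient E w'"
proof -
  have "orient E u = {p \<in> orient E (r # u). fst p \<noteq> r}" if "distinct (r # u)" for u
  proof -
    have "fst p \<noteq> r" if "p \<in> orient E u" for p
      using that orient_edge[of "fst p" "snd p" E u] \<open>distinct (r # u)\<close> by auto
    then show ?thesis by auto
  qed
  then show ?thesis using assms by metis
qed

text \<open>If some \<open>s\<close> other than \<open>r\<close> is also a source, it is not
  adjacent to \<open>r\<close> and can be moved directly behind it; the bracket then begins with
  \<open>[r, s] = 0\<close>. Otherwise the tail commutes into the word chosen for its
  orientation.\<close>

lemma bracket_rooted_span:
  assumes "distinct (r # w)"
  shows "bracket eg (r # w) \<in>
    tspan rels ((\<lambda>D. bracket eg (r # rooted_rep (set (r # w)) r D)) ` rooted_orientations E (set (r # w)) r)"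
proof -
  let ?S = "set (r # w)" and ?D = "orient E (r # w)"
  have D: "?D \<in> orientations_on E ?S" by (rule orient_mem[OF assms])
  show ?thesis
  proof (cases "?D \<in> rooted_orientations E ?S r")
    case True
    have rep: "distinct (r # rooted_rep ?S r ?D)" "set (r # rooted_rep ?S r ?D) = ?S"
      "orient E (r # rooted_rep ?S r ?D) = ?D"
      by (rule rooted_rep[OF True]; simp)+
    have "comm_eq E w (rooted_rep ?S r ?D)"
    proof (rule comm_eq_orient)
      show "set w = set (rooted_rep ?S r ?D)" using rep(1,2) assms by auto
      show "orient E w = orient E (rooted_rep ?S r ?D)" by (rule orient_tl[OF assms rep(1) rep(3)[symmetric]])
    qed (use assms rep(1) in auto)
    then have "cls (bracket eg (r # w)) = cls (bracket eg (r # rooted_rep ?S r ?D))"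
      unfolding bracket_simps by (intro foldl_comm_eq[OF lie_rels] cls_ee)
    then show ?thesis by (rule tspan_eq) (intro tspan_base imageI True)
  next
    case False
    then obtain s where s: "s \<in> ?S" "s \<noteq> r" "\<And>u. (u, s) \<notin> ?D"
      using D unfolding rooted_orientations_def by blast
    have "s \<in> set w" using s by simp
    have "orient E w \<in> orientations_on E (set w)" using assms by (intro orient_mem) simp
    moreover have "(u, s) \<notin> orient E w" for u using s(3)[of u] by auto
    ultimately obtain w' where w': "distinct (s # w')" "set (s # w') = set w" "orient E (s # w') = orient E w"
      using orientation_word_source[OF _ \<open>s \<in> set w\<close>] by blast
    have "\<not> E r s" using s(3)[of r] \<open>s \<in> set w\<close> by auto
    have "comm_eq E w (s # w')" using assms w' by (intro comm_eq_orient) auto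
    then have "cls (bracket eg (r # w)) = cls (bracket eg (r # s # w'))"
      unfolding bracket_simps by (intro foldl_comm_eq[OF lie_rels] cls_ee)
    also have "\<dots> = cls (foldl (\<lambda>s v. Mult s (eg v)) Zero w')"
      unfolding bracket_simps foldl_Cons
      by (rule foldl_Mult_cong) (rule cls_ee[OF s(2)[symmetric] \<open>\<not> E r s\<close>])
    also have "\<dots> = cls Zero" by (rule foldl_Mult_Zero)
    finally show ?thesis by (rule tspan_eq) (rule tspan_Zero)
  qed
qed

definition word_indicator :: "'v set \<Rightarrow> ('v \<times> 'v) set \<Rightarrow> 'v list \<Rightarrow> complex" where
  "word_indicator S D w = (if distinct w \<and> set w = S \<and> orient E w = D then 1 else 0)"

text \<open>Constancy on orientations handles the commuting pairs; in the cubic condition every word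
  repeats a letter and gets the value 0.\<close>

lemma word_indicator_serre: "word_indicator S D \<in> serre_functions"
proof (rule serre_functionsI)
  fix a b i j assume "i \<noteq> j" "\<not> E i j"
  have "distinct (a @ i # j # b) = distinct (a @ j # i # b)" "set (a @ i # j # b) = set (a @ j # i # b)"
    by auto
  then show "word_indicator S D (a @ i # j # b) = word_indicator S D (a @ j # i # b)"
    unfolding word_indicator_def orient_swap[OF \<open>\<not> E i j\<close>] by simp
qed (simp add: word_indicator_def)

text \<open>Expanding a left-normed bracket, each later letter is multiplied on the left or on the
  right. When \<open>\<phi>\<close> sees only words starting with \<open>r\<close>, just the term
  with all letters on the right survives.\<close>

lemma evl_bracket:
  assumes "\<And>v u. v \<noteq> r \<Longrightarrow> \<phi> (v # u) = 0" "r \<notin> set w"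
  shows "evl (bracket eg (r # w)) \<phi> u = \<phi> (r # w @ u)"
  using assms(2)
proof (induction w arbitrary: u rule: rev_induct)
  case Nil
  show ?case by (simp add: bracket_simps)
next
  case (snoc v w)
  have "e_op v \<phi> = (\<lambda>_. 0)" using assms(1) snoc.prems by auto
  moreover have "evl (bracket eg (r # w)) (\<lambda>_. 0) = (\<lambda>_. 0)"
    by (rule op_linearD(3)[OF word_action.ev_linear[OF km_word_action]])
  moreover have "bracket eg (r # w @ [v]) = Mult (bracket eg (r # w)) (eg v)"
    using bracket_simps(3)[of "r # w" eg v] by simp
  ultimately show ?case using snoc by simp
qed

lemma term_functional_evl: "\<phi> \<in> serre_functions \<Longrightarrow> term_functional rels (\<lambda>t. evl t \<phi> w)"
  by (rule word_action.term_functional_ev[OF km_word_action evl_rels])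

lemma evl_rooted_rep:
  assumes "D \<in> rooted_orientations E S r" "D' \<in> rooted_orientations E S r" "r \<in> S"
  shows "evl (bracket eg (r # rooted_rep S r D')) (word_indicator S D) [] = (if D = D' then 1 else 0)"
proof -
  have "word_indicator S D (v # u) = 0" if "v \<noteq> r" for v u
  proof (rule ccontr)
    assume "word_indicator S D (v # u) \<noteq> 0"
    then have "distinct (v # u)" "set (v # u) = S" "orient E (v # u) = D"
      unfolding word_indicator_def by (metis (full_types))+
    then show False using rooted_hd[of "v # u" r] assms(1) that by simp
  qed
  moreover have "r \<notin> set (rooted_rep S r D')" using rooted_rep(1)[OF assms(2,3)] by simp
  ultimately have "evl (bracket eg (r # rooted_rep S r D')) (word_indicator S D) [] =
      word_indicator S D (r # rooted_rep S r D' @ [])"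
    by (intro evl_bracket)
  also have "\<dots> = (if D = D' then 1 else 0)"
    using rooted_rep[OF assms(2,3)] unfolding word_indicator_def append_Nil2 by auto
  finally show ?thesis .
qed

text \<open>The left side does not mention \<open>r\<close>, so the number of rooted orientations is
  the same for every \<open>r\<close> in \<open>S\<close>. It is zero if \<open>S\<close> induces a
  disconnected graph, in accordance with roots having connected support.\<close>

theorem root_mult_ind:
  assumes "r \<in> S"
  shows "root_mult B \<alpha> \<alpha>v (root_lattice_vec \<alpha> (ind S)) = card (rooted_orientations E S r)"
  unfolding root_mult_def
proof (rule dim_terms[where R = rels and b = "\<lambda>D. bracket eg (r # rooted_rep S r D)"
      and \<psi> = "\<lambda>D t. evl t (word_indicator S D) []"])
  let ?I = "rooted_orientations E S r" and ?b = "\<lambda>D. bracket eg (r # rooted_rep S r D)"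
  have nz: "ind S \<noteq> (\<lambda>_. 0)" using assms by (auto simp: ind_def fun_eq_iff)
  show "carrier (root_space B \<alpha> \<alpha>v (root_lattice_vec \<alpha> (ind S))) = cls ` tspan rels (?b ` ?I)"
    unfolding carrier_root_space[OF nz]
  proof (rule arg_cong[where f = "image cls"], intro equalityI subsetI)
    fix t assume "t \<in> tspan rels (bracket eg ` {w. count_list w = ind S})"
    then show "t \<in> tspan rels (?b ` ?I)"
    proof (rule tspan_sub, intro subsetI)
      fix a assume "a \<in> bracket eg ` {w. count_list w = ind S}"
      then obtain w where w: "distinct w" "set w = S" "a = bracket eg w" by (auto simp: count_list_ind)
      have "a \<in> tspan rels {bracket eg (r # u) | u. mset (r # u) = mset w}"
        unfolding w(3) by (rule bracket_rooted[OF lie_rels]) (use assms w in simp)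
      then show "a \<in> tspan rels (?b ` ?I)"
      proof (rule tspan_sub, intro subsetI)
        fix s assume "s \<in> {bracket eg (r # u) | u. mset (r # u) = mset w}"
        then obtain u where u: "mset (r # u) = mset w" "s = bracket eg (r # u)" by blast
        have "distinct (r # u)" "set (r # u) = S"
          using w(1,2) mset_eq_imp_distinct_iff[OF u(1)] mset_eq_setD[OF u(1)] by simp_all
        with bracket_rooted_span[of r u] show "s \<in> tspan rels (?b ` ?I)" unfolding u(2) by simp
      qed
    qed
  next
    fix t assume "t \<in> tspan rels (?b ` ?I)"
    then show "t \<in> tspan rels (bracket eg ` {w. count_list w = ind S})"
    proof (rule tspan_mono, intro subsetI)
      fix a assume "a \<in> ?b ` ?I"
      then obtain D where D: "D \<in> ?I" "a = ?b D" by blast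
      have "count_list (r # rooted_rep S r D) = ind S"
        unfolding count_list_ind using rooted_rep[OF D(1) assms] by blast
      then show "a \<in> bracket eg ` {w. count_list w = ind S}" unfolding D(2) by blast
    qed
  qed
  show "term_functional rels (\<lambda>t. evl t (word_indicator S D) [])" for D
    by (rule term_functional_evl[OF word_indicator_serre])
  show "evl (?b D') (word_indicator S D) [] = (if D = D' then 1 else 0)" if "D \<in> ?I" "D' \<in> ?I" for D D'
    by (rule evl_rooted_rep[OF that assms])
qed (simp_all add: root_space_def weight_space_def kac_moody_eq)

end

section \<open>The Kostant partition function\<close>

lemma geometric_inverse:
  fixes a :: "'v::finite \<Rightarrow> nat"
  assumes "a \<noteq> (\<lambda>_. 0)"
  shows "(1 - mfps_exp a) * mfps_geometric a = 1"
proof (rule mfps_eqI)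
  fix c
  have "(\<exists>k. c = (\<lambda>i. k * a i)) \<longleftrightarrow>
      c = (\<lambda>_. 0) \<or> ((\<forall>i. a i \<le> c i) \<and> (\<exists>k. (\<lambda>i. c i - a i) = (\<lambda>i. k * a i)))"
  proof (intro iffI; (elim exE disjE conjE)?)
    fix k assume k: "c = (\<lambda>i. k * a i)"
    show "c = (\<lambda>_. 0) \<or> ((\<forall>i. a i \<le> c i) \<and> (\<exists>k. (\<lambda>i. c i - a i) = (\<lambda>i. k * a i)))"
    proof (cases k)
      case (Suc l)
      then have "\<forall>i. a i \<le> c i" "(\<lambda>i. c i - a i) = (\<lambda>i. l * a i)" by (simp_all add: k)
      then show ?thesis by blast
    qed (simp add: k)
  next
    assume "c = (\<lambda>_. 0)"
    then show "\<exists>k. c = (\<lambda>i. k * a i)" by (intro exI[of _ 0]) simp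
  next
    fix k assume le: "\<forall>i. a i \<le> c i" and k: "(\<lambda>i. c i - a i) = (\<lambda>i. k * a i)"
    have "c i = Suc k * a i" for i using fun_cong[OF k, of i] spec[OF le, of i] by simp
    then show "\<exists>k. c = (\<lambda>i. k * a i)" by blast
  qed
  moreover have "\<not> (\<forall>i. a i \<le> c i)" if "c = (\<lambda>_. 0)"
    using assms that by (auto simp: fun_eq_iff)
  moreover have "mfps_coeff ((1 - mfps_exp a) * mfps_geometric a) c =
      mfps_coeff (mfps_geometric a) c - mfps_coeff (mfps_exp a * mfps_geometric a) c"
    by (simp add: left_diff_distrib minus_mfps.rep_eq)
  ultimately show "mfps_coeff ((1 - mfps_exp a) * mfps_geometric a) c = mfps_coeff 1 c"
    by (auto simp: mfps_coeff_exp_times mfps_geometric.rep_eq one_mfps.rep_eq)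
qed

lemma mfps_inverse_power:
  fixes a :: "'v::finite \<Rightarrow> nat"
  assumes "a \<noteq> (\<lambda>_. 0)"
  shows "mfps_inverse ((1 - mfps_exp a) ^ n) = mfps_geometric a ^ n"
  by (rule mfps_inverse_eqI) (simp add: power_mult_distrib[symmetric] geometric_inverse[OF assms])

definition supp :: "('v \<Rightarrow> nat) \<Rightarrow> 'v set" where
  "supp a = {i. a i \<noteq> 0}"

section \<open>Coefficients of the partition product at squarefree exponents\<close>

context simply_laced
begin

abbreviation le_ind :: "('v \<Rightarrow> nat) \<Rightarrow> 'v set \<Rightarrow> bool" where
  "le_ind a T \<equiv> \<forall>i. a i \<le> ind T i"

lemma le_ind_supp: "le_ind a T \<Longrightarrow> a = ind (supp a) \<and> supp a \<subseteq> T"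
proof
  assume le: "le_ind a T"
  show "a = ind (supp a)"
  proof
    fix i show "a i = ind (supp a) i"
      using spec[OF le, of i] by (auto simp: ind_def supp_def split: if_splits)
  qed
  show "supp a \<subseteq> T"
  proof
    fix i assume "i \<in> supp a"
    then show "i \<in> T" using spec[OF le, of i] by (auto simp: ind_def supp_def split: if_splits)
  qed
qed

lemma supp_ind [simp]: "supp (ind A) = A"
  by (auto simp: supp_def ind_def)

lemma le_ind_iff: "le_ind (ind A) T \<longleftrightarrow> A \<subseteq> T"
  by (auto simp: ind_def split: if_splits)

lemma ind_diff:
  assumes "le_ind a T" shows "(\<lambda>i. ind T i - a i) = ind (T - supp a)"
proof
  fix i
  have "a i = ind (supp a) i" "supp a \<subseteq> T" using le_ind_supp[OF assms] by (metis, blast)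
  then show "ind T i - a i = ind (T - supp a) i" by (auto simp: ind_def)
qed

text \<open>At squarefree exponents a factor \<open>p\<close> of this kind behaves like its constant
  term plus one monomial at \<open>a\<close>, so at most two splittings of \<open>T\<close>
  contribute.\<close>

lemma coeff_times_ind:
  assumes "a \<noteq> (\<lambda>_. 0)"
    and p: "\<And>U. U \<noteq> {} \<Longrightarrow> ind U \<noteq> a \<Longrightarrow> mfps_coeff p (ind U) = 0"
  shows "mfps_coeff (p * q) (ind T) = mfps_coeff p (ind {}) * mfps_coeff q (ind T) +
    (if le_ind a T then mfps_coeff p a * mfps_coeff q (ind (T - supp a)) else 0)"
proof -
  let ?f = "\<lambda>(x, y). mfps_coeff p x * mfps_coeff q y"
  let ?A = "{(ind {}, ind T)}" and ?B = "if le_ind a T then {(a, ind (T - supp a))} else {}"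
  have 0: "ind {} = (\<lambda>_. 0)" by (simp add: ind_def fun_eq_iff)
  have "mfps_coeff (p * q) (ind T) = (\<Sum>z\<in>splits (ind T). ?f z)"
    by (simp add: times_mfps.rep_eq)
  also have "\<dots> = (\<Sum>z\<in>?A \<union> ?B. ?f z)"
  proof (rule sum.mono_neutral_right[OF finite_splits])
    show "?A \<union> ?B \<subseteq> splits (ind T)"
    proof
      fix z assume "z \<in> ?A \<union> ?B"
      then consider "z = (ind {}, ind T)" | "le_ind a T" "z = (a, ind (T - supp a))"
        by (auto split: if_splits)
      then show "z \<in> splits (ind T)"
      proof cases
        case 2
        then show ?thesis by (simp add: splits_def ind_diff[symmetric] fun_eq_iff)
      qed (simp add: splits_def 0)
    qed
    show "\<forall>z\<in>splits (ind T) - (?A \<union> ?B). ?f z = 0"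
    proof
      fix z assume z: "z \<in> splits (ind T) - (?A \<union> ?B)"
      obtain x y where xy: "z = (x, y)" by (cases z)
      then have sp: "\<And>i. x i + y i = ind T i" using z by (auto simp: splits_def fun_eq_iff)
      have y: "y = (\<lambda>i. ind T i - x i)"
      proof
        fix i show "y i = ind T i - x i" using sp[of i] by simp
      qed
      have le: "le_ind x T"
      proof
        fix i show "x i \<le> ind T i" using sp[of i] by simp
      qed
      have x: "x = ind (supp x)" using le_ind_supp[OF le] by simp
      have "x \<noteq> a" using z le ind_diff[OF le] by (auto simp: xy y)
      moreover have "supp x \<noteq> {}"
      proof
        assume "supp x = {}"
        then have "x = ind {}" using x by simp
        then show False using z by (simp add: xy y 0)
      qed
      ultimately have "mfps_coeff p x = 0" using p[of "supp x"] x by simp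
      then show "?f z = 0" by (simp add: xy)
    qed
  qed
  also have "\<dots> = (\<Sum>z\<in>?A. ?f z) + (\<Sum>z\<in>?B. ?f z)"
    using assms(1) by (intro sum.union_disjoint) (auto simp: 0)
  finally show ?thesis by (auto split: if_splits)
qed

text \<open>On squarefree exponents \<open>(1 - e^a)^(-n)\<close> looks like
  \<open>1 + n e^a\<close>, since \<open>k\<close> times a nonzero \<open>a\<close> is never
  squarefree for \<open>k\<close> at least 2.\<close>

lemma coeff_geometric_power:
  assumes "a \<noteq> (\<lambda>_. 0)"
  shows "mfps_coeff (mfps_geometric a ^ n) (ind U) = (if U = {} then 1 else if ind U = a then int n else 0)"
proof (induction n arbitrary: U)
  case 0
  have "ind U = (\<lambda>_. 0) \<longleftrightarrow> U = {}" by (auto simp: ind_def fun_eq_iff)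
  then show ?case by (simp add: one_mfps.rep_eq)
next
  case (Suc n)
  have 0: "ind {} = (\<lambda>_. 0)" by (simp add: ind_def fun_eq_iff)
  have g: "mfps_coeff (mfps_geometric a) (ind {}) = 1" "mfps_coeff (mfps_geometric a) a = 1"
    using exI[of "\<lambda>k. a = (\<lambda>i. k * a i)" 1] exI[of "\<lambda>k. (\<lambda>i. 0) = (\<lambda>i. k * a i)" 0]
    by (auto simp: mfps_geometric.rep_eq 0)
  have "mfps_coeff (mfps_geometric a) (ind V) = 0" if V: "V \<noteq> {}" "ind V \<noteq> a" for V
  proof -
    have "ind V \<noteq> (\<lambda>i. k * a i)" for k
    proof
      assume k: "ind V = (\<lambda>i. k * a i)"
      obtain j where "j \<in> V" using V(1) by blast
      then have "k * a j = 1" using fun_cong[OF k, of j] by (simp add: ind_def)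
      then have "k = 1" by simp
      then show False using k V(2) by simp
    qed
    then show ?thesis by (simp add: mfps_geometric.rep_eq)
  qed
  from coeff_times_ind[OF assms this, of "mfps_geometric a ^ n" U]
  have eq: "mfps_coeff (mfps_geometric a ^ Suc n) (ind U) = mfps_coeff (mfps_geometric a ^ n) (ind U) +
      (if le_ind a U then mfps_coeff (mfps_geometric a ^ n) (ind (U - supp a)) else 0)"
    by (simp add: g)
  show ?case
  proof (cases "le_ind a U")
    case True
    then have a: "a = ind (supp a)" "supp a \<subseteq> U" using le_ind_supp by auto
    have "supp a \<noteq> {}" using a(1) assms 0 by auto
    then have "U \<noteq> {}" using a(2) by auto
    have "U - supp a = {} \<longleftrightarrow> ind U = a"
    proof
      assume "U - supp a = {}"
      then have "U = supp a" using a(2) by auto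
      then show "ind U = a" using a(1) by simp
    next
      assume "ind U = a"
      then have "supp a = U" using supp_ind by metis
      then show "U - supp a = {}" by simp
    qed
    moreover have "ind (U - supp a) \<noteq> a"
    proof
      assume "ind (U - supp a) = a"
      then have "supp a = U - supp a" using supp_ind by metis
      then show False using \<open>supp a \<noteq> {}\<close> by auto
    qed
    ultimately show ?thesis unfolding eq Suc using True \<open>U \<noteq> {}\<close> by auto
  next
    case False
    then have "ind U \<noteq> a" by auto
    then show ?thesis unfolding eq Suc using False by auto
  qed
qed

definition multilinear_coeff :: "(('v \<Rightarrow> nat) \<Rightarrow> nat) \<Rightarrow> ('v \<Rightarrow> nat) set \<Rightarrow> 'v set \<Rightarrow> int" where
  "multilinear_coeff m R T = mfps_coeff (\<Prod>a\<in>R. mfps_geometric a ^ m a) (ind T)"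

lemma multilinear_coeff_empty_roots: "multilinear_coeff m {} T = (if T = {} then 1 else 0)"
  by (auto simp: multilinear_coeff_def one_mfps.rep_eq ind_def fun_eq_iff)

lemma multilinear_coeff_insert:
  assumes "finite R" "a \<notin> R" "a \<noteq> (\<lambda>_. 0)"
  shows "multilinear_coeff m (insert a R) T = multilinear_coeff m R T +
    (if le_ind a T then int (m a) * multilinear_coeff m R (T - supp a) else 0)"
proof -
  have 0: "ind {} = (\<lambda>_. 0)" by (simp add: ind_def fun_eq_iff)
  have a: "mfps_coeff (mfps_geometric a ^ m a) a = int (m a)" if "le_ind a T"
  proof -
    have "a = ind (supp a)" using le_ind_supp[OF that] by simp
    moreover from this have "supp a \<noteq> {}" using assms(3) 0 by auto
    ultimately show ?thesis using coeff_geometric_power[OF assms(3), of "m a" "supp a"] by simp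
  qed
  show ?thesis
    unfolding multilinear_coeff_def prod.insert[OF assms(1,2)]
    by (subst coeff_times_ind[OF assms(3)]) (use assms(3) a in \<open>simp_all add: coeff_geometric_power\<close>)
qed

lemma multilinear_coeff_empty:
  assumes "finite R" "(\<lambda>_. 0) \<notin> R" shows "multilinear_coeff m R {} = 1"
  using assms
proof (induction R)
  case (insert a R)
  then have "\<not> le_ind a {}" by (auto simp: ind_def fun_eq_iff)
  then show ?case using insert by (auto simp: multilinear_coeff_insert)
qed (simp add: multilinear_coeff_empty_roots)

text \<open>Exactly one factor of a multilinear monomial involves the vertex \<open>r\<close>.\<close>

lemma multilinear_coeff_rec:
  assumes "finite R" "(\<lambda>_. 0) \<notin> R" "r \<in> T"
  shows "multilinear_coeff m R T =
    (\<Sum>a\<in>{a \<in> R. a r \<noteq> 0 \<and> le_ind a T}. int (m a) * multilinear_coeff m R (T - supp a))"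
  using assms
proof (induction R arbitrary: T)
  case empty
  then show ?case by (auto simp: multilinear_coeff_empty_roots)
next
  case (insert b R)
  let ?F = "multilinear_coeff m R" and ?F' = "multilinear_coeff m (insert b R)"
  let ?Q = "\<lambda>T. {a \<in> R. a r \<noteq> 0 \<and> le_ind a T}"
  have b0: "b \<noteq> (\<lambda>_. 0)" and R0: "(\<lambda>_. 0) \<notin> R" using insert.prems by auto
  have ins: "?F' T = ?F T + (if le_ind b T then int (m b) * ?F (T - supp b) else 0)" for T
    by (rule multilinear_coeff_insert[OF insert.hyps b0])
  have IH: "?F T = (\<Sum>a\<in>?Q T. int (m a) * ?F (T - supp a))" if "r \<in> T" for T
    using insert.IH[OF R0 that] .
  show ?case
  proof (cases "b r \<noteq> 0")
    case True
    \<comment> \<open>A factor \<open>b\<close> involving \<open>r\<close> cannot accompany another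
      factor \<open>a\<close> involving \<open>r\<close>, so adding \<open>b\<close> leaves the
      coefficients at the complements unchanged.\<close>
    have same: "?F' (T - supp a) = ?F (T - supp a)" if "a r \<noteq> 0" for a
    proof -
      have "\<not> le_ind b (T - supp a)"
      proof
        assume "le_ind b (T - supp a)"
        then have "b r \<le> ind (T - supp a) r" by blast
        then show False using True that by (simp add: ind_def supp_def)
      qed
      then show ?thesis using ins[of "T - supp a"] by (simp only: if_False add_0_right)
    qed
    have Q: "{a \<in> insert b R. a r \<noteq> 0 \<and> le_ind a T} = (if le_ind b T then insert b (?Q T) else ?Q T)"
      using True by auto
    have "(\<Sum>a\<in>{a \<in> insert b R. a r \<noteq> 0 \<and> le_ind a T}. int (m a) * ?F' (T - supp a)) =
        (\<Sum>a\<in>(if le_ind b T then insert b (?Q T) else ?Q T). int (m a) * ?F (T - supp a))"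
      by (rule sum.cong[OF Q]) (use True in \<open>auto simp: same split: if_splits\<close>)
    also have "(\<Sum>a\<in>(if le_ind b T then insert b (?Q T) else ?Q T). int (m a) * ?F (T - supp a)) = ?F' T"
      unfolding ins IH[OF insert.prems(2)] using insert.hyps by auto
    finally show ?thesis by (rule HOL.sym)
  next
    case False
    \<comment> \<open>Here \<open>b\<close> avoids \<open>r\<close>. Choosing \<open>a\<close> first
      and \<open>b\<close> from the rest is the same as choosing \<open>b\<close> first, because the
      supports are disjoint.\<close>
    have "(\<Sum>a\<in>{a \<in> insert b R. a r \<noteq> 0 \<and> le_ind a T}. int (m a) * ?F' (T - supp a)) =
        (\<Sum>a\<in>?Q T. int (m a) * ?F (T - supp a) +
          (if le_ind b (T - supp a) then int (m a) * (int (m b) * ?F (T - supp a - supp b)) else 0))"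
      by (rule sum.cong) (use False in \<open>auto simp: ins distrib_left\<close>)
    also have "\<dots> = ?F T + (\<Sum>a\<in>?Q T. if le_ind b (T - supp a) then int (m a) * (int (m b) * ?F (T - supp a - supp b)) else 0)"
      unfolding sum.distrib IH[OF insert.prems(2)] ..
    also have "(\<Sum>a\<in>?Q T. if le_ind b (T - supp a) then int (m a) * (int (m b) * ?F (T - supp a - supp b)) else 0) =
        (\<Sum>a\<in>{a \<in> ?Q T. le_ind b (T - supp a)}. int (m a) * (int (m b) * ?F (T - supp a - supp b)))"
      by (rule sum.inter_filter[symmetric]) (use insert.hyps in auto)
    also have "\<dots> = (if le_ind b T then int (m b) * ?F (T - supp b) else 0)"
    proof (cases "le_ind b T")
      case True
      then have b: "b = ind (supp b)" "supp b \<subseteq> T" using le_ind_supp by auto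
      have "le_ind a T \<and> le_ind b (T - supp a) \<longleftrightarrow> le_ind a (T - supp b)" for a
      proof (cases "a = ind (supp a)")
        case a: True
        show ?thesis
          using le_ind_iff[of "supp a" T] le_ind_iff[of "supp b" "T - supp a"] le_ind_iff[of "supp a" "T - supp b"]
            a[symmetric] b(1)[symmetric] b(2) by auto
      next
        case False
        then show ?thesis using le_ind_supp[of a T] le_ind_supp[of a "T - supp b"] by blast
      qed
      then have "{a \<in> ?Q T. le_ind b (T - supp a)} = ?Q (T - supp b)" by auto
      moreover have "r \<in> T - supp b" using insert.prems(2) \<open>\<not> b r \<noteq> 0\<close> by (simp add: supp_def)
      moreover have "T - supp a - supp b = T - supp b - supp a" for a by auto
      ultimately show ?thesis
        using True by (simp add: IH[of "T - supp b"] sum_distrib_left mult.left_commute)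
    next
      case nb: False
      have "{a \<in> ?Q T. le_ind b (T - supp a)} = {}"
      proof -
        have "le_ind b T" if "le_ind b (T - supp a)" for a
        proof
          fix i show "b i \<le> ind T i" using spec[OF that, of i] by (auto simp: ind_def split: if_splits)
        qed
        then show ?thesis using nb by blast
      qed
      then show ?thesis using nb by (simp only: sum.empty if_False)
    qed
    finally show ?thesis by (simp only: ins)
  qed
qed

end

subsection \<open>Splitting an acyclic orientation at the vertices reachable from a root\<close>

context simple_graph
begin

text \<open>Following arcs backwards ends, by acyclicity, in a source, and \<open>r\<close> is the
  only one.\<close>

lemma rooted_reachable:
  assumes D: "D \<in> rooted_orientations E S r" and "v \<in> S"
  shows "(r, v) \<in> D\<^sup>*"
proof -
  have "wf D" using orientations_onD(3)[OF rootedD(1)[OF D]] by (simp add: finite_acyclic_wf)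
  then show ?thesis using \<open>v \<in> S\<close>
  proof (induction v)
    case (less v)
    show ?case
    proof (cases "v = r")
      case False
      then obtain u where u: "(u, v) \<in> D" using rootedD(2)[OF D less.prems] by blast
      then have "(r, u) \<in> D\<^sup>*" using less.IH[OF u] orientations_onD(1)[OF rootedD(1)[OF D] u] by blast
      then show ?thesis using u by (rule rtrancl_into_rtrancl)
    qed simp
  qed
qed

definition glue_at :: "'v set \<Rightarrow> 'v set \<times> ('v \<times> 'v) set \<times> ('v \<times> 'v) set \<Rightarrow> ('v \<times> 'v) set" where
  "glue_at T = (\<lambda>(A, D1, D2). D2 \<union> D1 \<union> {(u, v). u \<in> T - A \<and> v \<in> A \<and> E u v})"

text \<open>The set \<open>A\<close> of vertices reachable from \<open>r\<close> is closed under
  arcs, so all edges between it and the rest point into \<open>A\<close>. Restricting to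
  \<open>A\<close> and to \<open>T - A\<close> therefore loses nothing, and in a glued orientation
  \<open>A\<close> is recovered as the reachable set.\<close>

lemma card_orientations_rec:
  assumes r: "r \<in> T"
  shows "card (orientations_on E T) =
    (\<Sum>A\<in>{A. r \<in> A \<and> A \<subseteq> T}. card (rooted_orientations E A r) * card (orientations_on E (T - A)))"
proof -
  let ?X = "SIGMA A:{A. r \<in> A \<and> A \<subseteq> T}. rooted_orientations E A r \<times> orientations_on E (T - A)"
  let ?g = "\<lambda>D. (D\<^sup>* `` {r}, D \<inter> (D\<^sup>* `` {r}) \<times> (D\<^sup>* `` {r}), D \<inter> (T - D\<^sup>* `` {r}) \<times> (T - D\<^sup>* `` {r}))"
  have "bij_betw (glue_at T) ?X (orientations_on E T)"
  proof (rule bij_betw_byWitness[where f' = ?g])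
    show "\<forall>x\<in>?X. ?g (glue_at T x) = x"
    proof
      fix x assume "x \<in> ?X"
      then obtain A D1 D2 where x: "x = (A, D1, D2)" and A: "r \<in> A" "A \<subseteq> T"
        and D1: "D1 \<in> rooted_orientations E A r" and D2: "D2 \<in> orientations_on E (T - A)" by auto
      let ?D = "glue_at T x"
      have D: "?D = D2 \<union> D1 \<union> {(u, v). u \<in> T - A \<and> v \<in> A \<and> E u v}" by (simp add: x glue_at_def)
      have s1: "D1 \<subseteq> A \<times> A" using orientations_onD(1)[OF rootedD(1)[OF D1]] by auto
      have s2: "D2 \<subseteq> (T - A) \<times> (T - A)" using orientations_onD(1)[OF D2] by auto
      have "?D\<^sup>* `` {r} = A"
      proof (intro equalityI subsetI)
        fix v assume "v \<in> ?D\<^sup>* `` {r}"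
        then have "(r, v) \<in> ?D\<^sup>*" by simp
        then show "v \<in> A"
        proof induction
          case (step y z)
          then show ?case using s1 s2 A unfolding D by blast
        qed (rule A(1))
      next
        fix v assume "v \<in> A"
        then have "(r, v) \<in> D1\<^sup>*" by (rule rooted_reachable[OF D1])
        moreover have "D1 \<subseteq> ?D" unfolding D by blast
        ultimately show "v \<in> ?D\<^sup>* `` {r}" using rtrancl_mono by blast
      qed
      moreover have "?D \<inter> A \<times> A = D1" using s1 s2 unfolding D by blast
      moreover have "?D \<inter> (T - A) \<times> (T - A) = D2" using s1 s2 unfolding D by blast
      ultimately show "?g ?D = x" by (simp add: x)
    qed
    have mem: "D \<in> orientations_on E T \<Longrightarrow> ?g D \<in> ?X \<and> glue_at T (?g D) = D" for D
    proof
      assume D: "D \<in> orientations_on E T"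
      let ?A = "D\<^sup>* `` {r}"
      have sub: "?A \<subseteq> T"
      proof
        fix v assume "v \<in> ?A"
        then have "(r, v) \<in> D\<^sup>*" by simp
        then show "v \<in> T"
        proof (cases rule: rtranclE)
          case (step u)
          then show ?thesis using orientations_onD(1)[OF D, of u v] by blast
        qed (use r in simp)
      qed
      have rA: "r \<in> ?A" by simp
      have closed: "v \<in> ?A" if "(u, v) \<in> D" "u \<in> ?A" for u v using that by (auto intro: rtrancl_into_rtrancl)
      have "D \<inter> ?A \<times> ?A \<in> rooted_orientations E ?A r"
        unfolding rooted_orientations_def
      proof (intro CollectI conjI ballI impI)
        show "D \<inter> ?A \<times> ?A \<in> orientations_on E ?A" by (rule restrict_orientation[OF D sub])
        fix v assume v: "v \<in> ?A" "\<forall>u. (u, v) \<notin> D \<inter> ?A \<times> ?A"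
        then have "(r, v) \<in> D\<^sup>*" by simp
        then show "v = r" by (cases rule: rtranclE) (use v in auto)
      qed
      moreover have "D \<inter> (T - ?A) \<times> (T - ?A) \<in> orientations_on E (T - ?A)"
        by (rule restrict_orientation[OF D]) auto
      ultimately show "?g D \<in> ?X" using sub rA by simp
      have TA: "T - (T - ?A) = ?A" using sub by auto
      have "D = (D \<inter> (T - ?A) \<times> (T - ?A)) \<union> (D \<inter> (T - (T - ?A)) \<times> (T - (T - ?A))) \<union>
          {(u, v). u \<in> T - ?A \<and> v \<in> T - (T - ?A) \<and> E u v}"
        by (rule orientation_split[OF D]) (use closed TA in auto)
      then show "glue_at T (?g D) = D" unfolding TA glue_at_def prod.case by (rule HOL.sym)
    qed
    show "\<forall>D\<in>orientations_on E T. glue_at T (?g D) = D" using mem by blast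
    show "?g ` orientations_on E T \<subseteq> ?X" using mem by blast
    show "glue_at T ` ?X \<subseteq> orientations_on E T"
    proof
      fix D assume "D \<in> glue_at T ` ?X"
      then obtain A D1 D2 where A: "r \<in> A" "A \<subseteq> T" and D1: "D1 \<in> rooted_orientations E A r"
        and D2: "D2 \<in> orientations_on E (T - A)" and D: "D = glue_at T (A, D1, D2)" by auto
      have "D2 \<union> D1 \<union> {(u, v). u \<in> T - A \<and> v \<in> A \<and> E u v} \<in> orientations_on E ((T - A) \<union> A)"
        by (rule glue_orientations[OF D2 rootedD(1)[OF D1]]) auto
      moreover have "(T - A) \<union> A = T" using A(2) by auto
      ultimately show "D \<in> orientations_on E T" by (simp add: D glue_at_def)
    qed
  qed
  then have "card (orientations_on E T) = card ?X" by (rule bij_betw_same_card[THEN HOL.sym])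
  also have "\<dots> = (\<Sum>A\<in>{A. r \<in> A \<and> A \<subseteq> T}. card (rooted_orientations E A r \<times> orientations_on E (T - A)))"
    by (rule card_SigmaI) auto
  finally show ?thesis by (simp add: card_cartesian_product)
qed

end

section \<open>From root multiplicities to the partition function\<close>

context simply_laced
begin

text \<open>The functional dual to \<open>D\<close> takes the value 1 on the bracket of
  \<open>D\<close>, which is therefore a nonzero root vector.\<close>

lemma ind_positive_root:
  assumes "r \<in> S" "rooted_orientations E S r \<noteq> {}"
  shows "ind S \<in> positive_roots B \<alpha> \<alpha>v"
proof -
  obtain D where D: "D \<in> rooted_orientations E S r" using assms(2) by blast
  let ?b = "bracket eg (r # rooted_rep S r D)"
  have nz: "ind S \<noteq> (\<lambda>_. 0)" using assms(1) by (auto simp: ind_def fun_eq_iff)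
  have rep: "distinct (r # rooted_rep S r D)" "set (r # rooted_rep S r D) = S" "orient E (r # rooted_rep S r D) = D"
    by (rule rooted_rep[OF D assms(1)])+
  have "cls ?b \<in> carrier (root_space B \<alpha> \<alpha>v (root_lattice_vec \<alpha> (ind S)))"
    unfolding carrier_root_space[OF nz] using rep by (intro imageI tspan_base) (auto simp: count_list_ind)
  moreover have "cls ?b \<noteq> cls Zero"
  proof
    assume eq: "cls ?b = cls Zero"
    have "evl ?b (word_indicator S D) [] = evl Zero (word_indicator S D) []"
      by (rule term_functionalD(4)[OF term_functional_evl[OF word_indicator_serre] eq])
    moreover have "evl ?b (word_indicator S D) [] = 1" by (rule evl_rooted_rep[OF D D assms(1), simplified])
    ultimately show False by simp
  qed
  ultimately show ?thesis
    using nz by (auto simp: positive_roots_def kac_moody_eq alg_class_simps(4)[symmetric])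
qed

text \<open>Both sides satisfy the same recursion at a vertex \<open>r\<close>. The finite set
  \<open>R\<close> is a stage of the infinite product that already contains every squarefree
  root.\<close>

lemma multilinear_coeff_orientations:
  defines "m \<equiv> \<lambda>a. root_mult B \<alpha> \<alpha>v (root_lattice_vec \<alpha> a)"
  assumes R: "finite R" "R \<subseteq> positive_roots B \<alpha> \<alpha>v" "range ind \<inter> positive_roots B \<alpha> \<alpha>v \<subseteq> R"
  shows "multilinear_coeff m R T = int (card (orientations_on E T))"
proof (induction "card T" arbitrary: T rule: less_induct)
  case less
  have R0: "(\<lambda>_. 0) \<notin> R" using R(2) by (auto simp: positive_roots_def)
  show ?case
  proof (cases "T = {}")
    case True
    then show ?thesis by (simp add: multilinear_coeff_empty[OF R(1) R0] orientation_empty)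
  next
    case False
    then obtain r where r: "r \<in> T" by blast
    let ?Q = "{a \<in> R. a r \<noteq> 0 \<and> le_ind a T}" and ?A = "{A. r \<in> A \<and> A \<subseteq> T}"
    have "multilinear_coeff m R T = (\<Sum>a\<in>?Q. int (m a) * multilinear_coeff m R (T - supp a))"
      by (rule multilinear_coeff_rec[OF R(1) R0 r])
    also have "\<dots> = (\<Sum>A\<in>{A \<in> ?A. ind A \<in> R}. int (m (ind A)) * multilinear_coeff m R (T - A))"
    proof (rule sum.reindex_bij_witness[where i = ind and j = supp])
      fix a assume a: "a \<in> ?Q"
      then have le: "a = ind (supp a)" "supp a \<subseteq> T" using le_ind_supp by auto
      then show "ind (supp a) = a" by simp
      show "supp a \<in> {A \<in> ?A. ind A \<in> R}" using a le by (simp add: supp_def)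
      show "int (m (ind (supp a))) * multilinear_coeff m R (T - supp a) = int (m a) * multilinear_coeff m R (T - supp a)"
        using le(1) by simp
    next
      fix A assume A: "A \<in> {A \<in> ?A. ind A \<in> R}"
      show "supp (ind A) = A" by simp
      show "ind A \<in> ?Q" using A le_ind_iff[of A T] by (auto simp: ind_def)
    qed
    \<comment> \<open>Sets \<open>A\<close> whose indicator is missing from \<open>R\<close> are not
      roots and have multiplicity 0, so the sum may run over all \<open>A\<close>.\<close>
    also have "\<dots> = (\<Sum>A\<in>?A. int (m (ind A)) * multilinear_coeff m R (T - A))"
    proof (rule sum.mono_neutral_left)
      show "\<forall>A\<in>?A - {A \<in> ?A. ind A \<in> R}. int (m (ind A)) * multilinear_coeff m R (T - A) = 0"
      proof
        fix A assume A: "A \<in> ?A - {A \<in> ?A. ind A \<in> R}"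
        then have "r \<in> A" "ind A \<notin> positive_roots B \<alpha> \<alpha>v" using R(3) by auto
        then have "rooted_orientations E A r = {}" using ind_positive_root by blast
        then have "m (ind A) = 0" unfolding m_def root_mult_ind[OF \<open>r \<in> A\<close>] by simp
        then show "int (m (ind A)) * multilinear_coeff m R (T - A) = 0" by simp
      qed
    qed auto
    also have "\<dots> = (\<Sum>A\<in>?A. int (card (rooted_orientations E A r) * card (orientations_on E (T - A))))"
    proof (rule sum.cong[OF HOL.refl])
      fix A assume A: "A \<in> ?A"
      then have "card (T - A) < card T" by (intro psubset_card_mono) auto
      then have "multilinear_coeff m R (T - A) = int (card (orientations_on E (T - A)))" by (rule less)
      moreover have "m (ind A) = card (rooted_orientations E A r)"
        unfolding m_def by (rule root_mult_ind) (use A in simp)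
      ultimately show "int (m (ind A)) * multilinear_coeff m R (T - A) =
          int (card (rooted_orientations E A r) * card (orientations_on E (T - A)))" by simp
    qed
    finally show ?thesis unfolding card_orientations_rec[OF r] by simp
  qed
qed

theorem kostant_orientations:
  "kostant_partition B \<alpha> \<alpha>v (\<lambda>_. 1) = int (card (acyclic_orientations E))"
proof -
  let ?P = "positive_roots B \<alpha> \<alpha>v" and ?m = "\<lambda>a. root_mult B \<alpha> \<alpha>v (root_lattice_vec \<alpha> a)"
  let ?f = "\<lambda>S. mfps_coeff (\<Prod>a\<in>S. mfps_inverse ((1 - mfps_exp a) ^ ?m a)) (\<lambda>_. 1)"
  have ind: "(\<lambda>_. 1) = ind UNIV" by (simp add: ind_def fun_eq_iff)
  have "?f S = int (card (acyclic_orientations E))" if S: "finite S" "S \<subseteq> ?P" "range ind \<inter> ?P \<subseteq> S" for S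
  proof -
    have "(\<Prod>a\<in>S. mfps_inverse ((1 - mfps_exp a) ^ ?m a)) = (\<Prod>a\<in>S. mfps_geometric a ^ ?m a)"
      by (rule prod.cong) (use S(2) in \<open>auto simp: positive_roots_def mfps_inverse_power\<close>)
    then show ?thesis
      using multilinear_coeff_orientations[OF S, of UNIV] unfolding multilinear_coeff_def ind by simp
  qed
  \<comment> \<open>There are finitely many squarefree roots; from the stage that contains them all
    the coefficient is constant.\<close>
  then have ev: "\<forall>\<^sub>F S in finite_subsets_at_top ?P. ?f S = int (card (acyclic_orientations E))"
    unfolding eventually_finite_subsets_at_top
    by (intro exI[of _ "range ind \<inter> ?P"]) auto
  show ?thesis unfolding kostant_partition_def
  proof (rule the_equality[where P = "\<lambda>k. \<forall>\<^sub>F S in finite_subsets_at_top ?P. ?f S = k", OF ev])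
    fix k assume "\<forall>\<^sub>F S in finite_subsets_at_top ?P. ?f S = k"
    with ev have "\<forall>\<^sub>F S in finite_subsets_at_top ?P. k = int (card (acyclic_orientations E))"
      by eventually_elim simp
    then show "k = int (card (acyclic_orientations E))"
      by (simp add: finite_subsets_at_top_neq_bot)
  qed
qed

end

section \<open>The positive part and its enveloping algebra\<close>

context simply_laced
begin

abbreviation "Pos \<equiv> tspan rels (bracket eg ` {w. w \<noteq> []})"
abbreviation "nplus \<equiv> n_plus B \<alpha> \<alpha>v"
abbreviation "KM \<equiv> presented_algebra UNIV rels"

lemma bracket_count_Pos:
  assumes "c \<noteq> (\<lambda>_. 0)" "t \<in> tspan rels (bracket eg ` {w. count_list w = c})"
  shows "t \<in> Pos"
proof (rule tspan_mono[OF assms(2)], rule image_mono)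
  show "{w. count_list w = c} \<subseteq> {w. w \<noteq> []}" using count_nonzero[OF _ assms(1)] by blast
qed

lemma submodule_Pos: "submodule complex_field (cls ` Pos) KM"
proof -
  have "Module.module complex_field KM"
    by (rule vectorspace.axioms(1)[OF vectorspace_presented_algebra])
  then show ?thesis
  proof (rule submodule.intro)
    show "cls ` Pos \<subseteq> carrier KM" by auto
    show "\<zero>\<^bsub>KM\<^esub> \<in> cls ` Pos"
      unfolding alg_class_simps(4)[symmetric] by (intro imageI tspan_Zero)
    show "v \<oplus>\<^bsub>KM\<^esub> w \<in> cls ` Pos" if "v \<in> cls ` Pos" "w \<in> cls ` Pos" for v w
      using that by (auto simp: alg_class_simps(1)[symmetric] intro!: imageI tspan_Add)
    show "c \<odot>\<^bsub>KM\<^esub> v \<in> cls ` Pos" if "c \<in> carrier complex_field" "v \<in> cls ` Pos" for c v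
      using that by (auto simp: alg_class_simps(3)[symmetric] intro!: imageI tspan_Scale)
  qed
qed

text \<open>The bracket of a nonempty word is either zero or a root vector for a positive root;
  conversely every positive root space is spanned by such brackets.\<close>

lemma carrier_nplus: "carrier nplus = cls ` Pos"
proof -
  interpret V: vectorspace complex_field KM by (rule vectorspace_presented_algebra)
  let ?S = "\<Union>c\<in>positive_roots B \<alpha> \<alpha>v. carrier (root_space B \<alpha> \<alpha>v (root_lattice_vec \<alpha> c))"
  have car: "carrier nplus = V.span ?S" by (simp add: n_plus_def kac_moody_eq)
  have sub: "?S \<subseteq> carrier KM"
    by (auto simp: root_space_def weight_space_def kac_moody_eq)
  have "V.span ?S \<subseteq> cls ` Pos"
  proof (rule V.span_is_subset[OF _ submodule_Pos])
    show "?S \<subseteq> cls ` Pos"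
    proof
      fix x assume "x \<in> ?S"
      then obtain c where c: "c \<noteq> (\<lambda>_. 0)" "x \<in> carrier (root_space B \<alpha> \<alpha>v (root_lattice_vec \<alpha> c))"
        by (auto simp: positive_roots_def)
      then show "x \<in> cls ` Pos" unfolding carrier_root_space[OF c(1)] using bracket_count_Pos by blast
    qed
  qed
  moreover have "cls t \<in> V.span ?S" if "t \<in> Pos" for t
    using that
  proof induction
    case tspan_Zero
    show ?case unfolding alg_class_simps(4)
      by (rule submodule.zero_closed[OF V.span_is_submodule[OF sub]])
  next
    case (tspan_base a)
    then obtain w where w: "w \<noteq> []" "a = bracket eg w" by blast
    show ?case
    proof (cases "cls a = cls Zero")
      case True
      then show ?thesis unfolding True alg_class_simps(4)
        by (intro submodule.zero_closed[OF V.span_is_submodule[OF sub]])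
    next
      case False
      have mem: "cls a \<in> carrier (root_space B \<alpha> \<alpha>v (root_lattice_vec \<alpha> (count_list w)))"
        unfolding root_space_mem w(2) by (rule bracket_weight[OF w(1)])
      moreover have "count_list w \<noteq> (\<lambda>_. 0)"
      proof
        assume "count_list w = (\<lambda>_. 0)"
        then have "count_list w (hd w) = 0" by simp
        then show False using w(1) by (simp add: count_list_0_iff)
      qed
      ultimately have "count_list w \<in> positive_roots B \<alpha> \<alpha>v"
        using False by (auto simp: positive_roots_def kac_moody_eq alg_class_simps(4)[symmetric])
      then have "cls a \<in> ?S" using mem by blast
      then show ?thesis using V.in_own_span[OF sub] by blast
    qed
  next
    case (tspan_Add s t)
    then show ?case unfolding alg_class_simps(1)
      by (intro submodule.m_closed[OF V.span_is_submodule[OF sub]])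
  next
    case (tspan_Scale t c)
    then show ?case unfolding alg_class_simps(3)
      by (intro submodule.smult_closed[OF V.span_is_submodule[OF sub]]) (simp_all add: complex_field_def)
  next
    case (tspan_cong s t)
    then have "cls s = cls t" by (simp add: alg_class_eq_iff)
    then show ?case using tspan_cong.IH by simp
  qed
  ultimately show ?thesis unfolding car by blast
qed

lemma nplus_ops:
  "x \<oplus>\<^bsub>nplus\<^esub> y = x \<oplus>\<^bsub>KM\<^esub> y" "c \<odot>\<^bsub>nplus\<^esub> x = c \<odot>\<^bsub>KM\<^esub> x" "x \<otimes>\<^bsub>nplus\<^esub> y = x \<otimes>\<^bsub>KM\<^esub> y"
  by (simp_all add: n_plus_def kac_moody_eq)

lemma sum_roots: "(\<Sum>i\<in>UNIV. \<alpha> i) = root_lattice_vec \<alpha> (ind UNIV)"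
  by (simp add: root_lattice_vec_def ind_def)

lemma ind_UNIV_nonzero: "ind UNIV \<noteq> (\<lambda>_. 0)"
  by (simp add: ind_def fun_eq_iff)

lemma n_plus_weight_space_eq:
  "n_plus_weight_space B \<alpha> \<alpha>v (\<Sum>i\<in>UNIV. \<alpha> i) = root_space B \<alpha> \<alpha>v (\<Sum>i\<in>UNIV. \<alpha> i)"
proof -
  let ?R = "carrier (root_space B \<alpha> \<alpha>v (\<Sum>i\<in>UNIV. \<alpha> i))"
  have "?R \<subseteq> carrier nplus"
    unfolding sum_roots carrier_root_space[OF ind_UNIV_nonzero] carrier_nplus
    using bracket_count_Pos[OF ind_UNIV_nonzero] by blast
  moreover have "carrier nplus \<subseteq> carrier KM" unfolding carrier_nplus by auto
  ultimately have "{x \<in> carrier nplus. \<forall>h. ad_h B \<alpha> \<alpha>v h x = pairing (\<Sum>i\<in>UNIV. \<alpha> i) h \<odot>\<^bsub>KM\<^esub> x} = ?R"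
    by (auto simp: root_space_def weight_space_def kac_moody_eq)
  then show ?thesis
    by (simp add: n_plus_weight_space_def root_space_def weight_space_def n_plus_def kac_moody_eq)
qed

lemma Pos_bracket: "w \<noteq> [] \<Longrightarrow> bracket eg w \<in> Pos"
  by (rule tspan_base) blast

lemma Pos_e: "eg v \<in> Pos"
  using Pos_bracket[of "[v]"] by (simp add: bracket_simps)

lemma Pos_Mult: "s \<in> Pos \<Longrightarrow> t \<in> Pos \<Longrightarrow> Mult s t \<in> Pos"
proof (erule tspan_Mult, assumption)
  fix a b assume "a \<in> bracket eg ` {w. w \<noteq> []}" "b \<in> bracket eg ` {w. w \<noteq> []}"
  then obtain u v where uv: "u \<noteq> []" "a = bracket eg u" "v \<noteq> []" "b = bracket eg v" by blast
  have "Mult a b \<in> tspan rels {foldl (\<lambda>s v. Mult s (eg v)) a w | w. mset w = mset v}"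
    unfolding uv(4) by (rule Mult_bracket[OF lie_rels uv(3)])
  then show "Mult a b \<in> Pos"
  proof (rule tspan_mono, intro subsetI)
    fix s assume "s \<in> {foldl (\<lambda>s v. Mult s (eg v)) a w | w. mset w = mset v}"
    then obtain w where "s = foldl (\<lambda>s v. Mult s (eg v)) a w" by blast
    then have "s = bracket eg (u @ w)" unfolding uv(2) using uv(1) by (cases u) (simp_all add: bracket_def)
    then show "s \<in> bracket eg ` {w. w \<noteq> []}" using uv(1) by blast
  qed
qed

lemma Pos_ad: "t \<in> Pos \<Longrightarrow> Mult (hg h) t \<in> Pos"
proof (erule tspan_image[where f = "Mult (hg h)"])
  fix a assume "a \<in> bracket eg ` {w. w \<noteq> []}"
  then obtain w where w: "w \<noteq> []" "a = bracket eg w" by blast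
  have "cls (Mult (hg h) a) = cls (Scale (pairing (root_lattice_vec \<alpha> (count_list w)) h) a)"
    using bracket_weight[OF w(1)] unfolding hact.has_weight_def w(2) by blast
  then show "Mult (hg h) a \<in> Pos" by (rule tspan_eq) (rule tspan_Scale[OF Pos_bracket[OF w(1), folded w(2)]])
qed (assumption | rule alg_mult_laws alg_class_cong(2)[OF HOL.refl])+

subsection \<open>Words in the enveloping algebra\<close>

abbreviation "URel \<equiv> uea_cong_rel nplus"
abbreviation "ucl \<equiv> alg_class URel"

definition inc :: "('d, 'v) km_gen alg_term \<Rightarrow> ('d, 'v) km_elem uea_gen alg_term" where
  "inc t = Gen (Inc (cls t))"

abbreviation "one_u \<equiv> (Gen Unit :: ('d, 'v) km_elem uea_gen alg_term)"

lemma u_rel: "(s, t) \<in> URel \<Longrightarrow> ucl s = ucl t"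
  unfolding alg_class_eq_iff by (rule alg_cong.rel)

lemma u_assoc: "ucl (Mult (Mult s t) u) = ucl (Mult s (Mult t u))"
  and u_unit_left: "ucl (Mult one_u t) = ucl t"
  and u_unit_right: "ucl (Mult t one_u) = ucl t"
  by (rule u_rel, force simp: uea_cong_rel_def unital_associative_laws_def)+

lemma u_inc:
  assumes "s \<in> Pos" "t \<in> Pos"
  shows "ucl (inc (Add s t)) = ucl (Add (inc s) (inc t))"
    and "ucl (inc (Scale c t)) = ucl (Scale c (inc t))"
    and "ucl (inc (Mult s t)) = ucl (Add (Mult (inc s) (inc t)) (Scale (-1) (Mult (inc t) (inc s))))"
proof -
  have m: "cls s \<in> carrier nplus" "cls t \<in> carrier nplus" using assms unfolding carrier_nplus by blast+
  have i: "inc (Add s t) = Gen (Inc (cls s \<oplus>\<^bsub>nplus\<^esub> cls t))"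
    "inc (Scale c t) = Gen (Inc (c \<odot>\<^bsub>nplus\<^esub> cls t))"
    "inc (Mult s t) = Gen (Inc (cls s \<otimes>\<^bsub>nplus\<^esub> cls t))"
    by (simp_all only: inc_def alg_class_simps nplus_ops)
  show "ucl (inc (Add s t)) = ucl (Add (inc s) (inc t))"
    unfolding i(1) unfolding inc_def by (rule u_rel, unfold uea_cong_rel_def uea_relations_def) (use m in blast)
  show "ucl (inc (Scale c t)) = ucl (Scale c (inc t))"
    unfolding i(2) unfolding inc_def by (rule u_rel, unfold uea_cong_rel_def uea_relations_def) (use m in blast)
  show "ucl (inc (Mult s t)) = ucl (Add (Mult (inc s) (inc t)) (Scale (-1) (Mult (inc t) (inc s))))"
    unfolding i(3) unfolding inc_def by (rule u_rel, unfold uea_cong_rel_def uea_relations_def) (use m in blast)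
qed

lemma u_inc_Zero: "ucl (inc Zero) = ucl Zero"
proof -
  have "inc Zero = inc (Scale 0 Zero)" unfolding inc_def by (simp only: alg_scale_laws(5))
  then show ?thesis
    using u_inc(2)[OF tspan_Zero tspan_Zero, of 0] by (simp add: alg_scale_laws)
qed

primrec uword :: "'v list \<Rightarrow> ('d, 'v) km_elem uea_gen alg_term" where
  "uword [] = one_u"
| "uword (v # w) = Mult (inc (eg v)) (uword w)"

abbreviation "UW \<equiv> tspan URel (range uword)"

lemma uword_append: "ucl (Mult (uword a) (uword b)) = ucl (uword (a @ b))"
proof (induction a)
  case Nil
  show ?case by (simp add: u_unit_left)
next
  case (Cons v a)
  have "ucl (Mult (uword (v # a)) (uword b)) = ucl (Mult (inc (eg v)) (Mult (uword a) (uword b)))"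
    unfolding uword.simps by (rule u_assoc)
  also have "\<dots> = ucl (Mult (inc (eg v)) (uword (a @ b)))" by (rule alg_class_cong(2)[OF HOL.refl Cons])
  finally show ?case by simp
qed

lemma UW_Mult: "s \<in> UW \<Longrightarrow> t \<in> UW \<Longrightarrow> Mult s t \<in> UW"
proof (erule tspan_Mult, assumption)
  fix a b assume "a \<in> range uword" "b \<in> range uword"
  then obtain u v where uv: "a = uword u" "b = uword v" by blast
  show "Mult a b \<in> UW" unfolding uv by (rule tspan_eq[OF uword_append]) (rule tspan_base[OF rangeI])
qed

text \<open>A bracket becomes the commutator of its factors, so by induction on its length it is a
  combination of words.\<close>

lemma UW_inc: "t \<in> Pos \<Longrightarrow> inc t \<in> UW"
proof (induction rule: tspan.induct)
  case tspan_Zero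
  show ?case by (rule tspan_eq[OF u_inc_Zero tspan.tspan_Zero])
next
  case (tspan_base a)
  then obtain w where w: "w \<noteq> []" "a = bracket eg w" by blast
  have gen: "inc (eg v) \<in> UW" for v
  proof (rule tspan_eq)
    show "ucl (inc (eg v)) = ucl (uword [v])" by (simp add: u_unit_right)
  qed (rule tspan.tspan_base[OF rangeI])
  show ?case unfolding w(2) using w(1)
  proof (induction w rule: rev_nonempty_induct)
    case (single v)
    show ?case using gen by (simp add: bracket_simps)
  next
    case (snoc v w)
    show ?case
      unfolding bracket_simps(3)[OF snoc.hyps]
      by (rule tspan_eq[OF u_inc(3)[OF Pos_bracket[OF snoc.hyps] Pos_e]])
        (intro tspan_Add tspan_Scale UW_Mult snoc.IH gen)
  qed
next
  case (tspan_Add s t)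
  show ?case by (rule tspan_eq[OF u_inc(1)[OF tspan_Add.hyps]]) (rule tspan.tspan_Add[OF tspan_Add.IH])
next
  case (tspan_Scale t c)
  show ?case
    by (rule tspan_eq[OF u_inc(2)[OF tspan_Scale.hyps tspan_Scale.hyps]]) (rule tspan.tspan_Scale[OF tspan_Scale.IH])
next
  case (tspan_cong s t)
  then have "cls s = cls t" by (simp add: alg_class_eq_iff)
  then have "inc s = inc t" by (simp add: inc_def)
  then show ?case using tspan_cong.IH by simp
qed

abbreviation "Ugen \<equiv> insert Unit (Inc ` carrier nplus)"

text \<open>The restriction on generators excludes \<open>Inc x\<close> for \<open>x\<close> outside
  the positive part, which no relation reduces to words.\<close>

lemma UW_all: "set_alg_term t \<subseteq> Ugen \<Longrightarrow> t \<in> UW"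
proof (induction t)
  case (Gen x)
  then consider "x = Unit" | s where "s \<in> Pos" "x = Inc (cls s)" unfolding carrier_nplus by auto
  then show ?case
  proof cases
    case 1
    have "one_u = uword []" by simp
    then show ?thesis unfolding 1 by (metis tspan_base rangeI)
  next
    case 2
    then show ?thesis using UW_inc[OF 2(1)] by (simp add: inc_def)
  qed
next
  case (Mult s t)
  then show ?case by (intro UW_Mult) auto
qed (auto intro: tspan.intros(1,3,4))

subsection \<open>Weights in the enveloping algebra\<close>

abbreviation "uder h \<equiv> leibniz (\<lambda>x. case x of Unit \<Rightarrow> Zero | Inc y \<Rightarrow> Gen (Inc (ad_h B \<alpha> \<alpha>v h y)))"

lemma uder_inc: "uder h (inc t) = inc (Mult (hg h) t)"
  by (simp add: inc_def ad_h_cls)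

text \<open>Sorts the four products in the derivative of a commutator into the derivatives of its
  two products.\<close>

lemma u_add4: "ucl (Add (Add p (Scale (-1) q)) (Add r (Scale (-1) s))) = ucl (Add (Add p r) (Scale (-1) (Add s q)))"
proof -
  have "ucl (Add (Add p (Scale (-1) q)) (Add r (Scale (-1) s))) =
      ucl (Add (Add p r) (Add (Scale (-1) q) (Scale (-1) s)))"
    unfolding alg_add_laws(2) by (intro alg_class_cong(1)[OF HOL.refl] alg_add_ac)
  also have "\<dots> = ucl (Add (Add p r) (Add (Scale (-1) s) (Scale (-1) q)))"
    by (intro alg_class_cong(1)[OF HOL.refl] alg_add_laws(1))
  also have "\<dots> = ucl (Add (Add p r) (Scale (-1) (Add s q)))"
    by (intro alg_class_cong(1)[OF HOL.refl] alg_scale_laws(2)[symmetric])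
  finally show ?thesis .
qed

text \<open>This compatibility makes the Leibniz extension well defined on classes. For the bracket
  relation it rests on the adjoint action of \<open>h\<close> being a derivation of the Lie
  algebra.\<close>

lemma uder_rel:
  assumes "(s, t) \<in> URel" shows "(uder h s, uder h t) \<in> alg_cong URel"
proof -
  from assms have "(s, t) \<in> unital_associative_laws \<or> (s, t) \<in> uea_relations nplus"
    by (simp only: uea_cong_rel_def Un_iff)
  then have "ucl (uder h s) = ucl (uder h t)"
  proof
    assume "(s, t) \<in> unital_associative_laws"
    then consider a b c where "s = Mult (Mult a b) c" "t = Mult a (Mult b c)" | "s = Mult one_u t" | "s = Mult t one_u"
      unfolding unital_associative_laws_def by blast
    then show ?thesis
    proof cases
      case 1
      let ?d = "uder h"
      have "ucl (?d s) = ucl (Add (Add (Mult (Mult (?d a) b) c) (Mult (Mult a (?d b)) c)) (Mult (Mult a b) (?d c)))"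
        unfolding 1 leibniz.simps by (rule alg_class_cong(1)[OF alg_mult_laws(1) HOL.refl])
      also have "\<dots> = ucl (Add (Add (Mult (?d a) (Mult b c)) (Mult a (Mult (?d b) c))) (Mult a (Mult b (?d c))))"
        by (intro alg_class_cong(1) u_assoc)
      also have "\<dots> = ucl (Add (Mult (?d a) (Mult b c)) (Add (Mult a (Mult (?d b) c)) (Mult a (Mult b (?d c)))))"
        by (rule alg_add_laws(2))
      also have "\<dots> = ucl (?d t)"
        unfolding 1 leibniz.simps by (rule alg_class_cong(1)[OF HOL.refl alg_mult_laws(2)[symmetric]])
      finally show ?thesis .
    next
      case 2
      have "ucl (uder h s) = ucl (Add (Mult Zero t) (Mult one_u (uder h t)))" unfolding 2 by simp
      also have "\<dots> = ucl (Add Zero (uder h t))" by (intro alg_class_cong(1) alg_mult_laws u_unit_left)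
      finally show ?thesis by (simp only: alg_add_laws(4))
    next
      case 3
      have "ucl (uder h s) = ucl (Add (Mult (uder h t) one_u) (Mult t Zero))" unfolding 3 by simp
      also have "\<dots> = ucl (Add (uder h t) Zero)" by (intro alg_class_cong(1) alg_mult_laws u_unit_right)
      finally show ?thesis by (simp only: alg_add_laws(3))
    qed
  next
    assume st: "(s, t) \<in> uea_relations nplus"
    from st consider
        x y where "x \<in> carrier nplus" "y \<in> carrier nplus" "s = Gen (Inc (x \<oplus>\<^bsub>nplus\<^esub> y))" "t = Add (Gen (Inc x)) (Gen (Inc y))"
      | c x where "x \<in> carrier nplus" "s = Gen (Inc (c \<odot>\<^bsub>nplus\<^esub> x))" "t = Scale c (Gen (Inc x))"
      | x y where "x \<in> carrier nplus" "y \<in> carrier nplus" "s = Gen (Inc (x \<otimes>\<^bsub>nplus\<^esub> y))"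
          "t = Add (Mult (Gen (Inc x)) (Gen (Inc y))) (Scale (-1) (Mult (Gen (Inc y)) (Gen (Inc x))))"
      unfolding uea_relations_def by blast
    then show ?thesis
    proof cases
      case 1
      then obtain a b where ab: "a \<in> Pos" "x = cls a" "b \<in> Pos" "y = cls b" unfolding carrier_nplus by blast
      have st: "s = inc (Add a b)" "t = Add (inc a) (inc b)"
        unfolding 1(3,4) ab nplus_ops inc_def alg_class_simps(1) by simp_all
      have "inc (Mult (hg h) (Add a b)) = inc (Add (Mult (hg h) a) (Mult (hg h) b))"
        unfolding inc_def by (simp only: alg_mult_laws(2))
      then show ?thesis
        unfolding st leibniz.simps uder_inc using u_inc(1)[OF Pos_ad[OF ab(1)] Pos_ad[OF ab(3)]] by simp
    next
      case 2
      then obtain a where a: "a \<in> Pos" "x = cls a" unfolding carrier_nplus by blast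
      have st: "s = inc (Scale c a)" "t = Scale c (inc a)"
        unfolding 2(2,3) a nplus_ops inc_def alg_class_simps(3) by simp_all
      have "inc (Mult (hg h) (Scale c a)) = inc (Scale c (Mult (hg h) a))"
        unfolding inc_def by (simp only: alg_mult_laws(4))
      then show ?thesis
        unfolding st leibniz.simps uder_inc using u_inc(2)[OF Pos_ad[OF a(1)] Pos_ad[OF a(1)]] by simp
    next
      case 3
      then obtain a b where ab: "a \<in> Pos" "x = cls a" "b \<in> Pos" "y = cls b" unfolding carrier_nplus by blast
      have st: "s = inc (Mult a b)" "t = Add (Mult (inc a) (inc b)) (Scale (-1) (Mult (inc b) (inc a)))"
        unfolding 3(3,4) ab nplus_ops inc_def alg_class_simps(2) by simp_all
      let ?a = "Mult (hg h) a" and ?b = "Mult (hg h) b"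
      have P: "?a \<in> Pos" "?b \<in> Pos" by (rule Pos_ad ab)+
      have "inc (Mult (hg h) (Mult a b)) = inc (Add (Mult ?a b) (Mult a ?b))"
        unfolding inc_def by (simp only: lie_left[OF lie_rels])
      then have "ucl (uder h s) = ucl (Add (inc (Mult ?a b)) (inc (Mult a ?b)))"
        unfolding st uder_inc using u_inc(1)[OF Pos_Mult[OF P(1) ab(3)] Pos_Mult[OF ab(1) P(2)]] by simp
      also have "\<dots> = ucl (Add (Add (Mult (inc ?a) (inc b)) (Scale (-1) (Mult (inc b) (inc ?a))))
          (Add (Mult (inc a) (inc ?b)) (Scale (-1) (Mult (inc ?b) (inc a)))))"
        by (intro alg_class_cong(1) u_inc(3) P ab)
      also have "\<dots> = ucl (Add (Add (Mult (inc ?a) (inc b)) (Mult (inc a) (inc ?b)))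
          (Scale (-1) (Add (Mult (inc ?b) (inc a)) (Mult (inc b) (inc ?a)))))"
        by (rule u_add4)
      also have "\<dots> = ucl (uder h t)" unfolding st leibniz.simps uder_inc by (rule HOL.refl)
      finally show ?thesis .
    qed
  qed
  then show ?thesis by (simp only: alg_class_eq_iff)
qed

lemma uder_cong: "ucl s = ucl t \<Longrightarrow> ucl (uder h s) = ucl (uder h t)"
  unfolding alg_class_eq_iff by (rule leibniz_cong[OF uder_rel])

sublocale uact: term_action URel uder
  by unfold_locales (rule uder_cong, assumption | simp only: leibniz.simps)+

lemma uea_derivation_ucl: "uea_derivation nplus (ad_h B \<alpha> \<alpha>v h) (ucl t) = ucl (uder h t)"
  unfolding uea_derivation_def
  by (rule UN_alg_class) (use uder_cong[of t _ h] in \<open>simp add: alg_class_eq_iff alg_cong.sym\<close>)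

lemma uword_weight: "uact.has_weight (pairing (root_lattice_vec \<alpha> (count_list w))) (uword w)"
  unfolding wt_count[symmetric]
proof (induction w)
  case Nil
  show ?case by (simp add: uact.has_weight_def pairing_simps alg_scale_laws)
next
  case (Cons v w)
  show ?case unfolding uact.has_weight_def
  proof
    fix h
    have "inc (Mult (hg h) (eg v)) = inc (Scale (pairing (\<alpha> v) h) (eg v))"
      unfolding inc_def km_rel[OF km_relations.H_e] ..
    then have e: "ucl (uder h (inc (eg v))) = ucl (Scale (pairing (\<alpha> v) h) (inc (eg v)))"
      unfolding uder_inc by (simp only: u_inc(2)[OF Pos_e Pos_e])
    have "ucl (uder h (uword (v # w))) = ucl (Add (Mult (uder h (inc (eg v))) (uword w)) (Mult (inc (eg v)) (uder h (uword w))))"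
      unfolding uword.simps leibniz.simps ..
    also have "\<dots> = ucl (Add (Mult (Scale (pairing (\<alpha> v) h) (inc (eg v))) (uword w))
        (Mult (inc (eg v)) (Scale (pairing (wt w) h) (uword w))))"
      using Cons unfolding uact.has_weight_def by (intro alg_class_cong(1) alg_class_cong(2) e HOL.refl) blast
    also have "\<dots> = ucl (Add (Scale (pairing (\<alpha> v) h) (uword (v # w))) (Scale (pairing (wt w) h) (uword (v # w))))"
      unfolding uword.simps by (intro alg_class_cong(1) alg_mult_laws)
    finally show "ucl (uder h (uword (v # w))) = ucl (Scale (pairing (wt (v # w)) h) (uword (v # w)))"
      unfolding wt_simps pairing_simps by (simp only: alg_scale_laws(1))
  qed
qed

lemma u_comm:
  assumes "u \<noteq> v" "\<not> E u v"
  shows "ucl (Mult (inc (eg u)) (inc (eg v))) = ucl (Mult (inc (eg v)) (inc (eg u)))"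
proof -
  have "inc (Mult (eg u) (eg v)) = inc Zero" unfolding inc_def cls_ee[OF assms] ..
  then have "ucl (Add (Mult (inc (eg u)) (inc (eg v))) (Scale (-1) (Mult (inc (eg v)) (inc (eg u))))) = ucl Zero"
    using u_inc(3)[OF Pos_e Pos_e, of u v] u_inc_Zero by simp
  from alg_eq_neg[OF this] show ?thesis by (simp add: alg_scale_laws)
qed

lemma uword_comm_eq: "comm_eq E w w' \<Longrightarrow> ucl (uword w) = ucl (uword w')"
proof (induction rule: comm_eq.induct)
  case (comm_swap u v a b w)
  have "ucl (Mult (inc (eg u)) (Mult (inc (eg v)) (uword b))) = ucl (Mult (Mult (inc (eg u)) (inc (eg v))) (uword b))"
    by (rule u_assoc[symmetric])
  also have "\<dots> = ucl (Mult (Mult (inc (eg v)) (inc (eg u))) (uword b))"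
    by (rule alg_class_cong(2)[OF u_comm[OF comm_swap.hyps(1,2)] HOL.refl])
  also have "\<dots> = ucl (Mult (inc (eg v)) (Mult (inc (eg u)) (uword b)))" by (rule u_assoc)
  finally have "ucl (uword (u # v # b)) = ucl (uword (v # u # b))" by simp
  then have "ucl (Mult (uword a) (uword (u # v # b))) = ucl (Mult (uword a) (uword (v # u # b)))"
    by (rule alg_class_cong(2)[OF HOL.refl])
  then have "ucl (uword (a @ u # v # b)) = ucl (uword (a @ v # u # b))" by (simp only: uword_append)
  then show ?case using comm_swap.IH by simp
qed simp

subsection \<open>The multilinear weight space of the enveloping algebra\<close>

text \<open>On Serre functions the representative chosen for a class does not matter, because
  \<open>evl\<close> respects the Lie relations there.\<close>

primrec uea_op :: "('d, 'v) km_elem uea_gen \<Rightarrow> 'v op" where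
  "uea_op Unit = (\<lambda>\<phi>. \<phi>)"
| "uea_op (Inc x) = evl (SOME t. cls t = x)"

abbreviation "evu \<equiv> ev 0 uea_op"

lemma uea_word_action: "word_action uea_op serre_functions"
proof
  show "op_linear (uea_op x)" for x
    by (cases x) (simp_all add: word_action.ev_linear[OF km_word_action], simp add: op_linear_def)
  show "uea_op x \<phi> \<in> serre_functions" if "\<phi> \<in> serre_functions" for \<phi> x
    using that by (cases x) (simp_all add: word_action.ev_J[OF km_word_action])
qed (rule serre_subspace)

lemma uea_op_inc:
  assumes "\<phi> \<in> serre_functions" shows "uea_op (Inc (cls t)) \<phi> = evl t \<phi>"
proof -
  have "cls (SOME s. cls s = cls t) = cls t" by (rule someI[of _ t]) simp
  then have "((SOME s. cls s = cls t), t) \<in> alg_cong rels" by (simp only: alg_class_eq_iff)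
  have "evl (SOME s. cls s = cls t) \<phi> = evl t \<phi>"
    by (rule word_action.ev_cong[OF km_word_action]) (rule evl_rels, assumption+, fact+)
  then show ?thesis by (simp only: uea_op.simps)
qed

lemma evl_J: "\<phi> \<in> serre_functions \<Longrightarrow> evl t \<phi> \<in> serre_functions"
  by (rule word_action.ev_J[OF km_word_action])

text \<open>The two values of the product parameter meet here: a Lie bracket acts under
  \<open>evl\<close> as a commutator, which is the difference of two plain compositions under
  \<open>evu\<close>.\<close>

lemma evu_rels:
  assumes "(s, t) \<in> URel" "\<phi> \<in> serre_functions"
  shows "evu s \<phi> = evu t \<phi>"
  using assms(1) unfolding uea_cong_rel_def
proof
  assume "(s, t) \<in> unital_associative_laws"
  then show ?thesis unfolding unital_associative_laws_def by auto
next
  assume "(s, t) \<in> uea_relations nplus"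
  then consider
      x y where "x \<in> carrier nplus" "y \<in> carrier nplus" "s = Gen (Inc (x \<oplus>\<^bsub>nplus\<^esub> y))" "t = Add (Gen (Inc x)) (Gen (Inc y))"
    | c x where "x \<in> carrier nplus" "s = Gen (Inc (c \<odot>\<^bsub>nplus\<^esub> x))" "t = Scale c (Gen (Inc x))"
    | x y where "x \<in> carrier nplus" "y \<in> carrier nplus" "s = Gen (Inc (x \<otimes>\<^bsub>nplus\<^esub> y))"
        "t = Add (Mult (Gen (Inc x)) (Gen (Inc y))) (Scale (-1) (Mult (Gen (Inc y)) (Gen (Inc x))))"
    unfolding uea_relations_def by blast
  then show ?thesis
  proof cases
    case 1
    then obtain a b where ab: "x = cls a" "y = cls b" unfolding carrier_nplus by blast
    have "evu s \<phi> = uea_op (Inc (cls (Add a b))) \<phi>"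
      unfolding 1(3) ab nplus_ops alg_class_simps(1) by simp
    also have "\<dots> = evu t \<phi>"
      unfolding uea_op_inc[OF assms(2)] 1(4) ab ev.simps uea_op_inc[OF assms(2)] by simp
    finally show ?thesis .
  next
    case 2
    then obtain a where a: "x = cls a" unfolding carrier_nplus by blast
    have "evu s \<phi> = uea_op (Inc (cls (Scale c a))) \<phi>"
      unfolding 2(2) a nplus_ops alg_class_simps(3) by simp
    also have "\<dots> = evu t \<phi>"
      unfolding uea_op_inc[OF assms(2)] 2(3) a ev.simps uea_op_inc[OF assms(2)] by simp
    finally show ?thesis .
  next
    case 3
    then obtain a b where ab: "x = cls a" "y = cls b" unfolding carrier_nplus by blast
    have "evu s \<phi> = uea_op (Inc (cls (Mult a b))) \<phi>"
      unfolding 3(3) ab nplus_ops alg_class_simps(2) by simp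
    also have "\<dots> = evu t \<phi>"
      unfolding uea_op_inc[OF assms(2)] 3(4) ab ev.simps uea_op_inc[OF assms(2)]
        uea_op_inc[OF evl_J[OF assms(2)]] by simp
    finally show ?thesis .
  qed
qed

lemma evu_uword: "\<phi> \<in> serre_functions \<Longrightarrow> evu (uword w) \<phi> u = \<phi> (w @ u)"
proof (induction w arbitrary: \<phi>)
  case (Cons v w)
  have "evu (inc (eg v)) \<phi> = e_op v \<phi>"
    using uea_op_inc[OF Cons.prems, of "eg v"] by (simp add: inc_def)
  then show ?case using Cons.IH[OF e_op_serre[OF Cons.prems, of v]] by simp
qed simp

definition word_rep :: "('v \<times> 'v) set \<Rightarrow> 'v list" where
  "word_rep D = (SOME w. distinct w \<and> set w = UNIV \<and> orient E w = D)"

lemma word_rep: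
  assumes "D \<in> orientations_on E UNIV"
  shows "distinct (word_rep D)" "set (word_rep D) = UNIV" "orient E (word_rep D) = D"
  using someI_ex[OF orientation_word[OF assms]] unfolding word_rep_def by blast+

text \<open>Words of this weight list every vertex once, and words with the same orientation have
  the same class; evaluating the indicators of orientations at the empty word tells the remaining
  ones apart.\<close>

theorem dim_uea_weight_space:
  "vectorspace.dim complex_field (uea_n_plus_weight_space B \<alpha> \<alpha>v (\<Sum>i\<in>UNIV. \<alpha> i)) = card (acyclic_orientations E)"
proof -
  let ?I = "orientations_on E UNIV" and ?b = "\<lambda>D. uword (word_rep D)"
  let ?V = "uea_n_plus_weight_space B \<alpha> \<alpha>v (\<Sum>i\<in>UNIV. \<alpha> i)"
  let ?\<mu> = "pairing (root_lattice_vec \<alpha> (ind UNIV))"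
  have ops: "x \<oplus>\<^bsub>?V\<^esub> y = x \<oplus>\<^bsub>presented_algebra UNIV URel\<^esub> y" "c \<odot>\<^bsub>?V\<^esub> x = c \<odot>\<^bsub>presented_algebra UNIV URel\<^esub> x"
    "\<zero>\<^bsub>?V\<^esub> = \<zero>\<^bsub>presented_algebra UNIV URel\<^esub>" for x y c
    by (simp_all add: uea_n_plus_weight_space_def weight_space_def uea_def presented_algebra_def)
  have car: "x \<in> carrier ?V \<longleftrightarrow> (\<exists>t. x = ucl t \<and> set_alg_term t \<subseteq> Ugen \<and> uact.has_weight ?\<mu> t)" for x
  proof -
    have smult: "c \<odot>\<^bsub>uea nplus\<^esub> y = c \<odot>\<^bsub>presented_algebra UNIV URel\<^esub> y" for c y
      by (simp add: uea_def presented_algebra_def)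
    have carU: "carrier (uea nplus) = ucl ` {t. set_alg_term t \<subseteq> Ugen}"
      by (simp add: uea_def carrier_presented_algebra)
    have wt: "(\<forall>h. uea_derivation nplus (ad_h B \<alpha> \<alpha>v h) (ucl t) = ?\<mu> h \<odot>\<^bsub>uea nplus\<^esub> ucl t) \<longleftrightarrow> uact.has_weight ?\<mu> t" for t
      unfolding uact.has_weight_def uea_derivation_ucl smult alg_class_simps(3) ..
    have "carrier ?V = {x \<in> carrier (uea nplus). \<forall>h. uea_derivation nplus (ad_h B \<alpha> \<alpha>v h) x = ?\<mu> h \<odot>\<^bsub>uea nplus\<^esub> x}"
      by (simp add: uea_n_plus_weight_space_def weight_space_def sum_roots)
    then have "x \<in> carrier ?V \<longleftrightarrow> (\<exists>t. x = ucl t \<and> set_alg_term t \<subseteq> Ugen \<and>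
        (\<forall>h. uea_derivation nplus (ad_h B \<alpha> \<alpha>v h) x = ?\<mu> h \<odot>\<^bsub>uea nplus\<^esub> x))"
      unfolding carU by (simp only: mem_Collect_eq image_iff) blast
    also have "\<dots> \<longleftrightarrow> (\<exists>t. x = ucl t \<and> set_alg_term t \<subseteq> Ugen \<and> uact.has_weight ?\<mu> t)"
    proof (intro arg_cong[where f = Ex] ext conj_cong HOL.refl)
      fix t assume x: "x = ucl t"
      show "(\<forall>h. uea_derivation nplus (ad_h B \<alpha> \<alpha>v h) x = ?\<mu> h \<odot>\<^bsub>uea nplus\<^esub> x) \<longleftrightarrow> uact.has_weight ?\<mu> t"
        unfolding x by (rule wt)
    qed
    finally show ?thesis .
  qed
  \<comment> \<open>Spans are closed under the congruence, so a term in the span may contain foreign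
    generators; the carrier demands a representative without them.\<close>
  have Ugen_rep: "\<exists>s. ucl t = ucl s \<and> set_alg_term s \<subseteq> Ugen" if "t \<in> tspan URel (?b ` ?I)" for t
    using that
  proof induction
    case tspan_Zero
    show ?case by (intro exI[of _ Zero]) simp
  next
    case (tspan_base a)
    have "set_alg_term (uword w) \<subseteq> Ugen" for w
      using Pos_e by (induction w) (auto simp: inc_def carrier_nplus)
    then show ?case using tspan_base by blast
  next
    case (tspan_Add s t)
    then obtain s' t' where "ucl s = ucl s'" "set_alg_term s' \<subseteq> Ugen" "ucl t = ucl t'" "set_alg_term t' \<subseteq> Ugen" by blast
    then show ?case by (intro exI[of _ "Add s' t'"] conjI alg_class_cong(1)) simp_all
  next
    case (tspan_Scale t c)
    then obtain t' where "ucl t = ucl t'" "set_alg_term t' \<subseteq> Ugen" by blast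
    then show ?case by (intro exI[of _ "Scale c t'"] conjI alg_class_cong(3)) simp_all
  next
    case (tspan_cong s t)
    then have "ucl s = ucl t" by (simp add: alg_class_eq_iff)
    then show ?case using tspan_cong.IH by simp
  qed
  have weight_b: "uact.has_weight ?\<mu> t" if "t \<in> tspan URel (?b ` ?I)" for t
  proof (rule uact.has_weight_tspan[OF that])
    fix a assume "a \<in> ?b ` ?I"
    then obtain D where D: "D \<in> ?I" "a = ?b D" by blast
    have "count_list (word_rep D) = ind UNIV"
      unfolding count_list_ind using word_rep(1,2)[OF D(1)] by blast
    then show "uact.has_weight ?\<mu> a" using uword_weight[of "word_rep D"] D(2) by simp
  qed
  have span: "t \<in> tspan URel (?b ` ?I)" if "set_alg_term t \<subseteq> Ugen" "uact.has_weight ?\<mu> t" for t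
  proof -
    have "t \<in> tspan URel (uword ` {w \<in> UNIV. pairing (root_lattice_vec \<alpha> (count_list w)) = ?\<mu>})"
      by (rule uact.weight_component_family[OF UW_all[OF that(1)] uword_weight that(2)])
    then show ?thesis
    proof (rule tspan_sub, intro subsetI)
      fix a assume "a \<in> uword ` {w \<in> UNIV. pairing (root_lattice_vec \<alpha> (count_list w)) = ?\<mu>}"
      then obtain w where w: "a = uword w" "pairing (root_lattice_vec \<alpha> (count_list w)) = ?\<mu>" by auto
      have "root_lattice_vec \<alpha> (count_list w) = root_lattice_vec \<alpha> (ind UNIV)"
        by (rule pairing_eqD) (simp add: w(2))
      then have dw: "distinct w" "set w = UNIV" using root_lattice_vec_inj count_list_ind by blast+
      let ?D = "orient E w"
      have D: "?D \<in> ?I" using orient_mem[OF dw(1)] dw(2) by simp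
      have "comm_eq E w (word_rep ?D)"
        by (rule comm_eq_orient) (use dw word_rep[OF D] in simp_all)
      then have "ucl a = ucl (?b ?D)" unfolding w(1) by (rule uword_comm_eq)
      then show "a \<in> tspan URel (?b ` ?I)" by (rule tspan_eq) (intro tspan_base imageI D)
    qed
  qed
  have "vectorspace.dim complex_field ?V = card ?I"
  proof (rule dim_terms[where R = URel and b = ?b and \<psi> = "\<lambda>D t. evu t (word_indicator UNIV D) []"])
    show "carrier ?V = ucl ` tspan URel (?b ` ?I)"
    proof (intro equalityI subsetI)
      fix x assume "x \<in> carrier ?V"
      then show "x \<in> ucl ` tspan URel (?b ` ?I)" unfolding car using span by blast
    next
      fix x assume "x \<in> ucl ` tspan URel (?b ` ?I)"
      then obtain t where t: "x = ucl t" "t \<in> tspan URel (?b ` ?I)" by blast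
      obtain s where s: "ucl t = ucl s" "set_alg_term s \<subseteq> Ugen" using Ugen_rep[OF t(2)] by blast
      have "s \<in> tspan URel (?b ` ?I)" by (rule tspan_eq[OF s(1)[symmetric] t(2)])
      then show "x \<in> carrier ?V" unfolding car using weight_b s t(1) by blast
    qed
    show "term_functional URel (\<lambda>t. evu t (word_indicator UNIV D) [])" for D
      by (rule word_action.term_functional_ev[OF uea_word_action evu_rels word_indicator_serre])
    show "evu (?b D') (word_indicator UNIV D) [] = (if D = D' then 1 else 0)" if "D \<in> ?I" "D' \<in> ?I" for D D'
      using word_rep[OF that(2)] by (auto simp: evu_uword[OF word_indicator_serre] word_indicator_def)
  qed (simp_all add: ops)
  then show ?thesis by simp
qed

end

theorem corollary1p3:
  fixes E :: "'v::finite \<Rightarrow> 'v \<Rightarrow> bool"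
    and \<alpha> \<alpha>v :: "'v \<Rightarrow> complex^'d"
  assumes "symp E" and "irreflp E"
    and "minimal_realization (cartan_matrix E) \<alpha> \<alpha>v"
  shows "(int (card (acyclic_orientations E)) = kostant_partition (cartan_matrix E) \<alpha> \<alpha>v (\<lambda>_. 1) \<and>
          card (coxeter_elements \<alpha> \<alpha>v) =
            vectorspace.dim complex_field
              (uea_n_plus_weight_space (cartan_matrix E) \<alpha> \<alpha>v (\<Sum>i\<in>UNIV. \<alpha> i))) \<and>
         (connected_graph E \<longrightarrow>
            card (conjugacy_class (weyl_group \<alpha> \<alpha>v) ` coxeter_elements \<alpha> \<alpha>v) =
              vectorspace.dim complex_field
                (n_plus_weight_space (cartan_matrix E) \<alpha> \<alpha>v (\<Sum>i\<in>UNIV. \<alpha> i)) \<and>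
            vectorspace.dim complex_field
                (n_plus_weight_space (cartan_matrix E) \<alpha> \<alpha>v (\<Sum>i\<in>UNIV. \<alpha> i)) =
              root_mult (cartan_matrix E) \<alpha> \<alpha>v (\<Sum>i\<in>UNIV. \<alpha> i))"
proof -
  interpret simply_laced E \<alpha> \<alpha>v
  proof
    show "E v u" if "E u v" for u v using assms(1) that by (rule sympD)
    show "\<not> E u u" for u using assms(2) by (rule irreflpD)
    show "pairing (\<alpha> j) (\<alpha>v i) = (if i = j then 2 else if E i j then - 1 else 0)" for i j
      using assms(3) irreflpD[OF assms(2)]
      by (auto simp: minimal_realization_def cartan_matrix_def adjacency_matrix_def Finite_Cartesian_Product.mat_def)
  qed (use assms(3) in \<open>auto simp: minimal_realization_def\<close>)
  \<comment> \<open>The vertex \<open>r\<close> is free, and the same count at the same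
    \<open>r\<close> enumerates the conjugacy classes.\<close>
  have "root_mult (cartan_matrix E) \<alpha> \<alpha>v (\<Sum>i\<in>UNIV. \<alpha> i) = card (rooted_orientations E UNIV r)" for r
    unfolding sum_roots by (rule root_mult_ind) simp
  then show ?thesis
    using kostant_orientations card_coxeter_elements dim_uea_weight_space card_conjugacy_classes
    by (simp add: n_plus_weight_space_eq root_mult_def)
qed

end
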